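(* Let $X$ and $Y$ be simplicial sets and $f\colon X\to Y$ a map of simplicial sets. Let $\mathcal{A}$ be a cocomplete abelian category with exact coproducts. Given a contravariant Gabriel-Zisman natural system $T\colon(\Delta/X)^{op}\to\mathcal{A}$ on $X$, there is a homology spectral sequence $$E^2_{p,q}\cong H^{GZ}_p\bigl(Y,(L_q((\Delta/f)^{op})_* )(T)\bigr)\Rightarrow H^{GZ}_{p+q}(X,T)$$ which is natural in $f$ and $T$, where $L_q((\Delta/f)^{op})_*=\mathrm{Lan}_q^{(\Delta/f)^{op}}$ is the $q$-th left satellite of $\mathrm{Lan}^{(\Delta/f)^{op}}$, the left Kan extension along the induced functor $(\Delta/f)^{op}\colon(\Delta/X)^{op}\to(\Delta/Y)^{op}$ between the simplex categories.
   Context: $\Delta$ is the category of finite ordinals $[m]=\{0<\dots<m\}$ and order-preserving maps; $\delta^i\colon[n]\to[n+1]$ are the coface maps; $\Delta[m]=\mathrm{Hom}_\Delta(-,[m])$. For a simplicial set $X$, the simplex category $\Delta/X$ has as objects the pairs $([m],x)$ with $x\colon\Delta[m]\to X$ (equivalently $x\in X_m$), and a morphism $([m],x)\to([m'],x')$ is a morphism $\theta\colon[m]\to[m']$ of $\Delta$ with $x=x'\circ\theta$. A map $f\colon X\to Y$ induces the functor $\Delta/f\colon\Delta/X\to\Delta/Y$, $x\mapsto f\circ x$. A contravariant Gabriel-Zisman natural system on $X$ with values in $\mathcal{A}$ is a functor $T\colon(\Delta/X)^{op}\to\mathcal{A}$. For $\mathcal{A}$ cocomplete abelian with exact coproducts,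 the Gabriel-Zisman homology $H_n^{GZ}(X,T)$ is the $n$-th homology of the chain complex $C_n^{GZ}(X,T)=\bigoplus_{\sigma\in X_n}T(\sigma)$ with differential $C_{n+1}^{GZ}\to C_n^{GZ}$ given on the summand $T(\sigma)$, $\sigma\in X_{n+1}$, by $\sum_{i=0}^{n+1}(-1)^i(\delta^i)^\#$, where $(\delta^i)^\#\colon T(\sigma)\to T(\sigma\circ\delta^i)$ is induced by $\delta^i$. $\mathrm{Lan}^{(\Delta/f)^{op}}\colon\mathrm{Fun}((\Delta/X)^{op},\mathcal{A})\to\mathrm{Fun}((\Delta/Y)^{op},\mathcal{A})$ is the left adjoint of precomposition with $(\Delta/f)^{op}$; its $q$-th left satellite is its $q$-th left derived functor. *)

theory Defs
  imports Main "HOL-Library.FuncSet"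
begin

section \<open>Categories and functors\<close>

text \<open>
  An arrow knows its domain and codomain; \<open>Comp C g f\<close> is ``\<open>g\<close> after \<open>f\<close>''.
  Functors and natural transformations are extensional (\<open>undefined\<close> outside their domain), so that
  equality of functors is the mathematical one and functor categories are honest categories.
\<close>

record ('o, 'a) category =
  Obj :: "'o set"
  Arr :: "'a set"
  Dom :: "'a \<Rightarrow> 'o"
  Cod :: "'a \<Rightarrow> 'o"
  Ident :: "'o \<Rightarrow> 'a"
  Comp :: "'a \<Rightarrow> 'a \<Rightarrow> 'a"

record ('o, 'a) abcat = "('o, 'a) category" +
  Add :: "'a \<Rightarrow> 'a \<Rightarrow> 'a"
  Zero :: "'o \<Rightarrow> 'o \<Rightarrow> 'a"

record ('o, 'a, 'p, 'b) ftor =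
  onob :: "'o \<Rightarrow> 'p"
  onar :: "'a \<Rightarrow> 'b"

definition Hom :: "('o, 'a, 'z) category_scheme \<Rightarrow> 'o \<Rightarrow> 'o \<Rightarrow> 'a set" where
  "Hom C x y = {f \<in> Arr C. Dom C f = x \<and> Cod C f = y}"

definition is_category :: "('o, 'a, 'z) category_scheme \<Rightarrow> bool" where
  "is_category C \<longleftrightarrow>
     (\<forall>f\<in>Arr C. Dom C f \<in> Obj C \<and> Cod C f \<in> Obj C) \<and>
     (\<forall>x\<in>Obj C. Ident C x \<in> Hom C x x) \<and>
     (\<forall>f\<in>Arr C. \<forall>g\<in>Arr C. Cod C f = Dom C g \<longrightarrow> Comp C g f \<in> Hom C (Dom C f) (Cod C g)) \<and>
     (\<forall>f\<in>Arr C. Comp C f (Ident C (Dom C f)) = f \<and> Comp C (Ident C (Cod C f)) f = f) \<and>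
     (\<forall>f\<in>Arr C. \<forall>g\<in>Arr C. \<forall>h\<in>Arr C. Cod C f = Dom C g \<and> Cod C g = Dom C h \<longrightarrow>
        Comp C h (Comp C g f) = Comp C (Comp C h g) f)"

definition opcat :: "('o, 'a, 'z) category_scheme \<Rightarrow> ('o, 'a) category" where
  "opcat C = \<lparr>Obj = Obj C, Arr = Arr C, Dom = Cod C, Cod = Dom C, Ident = Ident C,
              Comp = (\<lambda>g f. Comp C f g)\<rparr>"

definition is_functor ::
  "('o, 'a, 'y) category_scheme \<Rightarrow> ('p, 'b, 'z) category_scheme \<Rightarrow> ('o, 'a, 'p, 'b) ftor \<Rightarrow> bool" where
  "is_functor C D F \<longleftrightarrow>
     onob F \<in> Obj C \<rightarrow>\<^sub>E Obj D \<and> onar F \<in> Arr C \<rightarrow>\<^sub>E Arr D \<and>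
     (\<forall>f\<in>Arr C. onar F f \<in> Hom D (onob F (Dom C f)) (onob F (Cod C f))) \<and>
     (\<forall>x\<in>Obj C. onar F (Ident C x) = Ident D (onob F x)) \<and>
     (\<forall>f\<in>Arr C. \<forall>g\<in>Arr C. Cod C f = Dom C g \<longrightarrow>
        onar F (Comp C g f) = Comp D (onar F g) (onar F f))"

text \<open>The first argument is the domain of the inner functor \<open>F\<close>.\<close>

definition comp_functor ::
  "('o, 'a, 'z) category_scheme \<Rightarrow> ('p, 'b, 'q, 'c) ftor \<Rightarrow> ('o, 'a, 'p, 'b) ftor \<Rightarrow> ('o, 'a, 'q, 'c) ftor" where
  "comp_functor C G F = \<lparr>onob = (\<lambda>x\<in>Obj C. onob G (onob F x)),
                         onar = (\<lambda>f\<in>Arr C. onar G (onar F f))\<rparr>"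

definition is_nat ::
  "('o, 'a, 'y) category_scheme \<Rightarrow> ('p, 'b, 'z) category_scheme \<Rightarrow>
   ('o, 'a, 'p, 'b) ftor \<Rightarrow> ('o, 'a, 'p, 'b) ftor \<Rightarrow> ('o \<Rightarrow> 'b) \<Rightarrow> bool" where
  "is_nat C D F G \<eta> \<longleftrightarrow>
     \<eta> \<in> extensional (Obj C) \<and>
     (\<forall>x\<in>Obj C. \<eta> x \<in> Hom D (onob F x) (onob G x)) \<and>
     (\<forall>f\<in>Arr C. Comp D (onar G f) (\<eta> (Dom C f)) = Comp D (\<eta> (Cod C f)) (onar F f))"

definition is_mono :: "('o, 'a, 'z) category_scheme \<Rightarrow> 'a \<Rightarrow> bool" where
  "is_mono C f \<longleftrightarrow> f \<in> Arr C \<and>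
     (\<forall>g\<in>Arr C. \<forall>h\<in>Arr C. Cod C g = Dom C f \<and> Cod C h = Dom C f \<and> Dom C g = Dom C h \<and>
        Comp C f g = Comp C f h \<longrightarrow> g = h)"

definition is_epi :: "('o, 'a, 'z) category_scheme \<Rightarrow> 'a \<Rightarrow> bool" where
  "is_epi C f \<longleftrightarrow> f \<in> Arr C \<and>
     (\<forall>g\<in>Arr C. \<forall>h\<in>Arr C. Dom C g = Cod C f \<and> Dom C h = Cod C f \<and> Cod C g = Cod C h \<and>
        Comp C g f = Comp C h f \<longrightarrow> g = h)"

definition is_iso :: "('o, 'a, 'z) category_scheme \<Rightarrow> 'a \<Rightarrow> bool" where
  "is_iso C f \<longleftrightarrow> f \<in> Arr C \<and>
     (\<exists>g\<in>Hom C (Cod C f) (Dom C f). Comp C g f = Ident C (Dom C f) \<and> Comp C f g = Ident C (Cod C f))"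

definition zero_object :: "('o, 'a, 'z) category_scheme \<Rightarrow> 'o \<Rightarrow> bool" where
  "zero_object C z \<longleftrightarrow> z \<in> Obj C \<and> (\<forall>x\<in>Obj C. (\<exists>!f. f \<in> Hom C x z) \<and> (\<exists>!f. f \<in> Hom C z x))"

subsection \<open>Colimits and coproducts\<close>

definition is_cocone ::
  "('i, 'j, 'y) category_scheme \<Rightarrow> ('o, 'a, 'z) category_scheme \<Rightarrow> ('i, 'j, 'o, 'a) ftor \<Rightarrow>
   'o \<Rightarrow> ('i \<Rightarrow> 'a) \<Rightarrow> bool" where
  "is_cocone J A D c \<iota> \<longleftrightarrow> c \<in> Obj A \<and>
     (\<forall>i\<in>Obj J. \<iota> i \<in> Hom A (onob D i) c) \<and>
     (\<forall>j\<in>Arr J. Comp A (\<iota> (Cod J j)) (onar D j) = \<iota> (Dom J j))"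

definition is_colimit ::
  "('i, 'j, 'y) category_scheme \<Rightarrow> ('o, 'a, 'z) category_scheme \<Rightarrow> ('i, 'j, 'o, 'a) ftor \<Rightarrow>
   'o \<Rightarrow> ('i \<Rightarrow> 'a) \<Rightarrow> bool" where
  "is_colimit J A D c \<iota> \<longleftrightarrow> is_cocone J A D c \<iota> \<and>
     (\<forall>c' \<kappa>. is_cocone J A D c' \<kappa> \<longrightarrow> (\<exists>!u. u \<in> Hom A c c' \<and> (\<forall>i\<in>Obj J. Comp A u (\<iota> i) = \<kappa> i)))"

text \<open>
  The type \<open>'u\<close> plays the role of the universe of small sets: ``small'' means ``indexed by a subset
  of \<open>'u\<close>''. Simplicial sets below also take their simplices from \<open>'u\<close>, and \<open>'u\<close> is an arbitrary
  infinite type. Thus only colimits of the size of the given simplicial sets are required.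
\<close>

definition cocomplete :: "'u itself \<Rightarrow> ('o, 'a, 'z) category_scheme \<Rightarrow> bool" where
  "cocomplete _ A \<longleftrightarrow>
     (\<forall>(J :: ('u, 'u) category) D. is_category J \<and> is_functor J A D \<longrightarrow> (\<exists>c \<iota>. is_colimit J A D c \<iota>))"

definition is_coproduct ::
  "('o, 'a, 'z) category_scheme \<Rightarrow> 'i set \<Rightarrow> ('i \<Rightarrow> 'o) \<Rightarrow> 'o \<Rightarrow> ('i \<Rightarrow> 'a) \<Rightarrow> bool" where
  "is_coproduct A I D c \<iota> \<longleftrightarrow> c \<in> Obj A \<and> (\<forall>i\<in>I. \<iota> i \<in> Hom A (D i) c) \<and>
     (\<forall>x\<in>Obj A. \<forall>h. (\<forall>i\<in>I. h i \<in> Hom A (D i) x) \<longrightarrow>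
        (\<exists>!u. u \<in> Hom A c x \<and> (\<forall>i\<in>I. Comp A u (\<iota> i) = h i)))"

definition coprod_sel :: "('o, 'a, 'z) category_scheme \<Rightarrow> 'i set \<Rightarrow> ('i \<Rightarrow> 'o) \<Rightarrow> 'o \<times> ('i \<Rightarrow> 'a)" where
  "coprod_sel A I D = (SOME (c, \<iota>). is_coproduct A I D c \<iota>)"

definition coprod :: "('o, 'a, 'z) category_scheme \<Rightarrow> 'i set \<Rightarrow> ('i \<Rightarrow> 'o) \<Rightarrow> 'o" where
  "coprod A I D = fst (coprod_sel A I D)"

definition coprod_inj :: "('o, 'a, 'z) category_scheme \<Rightarrow> 'i set \<Rightarrow> ('i \<Rightarrow> 'o) \<Rightarrow> 'i \<Rightarrow> 'a" where
  "coprod_inj A I D = snd (coprod_sel A I D)"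

definition cotuple ::
  "('o, 'a, 'z) category_scheme \<Rightarrow> 'i set \<Rightarrow> ('i \<Rightarrow> 'o) \<Rightarrow> 'o \<Rightarrow> ('i \<Rightarrow> 'a) \<Rightarrow> 'a" where
  "cotuple A I D x h =
     (THE u. u \<in> Hom A (coprod A I D) x \<and> (\<forall>i\<in>I. Comp A u (coprod_inj A I D i) = h i))"

definition coprod_map ::
  "('o, 'a, 'z) category_scheme \<Rightarrow> 'i set \<Rightarrow> ('i \<Rightarrow> 'a) \<Rightarrow> 'a" where
  "coprod_map A I f =
     cotuple A I (\<lambda>i. Dom A (f i)) (coprod A I (\<lambda>i. Cod A (f i)))
       (\<lambda>i. Comp A (coprod_inj A I (\<lambda>i. Cod A (f i)) i) (f i))"

section \<open>Abelian categories\<close>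

definition is_kernel :: "('o, 'a, 'z) abcat_scheme \<Rightarrow> 'a \<Rightarrow> 'a \<Rightarrow> bool" where
  "is_kernel A g k \<longleftrightarrow> g \<in> Arr A \<and> k \<in> Arr A \<and> Cod A k = Dom A g \<and>
     Comp A g k = Zero A (Dom A k) (Cod A g) \<and>
     (\<forall>h\<in>Arr A. Cod A h = Dom A g \<and> Comp A g h = Zero A (Dom A h) (Cod A g) \<longrightarrow>
        (\<exists>!u. u \<in> Hom A (Dom A h) (Dom A k) \<and> Comp A k u = h))"

definition is_cokernel :: "('o, 'a, 'z) abcat_scheme \<Rightarrow> 'a \<Rightarrow> 'a \<Rightarrow> bool" where
  "is_cokernel A f c \<longleftrightarrow> f \<in> Arr A \<and> c \<in> Arr A \<and> Dom A c = Cod A f \<and>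
     Comp A c f = Zero A (Dom A f) (Cod A c) \<and>
     (\<forall>h\<in>Arr A. Dom A h = Cod A f \<and> Comp A h f = Zero A (Dom A f) (Cod A h) \<longrightarrow>
        (\<exists>!u. u \<in> Hom A (Cod A c) (Cod A h) \<and> Comp A u c = h))"

definition is_preadditive :: "('o, 'a, 'z) abcat_scheme \<Rightarrow> bool" where
  "is_preadditive A \<longleftrightarrow> is_category A \<and>
     (\<forall>x\<in>Obj A. \<forall>y\<in>Obj A.
        Zero A x y \<in> Hom A x y \<and>
        (\<forall>f\<in>Hom A x y. \<forall>g\<in>Hom A x y. Add A f g \<in> Hom A x y \<and> Add A f g = Add A g f) \<and>
        (\<forall>f\<in>Hom A x y. \<forall>g\<in>Hom A x y. \<forall>h\<in>Hom A x y. Add A (Add A f g) h = Add A f (Add A g h)) \<and>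
        (\<forall>f\<in>Hom A x y. Add A f (Zero A x y) = f \<and> (\<exists>g\<in>Hom A x y. Add A f g = Zero A x y))) \<and>
     (\<forall>x\<in>Obj A. \<forall>y\<in>Obj A. \<forall>z\<in>Obj A.
        \<forall>f\<in>Hom A x y. \<forall>f'\<in>Hom A x y. \<forall>g\<in>Hom A y z. \<forall>g'\<in>Hom A y z.
          Comp A g (Add A f f') = Add A (Comp A g f) (Comp A g f') \<and>
          Comp A (Add A g g') f = Add A (Comp A g f) (Comp A g' f))"

definition is_abelian :: "('o, 'a, 'z) abcat_scheme \<Rightarrow> bool" where
  "is_abelian A \<longleftrightarrow> is_preadditive A \<and>
     (\<exists>z. zero_object A z) \<and>
     (\<forall>x\<in>Obj A. \<forall>y\<in>Obj A. \<exists>c \<iota>. is_coproduct A UNIV (\<lambda>b. if b then x else y) c \<iota>) \<and>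
     (\<forall>f\<in>Arr A. (\<exists>k. is_kernel A f k) \<and> (\<exists>c. is_cokernel A f c)) \<and>
     (\<forall>f. is_mono A f \<longrightarrow> (\<exists>g. is_kernel A g f)) \<and>
     (\<forall>f. is_epi A f \<longrightarrow> (\<exists>g. is_cokernel A g f))"

definition Neg :: "('o, 'a, 'z) abcat_scheme \<Rightarrow> 'a \<Rightarrow> 'a" where
  "Neg A f = (THE g. g \<in> Hom A (Dom A f) (Cod A f) \<and> Add A f g = Zero A (Dom A f) (Cod A f))"

primrec hom_sum :: "('o, 'a, 'z) abcat_scheme \<Rightarrow> 'o \<Rightarrow> 'o \<Rightarrow> (nat \<Rightarrow> 'a) \<Rightarrow> nat \<Rightarrow> 'a" where
  "hom_sum A x y h 0 = Zero A x y"
| "hom_sum A x y h (Suc n) = Add A (hom_sum A x y h n) (h n)"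

definition short_exact :: "('o, 'a, 'z) abcat_scheme \<Rightarrow> 'a \<Rightarrow> 'a \<Rightarrow> bool" where
  "short_exact A f g \<longleftrightarrow> is_kernel A g f \<and> is_cokernel A f g"

definition exact_coproducts :: "'u itself \<Rightarrow> ('o, 'a, 'z) abcat_scheme \<Rightarrow> bool" where
  "exact_coproducts _ A \<longleftrightarrow>
     (\<forall>(I :: 'u set) f g. (\<forall>i\<in>I. short_exact A (f i) (g i)) \<longrightarrow>
        short_exact A (coprod_map A I f) (coprod_map A I g))"

definition additive_functor ::
  "('o, 'a, 'y) abcat_scheme \<Rightarrow> ('p, 'b, 'z) abcat_scheme \<Rightarrow> ('o, 'a, 'p, 'b) ftor \<Rightarrow> bool" where
  "additive_functor C D F \<longleftrightarrow> is_functor C D F \<and>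
     (\<forall>x\<in>Obj C. \<forall>y\<in>Obj C. \<forall>f\<in>Hom C x y. \<forall>g\<in>Hom C x y.
        onar F (Add C f g) = Add D (onar F f) (onar F g))"

subsection \<open>Homology\<close>

definition ker :: "('o, 'a, 'z) abcat_scheme \<Rightarrow> 'a \<Rightarrow> 'a" where
  "ker A g = (SOME k. is_kernel A g k)"

definition cok :: "('o, 'a, 'z) abcat_scheme \<Rightarrow> 'a \<Rightarrow> 'a" where
  "cok A f = (SOME c. is_cokernel A f c)"

definition ker_lift :: "('o, 'a, 'z) abcat_scheme \<Rightarrow> 'a \<Rightarrow> 'a \<Rightarrow> 'a" where
  "ker_lift A g h = (THE u. u \<in> Hom A (Dom A h) (Dom A (ker A g)) \<and> Comp A (ker A g) u = h)"

definition cok_desc :: "('o, 'a, 'z) abcat_scheme \<Rightarrow> 'a \<Rightarrow> 'a \<Rightarrow> 'a" where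
  "cok_desc A f h = (THE u. u \<in> Hom A (Cod A (cok A f)) (Cod A h) \<and> Comp A u (cok A f) = h)"

text \<open>
  Homology at the middle of \<open>x --f--> y --g--> z\<close> with \<open>g f = 0\<close>: the cokernel of the
  factorisation of \<open>f\<close> through the kernel of \<open>g\<close>. \<open>homol_map\<close> is the map induced by \<open>v: y \<rightarrow> y'\<close>.
\<close>

definition homol_proj :: "('o, 'a, 'z) abcat_scheme \<Rightarrow> 'a \<Rightarrow> 'a \<Rightarrow> 'a" where
  "homol_proj A f g = cok A (ker_lift A g f)"

definition homol :: "('o, 'a, 'z) abcat_scheme \<Rightarrow> 'a \<Rightarrow> 'a \<Rightarrow> 'o" where
  "homol A f g = Cod A (homol_proj A f g)"

definition homol_map :: "('o, 'a, 'z) abcat_scheme \<Rightarrow> 'a \<Rightarrow> 'a \<Rightarrow> 'a \<Rightarrow> 'a \<Rightarrow> 'a \<Rightarrow> 'a" where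
  "homol_map A f g f' g' v =
     cok_desc A (ker_lift A g f) (Comp A (homol_proj A f' g') (ker_lift A g' (Comp A v (ker A g))))"

definition exact_at :: "('o, 'a, 'z) abcat_scheme \<Rightarrow> 'a \<Rightarrow> 'a \<Rightarrow> bool" where
  "exact_at A f g \<longleftrightarrow> f \<in> Arr A \<and> g \<in> Arr A \<and> Cod A f = Dom A g \<and>
     Comp A g f = Zero A (Dom A f) (Cod A g) \<and> zero_object A (homol A f g)"

text \<open>
  Non-negatively graded chain complexes: \<open>d n : C (n + 1) \<rightarrow> C n\<close>, and the differential leaving
  degree \<open>0\<close> is zero (its target is irrelevant for homology).
\<close>

definition out_diff :: "('o, 'a, 'z) abcat_scheme \<Rightarrow> (nat \<Rightarrow> 'a) \<Rightarrow> nat \<Rightarrow> 'a" where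
  "out_diff A d n = (case n of 0 \<Rightarrow> Zero A (Cod A (d 0)) (Cod A (d 0)) | Suc k \<Rightarrow> d k)"

definition chain_homology :: "('o, 'a, 'z) abcat_scheme \<Rightarrow> (nat \<Rightarrow> 'a) \<Rightarrow> nat \<Rightarrow> 'o" where
  "chain_homology A d n = homol A (d n) (out_diff A d n)"

definition chain_homology_map ::
  "('o, 'a, 'z) abcat_scheme \<Rightarrow> (nat \<Rightarrow> 'a) \<Rightarrow> (nat \<Rightarrow> 'a) \<Rightarrow> (nat \<Rightarrow> 'a) \<Rightarrow> nat \<Rightarrow> 'a" where
  "chain_homology_map A d d' \<phi> n = homol_map A (d n) (out_diff A d n) (d' n) (out_diff A d' n) (\<phi> n)"

section \<open>Functor categories\<close>

text \<open>An arrow of a functor category is a triple: source, target, components.\<close>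

type_synonym ('o, 'a, 'p, 'b) ntrans = "('o, 'a, 'p, 'b) ftor \<times> ('o, 'a, 'p, 'b) ftor \<times> ('o \<Rightarrow> 'b)"

definition fun_cat ::
  "('o, 'a, 'y) category_scheme \<Rightarrow> ('p, 'b, 'z) abcat_scheme \<Rightarrow>
   (('o, 'a, 'p, 'b) ftor, ('o, 'a, 'p, 'b) ntrans) abcat" where
  "fun_cat C A =
     \<lparr>Obj = {F. is_functor C A F},
      Arr = {(F, G, \<eta>). is_functor C A F \<and> is_functor C A G \<and> is_nat C A F G \<eta>},
      Dom = (\<lambda>(F, G, \<eta>). F),
      Cod = (\<lambda>(F, G, \<eta>). G),
      Ident = (\<lambda>F. (F, F, \<lambda>x\<in>Obj C. Ident A (onob F x))),
      Comp = (\<lambda>(G, H, \<epsilon>) (F, G', \<eta>). (F, H, \<lambda>x\<in>Obj C. Comp A (\<epsilon> x) (\<eta> x))),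
      Add = (\<lambda>(F, G, \<eta>) (F', G', \<epsilon>). (F, G, \<lambda>x\<in>Obj C. Add A (\<eta> x) (\<epsilon> x))),
      Zero = (\<lambda>F G. (F, G, \<lambda>x\<in>Obj C. Zero A (onob F x) (onob G x)))\<rparr>"

definition precomposition ::
  "('o, 'a, 'x) category_scheme \<Rightarrow> ('p, 'b, 'y) category_scheme \<Rightarrow> ('q, 'c, 'z) abcat_scheme \<Rightarrow>
   ('o, 'a, 'p, 'b) ftor \<Rightarrow>
   (('p, 'b, 'q, 'c) ftor, ('p, 'b, 'q, 'c) ntrans, ('o, 'a, 'q, 'c) ftor, ('o, 'a, 'q, 'c) ntrans) ftor" where
  "precomposition C D A K =
     \<lparr>onob = (\<lambda>F\<in>Obj (fun_cat D A). comp_functor C F K),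
      onar = (\<lambda>(F, G, \<eta>)\<in>Arr (fun_cat D A).
                (comp_functor C F K, comp_functor C G K, \<lambda>x\<in>Obj C. \<eta> (onob K x)))\<rparr>"

text \<open>\<open>F: C \<rightarrow> D\<close> is left adjoint to \<open>G: D \<rightarrow> C\<close> with unit \<open>\<eta>\<close>, in terms of universal arrows.\<close>

definition left_adjoint_unit ::
  "('o, 'a, 'y) category_scheme \<Rightarrow> ('p, 'b, 'z) category_scheme \<Rightarrow>
   ('p, 'b, 'o, 'a) ftor \<Rightarrow> ('o, 'a, 'p, 'b) ftor \<Rightarrow> ('o \<Rightarrow> 'a) \<Rightarrow> bool" where
  "left_adjoint_unit C D G F \<eta> \<longleftrightarrow> is_functor D C G \<and> is_functor C D F \<and>
     (\<forall>c\<in>Obj C. \<eta> c \<in> Hom C c (onob G (onob F c))) \<and>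
     (\<forall>f\<in>Arr C. Comp C (onar G (onar F f)) (\<eta> (Dom C f)) = Comp C (\<eta> (Cod C f)) f) \<and>
     (\<forall>c\<in>Obj C. \<forall>d\<in>Obj D. \<forall>h\<in>Hom C c (onob G d).
        \<exists>!k. k \<in> Hom D (onob F c) d \<and> Comp C (onar G k) (\<eta> c) = h)"

section \<open>Homological delta functors and left satellites\<close>

text \<open>\<open>conn L q f g : L_(q+1) (Cod g) \<rightarrow> L_q (Dom f)\<close> is the connecting morphism of a short exact
  sequence \<open>(f, g)\<close>.\<close>

record ('o, 'a, 'p, 'b) dfunctor =
  comp_at :: "nat \<Rightarrow> ('o, 'a, 'p, 'b) ftor"
  conn :: "nat \<Rightarrow> 'a \<Rightarrow> 'a \<Rightarrow> 'b"

definition delta_functor ::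
  "('o, 'a, 'y) abcat_scheme \<Rightarrow> ('p, 'b, 'z) abcat_scheme \<Rightarrow> ('o, 'a, 'p, 'b) dfunctor \<Rightarrow> bool" where
  "delta_functor C D L \<longleftrightarrow>
     (\<forall>q. additive_functor C D (comp_at L q)) \<and>
     (\<forall>f g. short_exact C f g \<longrightarrow>
        (\<forall>q. conn L q f g \<in> Hom D (onob (comp_at L (Suc q)) (Cod C g)) (onob (comp_at L q) (Dom C f)) \<and>
             exact_at D (onar (comp_at L q) f) (onar (comp_at L q) g) \<and>
             exact_at D (onar (comp_at L (Suc q)) g) (conn L q f g) \<and>
             exact_at D (conn L q f g) (onar (comp_at L q) f)) \<and>
        is_epi D (onar (comp_at L 0) g)) \<and>
     (\<forall>f g f' g' u v w. short_exact C f g \<and> short_exact C f' g' \<and>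
        u \<in> Hom C (Dom C f) (Dom C f') \<and> v \<in> Hom C (Cod C f) (Cod C f') \<and> w \<in> Hom C (Cod C g) (Cod C g') \<and>
        Comp C v f = Comp C f' u \<and> Comp C w g = Comp C g' v \<longrightarrow>
        (\<forall>q. Comp D (onar (comp_at L q) u) (conn L q f g) =
             Comp D (conn L q f' g') (onar (comp_at L (Suc q)) w)))"

definition delta_morphism ::
  "('o, 'a, 'y) abcat_scheme \<Rightarrow> ('p, 'b, 'z) abcat_scheme \<Rightarrow> ('o, 'a, 'p, 'b) dfunctor \<Rightarrow>
   ('o, 'a, 'p, 'b) dfunctor \<Rightarrow> (nat \<Rightarrow> 'o \<Rightarrow> 'b) \<Rightarrow> bool" where
  "delta_morphism C D S L \<phi> \<longleftrightarrow>
     (\<forall>q. is_nat C D (comp_at S q) (comp_at L q) (\<phi> q)) \<and>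
     (\<forall>f g q. short_exact C f g \<longrightarrow>
        Comp D (\<phi> q (Dom C f)) (conn S q f g) = Comp D (conn L q f g) (\<phi> (Suc q) (Cod C g)))"

text \<open>
  The left satellites of \<open>F\<close> are the universal homological delta functor with degree zero part \<open>F\<close>.
  (\<open>C\<close> need not have enough projectives, so they cannot be defined through resolutions.)
\<close>

definition left_satellites ::
  "('o, 'a, 'y) abcat_scheme \<Rightarrow> ('p, 'b, 'z) abcat_scheme \<Rightarrow> ('o, 'a, 'p, 'b) ftor \<Rightarrow>
   ('o, 'a, 'p, 'b) dfunctor \<Rightarrow> bool" where
  "left_satellites C D F L \<longleftrightarrow> delta_functor C D L \<and> comp_at L 0 = F \<and>
     (\<forall>S \<eta>. delta_functor C D S \<and> is_nat C D (comp_at S 0) F \<eta> \<longrightarrow>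
        (\<exists>!\<phi>. delta_morphism C D S L \<phi> \<and> \<phi> 0 = \<eta>))"

definition dfun_precomp ::
  "('o, 'a, 'z) category_scheme \<Rightarrow> ('p, 'b, 'q, 'c) dfunctor \<Rightarrow> ('o, 'a, 'p, 'b) ftor \<Rightarrow>
   ('o, 'a, 'q, 'c) dfunctor" where
  "dfun_precomp C L G = \<lparr>comp_at = (\<lambda>q. comp_functor C (comp_at L q) G),
                         conn = (\<lambda>q f g. conn L q (onar G f) (onar G g))\<rparr>"

definition dfun_postcomp ::
  "('o, 'a, 'z) category_scheme \<Rightarrow> ('p, 'b, 'q, 'c) ftor \<Rightarrow> ('o, 'a, 'p, 'b) dfunctor \<Rightarrow>
   ('o, 'a, 'q, 'c) dfunctor" where
  "dfun_postcomp C G L = \<lparr>comp_at = (\<lambda>q. comp_functor C G (comp_at L q)),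
                          conn = (\<lambda>q f g. onar G (conn L q f g))\<rparr>"

section \<open>Simplicial sets and simplex categories\<close>

text \<open>The arrow \<open>(m, n, \<theta>)\<close> is \<open>\<theta>: [m] \<rightarrow> [n]\<close>, where \<open>[m] = {..m}\<close>.\<close>

type_synonym delta_arr = "nat \<times> nat \<times> (nat \<Rightarrow> nat)"

definition Delta :: "(nat, delta_arr) category" where
  "Delta =
     \<lparr>Obj = UNIV,
      Arr = {(m, n, \<theta>). \<theta> \<in> {..m} \<rightarrow>\<^sub>E {..n} \<and> mono_on {..m} \<theta>},
      Dom = (\<lambda>(m, n, \<theta>). m),
      Cod = (\<lambda>(m, n, \<theta>). n),
      Ident = (\<lambda>m. (m, m, \<lambda>k\<in>{..m}. k)),
      Comp = (\<lambda>(n, l, \<psi>) (m, n', \<theta>). (m, l, compose {..m} \<psi> \<theta>))\<rparr>"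

definition coface :: "nat \<Rightarrow> nat \<Rightarrow> delta_arr" where
  "coface n i = (n, Suc n, \<lambda>k\<in>{..n}. if k < i then k else Suc k)"

record 'u sset =
  simp :: "nat \<Rightarrow> 'u set"
  act :: "delta_arr \<Rightarrow> 'u \<Rightarrow> 'u"

definition simplicial_set :: "'u sset \<Rightarrow> bool" where
  "simplicial_set X \<longleftrightarrow>
     (\<forall>\<theta>\<in>Arr Delta. \<forall>x\<in>simp X (Cod Delta \<theta>). act X \<theta> x \<in> simp X (Dom Delta \<theta>)) \<and>
     (\<forall>m. \<forall>x\<in>simp X m. act X (Ident Delta m) x = x) \<and>
     (\<forall>\<theta>\<in>Arr Delta. \<forall>\<psi>\<in>Arr Delta. Cod Delta \<theta> = Dom Delta \<psi> \<longrightarrow>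
        (\<forall>x\<in>simp X (Cod Delta \<psi>). act X (Comp Delta \<psi> \<theta>) x = act X \<theta> (act X \<psi> x)))"

type_synonym 'u smap = "nat \<Rightarrow> 'u \<Rightarrow> 'u"

definition simplicial_map :: "'u sset \<Rightarrow> 'u sset \<Rightarrow> 'u smap \<Rightarrow> bool" where
  "simplicial_map X Y f \<longleftrightarrow>
     (\<forall>m. \<forall>x\<in>simp X m. f m x \<in> simp Y m) \<and>
     (\<forall>\<theta>\<in>Arr Delta. \<forall>x\<in>simp X (Cod Delta \<theta>).
        f (Dom Delta \<theta>) (act X \<theta> x) = act Y \<theta> (f (Cod Delta \<theta>) x))"

type_synonym 'u sx = "nat \<times> 'u"
type_synonym 'u sx_arr = "'u sx \<times> delta_arr \<times> 'u sx"

definition simplex_cat :: "'u sset \<Rightarrow> ('u sx, 'u sx_arr) category" where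
  "simplex_cat X =
     \<lparr>Obj = {(m, x). x \<in> simp X m},
      Arr = {((m, x), \<theta>, (m', x')). x \<in> simp X m \<and> x' \<in> simp X m' \<and> \<theta> \<in> Hom Delta m m' \<and> x = act X \<theta> x'},
      Dom = (\<lambda>(s, \<theta>, s'). s),
      Cod = (\<lambda>(s, \<theta>, s'). s'),
      Ident = (\<lambda>s. (s, Ident Delta (fst s), s)),
      Comp = (\<lambda>(s', \<psi>, s'') (s, \<theta>, t). (s, Comp Delta \<psi> \<theta>, s''))\<rparr>"

text \<open>As a pair of maps, a functor and its opposite coincide: \<open>simplex_functor\<close> is used both as
  \<open>\<Delta>/f\<close> and as its opposite.\<close>

definition simplex_functor :: "'u sset \<Rightarrow> 'u smap \<Rightarrow> ('u sx, 'u sx_arr, 'u sx, 'u sx_arr) ftor" where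
  "simplex_functor X f =
     \<lparr>onob = (\<lambda>(m, x)\<in>Obj (simplex_cat X). (m, f m x)),
      onar = (\<lambda>((m, x), \<theta>, (m', x'))\<in>Arr (simplex_cat X). ((m, f m x), \<theta>, (m', f m' x')))\<rparr>"

section \<open>Gabriel-Zisman natural systems and homology\<close>

type_synonym ('u, 'o, 'a) nsys = "('u sx, 'u sx_arr, 'o, 'a) ftor"
type_synonym ('u, 'o, 'a) nsys_arr = "('u sx, 'u sx_arr, 'o, 'a) ntrans"

definition nsys_cat ::
  "('o, 'a) abcat \<Rightarrow> 'u sset \<Rightarrow> (('u, 'o, 'a) nsys, ('u, 'o, 'a) nsys_arr) abcat" where
  "nsys_cat A X = fun_cat (opcat (simplex_cat X)) A"

definition pull ::
  "('o, 'a) abcat \<Rightarrow> 'u sset \<Rightarrow> 'u sset \<Rightarrow> 'u smap \<Rightarrow>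
   (('u, 'o, 'a) nsys, ('u, 'o, 'a) nsys_arr, ('u, 'o, 'a) nsys, ('u, 'o, 'a) nsys_arr) ftor" where
  "pull A X Y f =
     precomposition (opcat (simplex_cat X)) (opcat (simplex_cat Y)) A (simplex_functor X f)"

definition GZ_chain :: "('o, 'a) abcat \<Rightarrow> 'u sset \<Rightarrow> ('u, 'o, 'a) nsys \<Rightarrow> nat \<Rightarrow> 'o" where
  "GZ_chain A X T n = coprod A (simp X n) (\<lambda>\<sigma>. onob T (n, \<sigma>))"

definition GZ_inj :: "('o, 'a) abcat \<Rightarrow> 'u sset \<Rightarrow> ('u, 'o, 'a) nsys \<Rightarrow> nat \<Rightarrow> 'u \<Rightarrow> 'a" where
  "GZ_inj A X T n = coprod_inj A (simp X n) (\<lambda>\<sigma>. onob T (n, \<sigma>))"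

definition GZ_face :: "('o, 'a) abcat \<Rightarrow> 'u sset \<Rightarrow> ('u, 'o, 'a) nsys \<Rightarrow> nat \<Rightarrow> 'u \<Rightarrow> nat \<Rightarrow> 'a" where
  "GZ_face A X T n \<sigma> i =
     (let \<tau> = act X (coface n i) \<sigma>
      in Comp A (GZ_inj A X T n \<tau>) (onar T ((n, \<tau>), coface n i, (Suc n, \<sigma>))))"

definition GZ_diff :: "('o, 'a) abcat \<Rightarrow> 'u sset \<Rightarrow> ('u, 'o, 'a) nsys \<Rightarrow> nat \<Rightarrow> 'a" where
  "GZ_diff A X T n =
     cotuple A (simp X (Suc n)) (\<lambda>\<sigma>. onob T (Suc n, \<sigma>)) (GZ_chain A X T n)
       (\<lambda>\<sigma>. hom_sum A (onob T (Suc n, \<sigma>)) (GZ_chain A X T n)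
              (\<lambda>i. if even i then GZ_face A X T n \<sigma> i else Neg A (GZ_face A X T n \<sigma> i)) (n + 2))"

definition GZ_homology :: "('o, 'a) abcat \<Rightarrow> 'u sset \<Rightarrow> ('u, 'o, 'a) nsys \<Rightarrow> nat \<Rightarrow> 'o" where
  "GZ_homology A X T n = chain_homology A (GZ_diff A X T) n"

text \<open>
  Functoriality of Gabriel-Zisman homology in the pair \<open>(X, T)\<close>: the chain map induced by
  \<open>a: X \<rightarrow> X'\<close> and an arrow \<open>t\<close> from \<open>T\<close> to the pullback of \<open>T'\<close> along \<open>a\<close> sends the summand
  \<open>\<sigma>\<close> to the summand \<open>a \<sigma>\<close> through \<open>t_\<sigma>: T(\<sigma>) \<rightarrow> T'(a \<sigma>)\<close>.
\<close>

definition GZ_chain_map ::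
  "('o, 'a) abcat \<Rightarrow> 'u sset \<Rightarrow> 'u sset \<Rightarrow> 'u smap \<Rightarrow> ('u, 'o, 'a) nsys \<Rightarrow> ('u, 'o, 'a) nsys \<Rightarrow>
   ('u, 'o, 'a) nsys_arr \<Rightarrow> nat \<Rightarrow> 'a" where
  "GZ_chain_map A X X' a T T' t n =
     cotuple A (simp X n) (\<lambda>\<sigma>. onob T (n, \<sigma>)) (GZ_chain A X' T' n)
       (\<lambda>\<sigma>. Comp A (GZ_inj A X' T' n (a n \<sigma>)) (snd (snd t) (n, \<sigma>)))"

definition GZ_homology_map ::
  "('o, 'a) abcat \<Rightarrow> 'u sset \<Rightarrow> 'u sset \<Rightarrow> 'u smap \<Rightarrow> ('u, 'o, 'a) nsys \<Rightarrow> ('u, 'o, 'a) nsys \<Rightarrow>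
   ('u, 'o, 'a) nsys_arr \<Rightarrow> nat \<Rightarrow> 'a" where
  "GZ_homology_map A X X' a T T' t n =
     chain_homology_map A (GZ_diff A X T) (GZ_diff A X' T') (GZ_chain_map A X X' a T T' t) n"

section \<open>Left Kan extension and its satellites\<close>

definition Lan_sel ::
  "('o, 'a) abcat \<Rightarrow> 'u sset \<Rightarrow> 'u sset \<Rightarrow> 'u smap \<Rightarrow>
   (('u, 'o, 'a) nsys, ('u, 'o, 'a) nsys_arr, ('u, 'o, 'a) nsys, ('u, 'o, 'a) nsys_arr) ftor \<times>
   (('u, 'o, 'a) nsys \<Rightarrow> ('u, 'o, 'a) nsys_arr)" where
  "Lan_sel A X Y f =
     (SOME (F, \<eta>). left_adjoint_unit (nsys_cat A X) (nsys_cat A Y) (pull A X Y f) F \<eta>)"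

definition Lan ::
  "('o, 'a) abcat \<Rightarrow> 'u sset \<Rightarrow> 'u sset \<Rightarrow> 'u smap \<Rightarrow>
   (('u, 'o, 'a) nsys, ('u, 'o, 'a) nsys_arr, ('u, 'o, 'a) nsys, ('u, 'o, 'a) nsys_arr) ftor" where
  "Lan A X Y f = fst (Lan_sel A X Y f)"

definition Lan_unit ::
  "('o, 'a) abcat \<Rightarrow> 'u sset \<Rightarrow> 'u sset \<Rightarrow> 'u smap \<Rightarrow> ('u, 'o, 'a) nsys \<Rightarrow> ('u, 'o, 'a) nsys_arr" where
  "Lan_unit A X Y f = snd (Lan_sel A X Y f)"

definition Lan_sat ::
  "('o, 'a) abcat \<Rightarrow> 'u sset \<Rightarrow> 'u sset \<Rightarrow> 'u smap \<Rightarrow>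
   (('u, 'o, 'a) nsys, ('u, 'o, 'a) nsys_arr, ('u, 'o, 'a) nsys, ('u, 'o, 'a) nsys_arr) dfunctor" where
  "Lan_sat A X Y f = (SOME L. left_satellites (nsys_cat A X) (nsys_cat A Y) (Lan A X Y f) L)"

abbreviation Lan_q ::
  "('o, 'a) abcat \<Rightarrow> 'u sset \<Rightarrow> 'u sset \<Rightarrow> 'u smap \<Rightarrow> nat \<Rightarrow>
   (('u, 'o, 'a) nsys, ('u, 'o, 'a) nsys_arr, ('u, 'o, 'a) nsys, ('u, 'o, 'a) nsys_arr) ftor" where
  "Lan_q A X Y f q \<equiv> comp_at (Lan_sat A X Y f) q"

subsection \<open>The category in which the spectral sequence is natural\<close>

text \<open>
  Objects: a map \<open>f: X \<rightarrow> Y\<close> with a natural system \<open>T\<close> on \<open>X\<close>. Morphisms \<open>(f, T) \<rightarrow> (f', T')\<close>: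
  a commutative square \<open>b f = f' a\<close> with an arrow from \<open>T\<close> to the pullback of \<open>T'\<close> along \<open>a\<close>.
\<close>

record ('u, 'o, 'a) gz_obj =
  src :: "'u sset"
  tgt :: "'u sset"
  smap :: "'u smap"
  coef :: "('u, 'o, 'a) nsys"

record ('u, 'o, 'a) gz_mor =
  on_src :: "'u smap"
  on_tgt :: "'u smap"
  on_coef :: "('u, 'o, 'a) nsys_arr"

definition is_gz_obj :: "('o, 'a) abcat \<Rightarrow> ('u, 'o, 'a) gz_obj \<Rightarrow> bool" where
  "is_gz_obj A P \<longleftrightarrow> simplicial_set (src P) \<and> simplicial_set (tgt P) \<and>
     simplicial_map (src P) (tgt P) (smap P) \<and> is_functor (opcat (simplex_cat (src P))) A (coef P)"

definition is_gz_mor ::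
  "('o, 'a) abcat \<Rightarrow> ('u, 'o, 'a) gz_obj \<Rightarrow> ('u, 'o, 'a) gz_obj \<Rightarrow> ('u, 'o, 'a) gz_mor \<Rightarrow> bool" where
  "is_gz_mor A P P' M \<longleftrightarrow>
     simplicial_map (src P) (src P') (on_src M) \<and> simplicial_map (tgt P) (tgt P') (on_tgt M) \<and>
     (\<forall>m. \<forall>x\<in>simp (src P) m. on_tgt M m (smap P m x) = smap P' m (on_src M m x)) \<and>
     on_coef M \<in> Hom (nsys_cat A (src P)) (coef P) (onob (pull A (src P) (src P') (on_src M)) (coef P'))"

text \<open>
  With \<open>a\<close>, \<open>b\<close> the two maps of the square, \<open>base_change\<close> is the mate \<open>Lan_f a\<^sup>* \<rightarrow> b\<^sup>* Lan_f'\<close> of the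
  equality \<open>a\<^sup>* f'\<^sup>* = f\<^sup>* b\<^sup>*\<close>, and \<open>base_change_sat\<close> its unique extension to the satellites.
\<close>

definition base_change ::
  "('o, 'a) abcat \<Rightarrow> ('u, 'o, 'a) gz_obj \<Rightarrow> ('u, 'o, 'a) gz_obj \<Rightarrow> ('u, 'o, 'a) gz_mor \<Rightarrow>
   ('u, 'o, 'a) nsys \<Rightarrow> ('u, 'o, 'a) nsys_arr" where
  "base_change A P P' M =
     (let X = src P; Y = tgt P; f = smap P; X' = src P'; Y' = tgt P'; f' = smap P';
          a = pull A X X' (on_src M); b = pull A Y Y' (on_tgt M)
      in (\<lambda>T'\<in>Obj (nsys_cat A X').
           (THE k. k \<in> Hom (nsys_cat A Y) (onob (Lan A X Y f) (onob a T')) (onob b (onob (Lan A X' Y' f') T')) \<and>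
                  Comp (nsys_cat A X) (onar (pull A X Y f) k) (Lan_unit A X Y f (onob a T')) =
                  onar a (Lan_unit A X' Y' f' T'))))"

definition base_change_sat ::
  "('o, 'a) abcat \<Rightarrow> ('u, 'o, 'a) gz_obj \<Rightarrow> ('u, 'o, 'a) gz_obj \<Rightarrow> ('u, 'o, 'a) gz_mor \<Rightarrow>
   nat \<Rightarrow> ('u, 'o, 'a) nsys \<Rightarrow> ('u, 'o, 'a) nsys_arr" where
  "base_change_sat A P P' M =
     (let X = src P; Y = tgt P; f = smap P; X' = src P'; Y' = tgt P'; f' = smap P';
          a = pull A X X' (on_src M); b = pull A Y Y' (on_tgt M)
      in (THE \<phi>. delta_morphism (nsys_cat A X') (nsys_cat A Y)
                  (dfun_precomp (nsys_cat A X') (Lan_sat A X Y f) a)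
                  (dfun_postcomp (nsys_cat A X') b (Lan_sat A X' Y' f')) \<phi> \<and>
                \<phi> 0 = base_change A P P' M))"

text \<open>The composite \<open>L_q Lan_f T \<rightarrow> L_q Lan_f (a\<^sup>* T') \<rightarrow> b\<^sup>* (L_q Lan_f' T')\<close>.\<close>

definition sat_map ::
  "('o, 'a) abcat \<Rightarrow> ('u, 'o, 'a) gz_obj \<Rightarrow> ('u, 'o, 'a) gz_obj \<Rightarrow> ('u, 'o, 'a) gz_mor \<Rightarrow>
   nat \<Rightarrow> ('u, 'o, 'a) nsys_arr" where
  "sat_map A P P' M q =
     Comp (nsys_cat A (tgt P)) (base_change_sat A P P' M q (coef P'))
       (onar (Lan_q A (src P) (tgt P) (smap P) q) (on_coef M))"

definition Lan_coef :: "('o, 'a) abcat \<Rightarrow> ('u, 'o, 'a) gz_obj \<Rightarrow> nat \<Rightarrow> ('u, 'o, 'a) nsys" where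
  "Lan_coef A P q = onob (Lan_q A (src P) (tgt P) (smap P) q) (coef P)"

definition E2_term :: "('o, 'a) abcat \<Rightarrow> ('u, 'o, 'a) gz_obj \<Rightarrow> nat \<Rightarrow> nat \<Rightarrow> 'o" where
  "E2_term A P p q = GZ_homology A (tgt P) (Lan_coef A P q) p"

definition E2_map ::
  "('o, 'a) abcat \<Rightarrow> ('u, 'o, 'a) gz_obj \<Rightarrow> ('u, 'o, 'a) gz_obj \<Rightarrow> ('u, 'o, 'a) gz_mor \<Rightarrow>
   nat \<Rightarrow> nat \<Rightarrow> 'a" where
  "E2_map A P P' M p q =
     GZ_homology_map A (tgt P) (tgt P') (on_tgt M) (Lan_coef A P q) (Lan_coef A P' q) (sat_map A P P' M q) p"

definition abutment :: "('o, 'a) abcat \<Rightarrow> ('u, 'o, 'a) gz_obj \<Rightarrow> nat \<Rightarrow> 'o" where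
  "abutment A P n = GZ_homology A (src P) (coef P) n"

definition abutment_map ::
  "('o, 'a) abcat \<Rightarrow> ('u, 'o, 'a) gz_obj \<Rightarrow> ('u, 'o, 'a) gz_obj \<Rightarrow> ('u, 'o, 'a) gz_mor \<Rightarrow> nat \<Rightarrow> 'a" where
  "abutment_map A P P' M n =
     GZ_homology_map A (src P) (src P') (on_src M) (coef P) (coef P') (on_coef M) n"

section \<open>Homology spectral sequences\<close>

text \<open>
  First-quadrant homology spectral sequences starting at the second page. \<open>pd r p q\<close> leaves
  \<open>page r p q\<close>; \<open>next_page r p q\<close> is the isomorphism from the homology of page \<open>r\<close> at \<open>(p, q)\<close> to
  \<open>page (r + 1) p q\<close>. Only pages \<open>r \<ge> 2\<close> are meaningful.
\<close>

record ('o, 'a) spseq =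
  page :: "nat \<Rightarrow> int \<Rightarrow> int \<Rightarrow> 'o"
  pd :: "nat \<Rightarrow> int \<Rightarrow> int \<Rightarrow> 'a"
  next_page :: "nat \<Rightarrow> int \<Rightarrow> int \<Rightarrow> 'a"

abbreviation pd_in :: "('o, 'a) spseq \<Rightarrow> nat \<Rightarrow> int \<Rightarrow> int \<Rightarrow> 'a" where
  "pd_in S r p q \<equiv> pd S r (p + int r) (q - int r + 1)"

definition homology_spectral_sequence :: "('o, 'a) abcat \<Rightarrow> ('o, 'a) spseq \<Rightarrow> bool" where
  "homology_spectral_sequence A S \<longleftrightarrow>
     (\<forall>r\<ge>2. \<forall>p q.
        page S r p q \<in> Obj A \<and>
        pd S r p q \<in> Hom A (page S r p q) (page S r (p - int r) (q + int r - 1)) \<and>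
        Comp A (pd S r p q) (pd_in S r p q) =
          Zero A (page S r (p + int r) (q - int r + 1)) (page S r (p - int r) (q + int r - 1)) \<and>
        next_page S r p q \<in> Hom A (homol A (pd_in S r p q) (pd S r p q)) (page S (Suc r) p q) \<and>
        is_iso A (next_page S r p q))"

definition first_quadrant :: "('o, 'a) abcat \<Rightarrow> ('o, 'a) spseq \<Rightarrow> bool" where
  "first_quadrant A S \<longleftrightarrow> (\<forall>r\<ge>2. \<forall>p q. p < 0 \<or> q < 0 \<longrightarrow> zero_object A (page S r p q))"

definition spseq_morphism ::
  "('o, 'a) abcat \<Rightarrow> ('o, 'a) spseq \<Rightarrow> ('o, 'a) spseq \<Rightarrow> (nat \<Rightarrow> int \<Rightarrow> int \<Rightarrow> 'a) \<Rightarrow> bool" where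
  "spseq_morphism A S S' \<Phi> \<longleftrightarrow>
     (\<forall>r\<ge>2. \<forall>p q.
        \<Phi> r p q \<in> Hom A (page S r p q) (page S' r p q) \<and>
        Comp A (pd S' r p q) (\<Phi> r p q) = Comp A (\<Phi> r (p - int r) (q + int r - 1)) (pd S r p q) \<and>
        Comp A (\<Phi> (Suc r) p q) (next_page S r p q) =
          Comp A (next_page S' r p q)
            (homol_map A (pd_in S r p q) (pd S r p q) (pd_in S' r p q) (pd S' r p q) (\<Phi> r p q)))"

text \<open>
  In a first-quadrant spectral sequence the differentials into and out of position \<open>(p, n - p)\<close>
  vanish from page \<open>n + 2\<close> on, so \<open>next_page\<close> identifies all later terms with the one on page
  \<open>n + 2\<close>, which serves as the limit term.
\<close>

definition limit_page :: "nat \<Rightarrow> nat" where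
  "limit_page n = n + 2"

text \<open>
  Convergence to \<open>H\<close>: a filtration \<open>0 = F_(-1) \<subseteq> F_0 \<subseteq> \<dots> \<subseteq> F_n = H n\<close> by subobjects \<open>fincl n p\<close>,
  together with epimorphisms \<open>fgr n p: F_p \<rightarrow> E^\<infinity>_(p, n - p)\<close> with kernel \<open>F_(p - 1)\<close>.
\<close>

record 'a filtr =
  fincl :: "nat \<Rightarrow> int \<Rightarrow> 'a"
  fgr :: "nat \<Rightarrow> int \<Rightarrow> 'a"

definition converges ::
  "('o, 'a) abcat \<Rightarrow> ('o, 'a) spseq \<Rightarrow> (nat \<Rightarrow> 'o) \<Rightarrow> 'a filtr \<Rightarrow> bool" where
  "converges A S H Fl \<longleftrightarrow>
     (\<forall>n p. is_mono A (fincl Fl n p) \<and> Cod A (fincl Fl n p) = H n \<and>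
        (p < 0 \<longrightarrow> zero_object A (Dom A (fincl Fl n p))) \<and>
        (int n \<le> p \<longrightarrow> is_iso A (fincl Fl n p)) \<and>
        (\<exists>j. j \<in> Hom A (Dom A (fincl Fl n (p - 1))) (Dom A (fincl Fl n p)) \<and>
             Comp A (fincl Fl n p) j = fincl Fl n (p - 1) \<and>
             is_cokernel A j (fgr Fl n p)) \<and>
        Cod A (fgr Fl n p) = page S (limit_page n) p (int n - p))"

definition convergence_compatible ::
  "('o, 'a) abcat \<Rightarrow> 'a filtr \<Rightarrow> 'a filtr \<Rightarrow> (nat \<Rightarrow> int \<Rightarrow> int \<Rightarrow> 'a) \<Rightarrow> (nat \<Rightarrow> 'a) \<Rightarrow> bool" where
  "convergence_compatible A Fl Fl' \<Phi> h \<longleftrightarrow>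
     (\<forall>n p. \<exists>t. t \<in> Hom A (Dom A (fincl Fl n p)) (Dom A (fincl Fl' n p)) \<and>
        Comp A (fincl Fl' n p) t = Comp A (h n) (fincl Fl n p) \<and>
        Comp A (fgr Fl' n p) t = Comp A (\<Phi> (limit_page n) p (int n - p)) (fgr Fl n p))"

end

theory Submission
  imports Defs
begin

text \<open>
  The functor \<open>\<Delta>/f\<close> is a discrete fibration: for a simplex \<open>x\<close> of \<open>X\<close>, every arrow \<open>y \<rightarrow> f x\<close> of
  \<open>\<Delta>/Y\<close> lifts uniquely to an arrow with target \<open>x\<close>. Hence the left Kan extension is a fibrewise
  coproduct, \<open>(Lan T)(y) = \<Oplus> T(x)\<close> over the \<open>x\<close> with \<open>f x = y\<close>, and it is exact because coproducts
  are. Its satellites therefore vanish in positive degrees and the second page is concentrated in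
  the row \<open>q = 0\<close>. On that row, regrouping the summands of \<open>C\<^sub>p(X, T)\<close> by their image in \<open>Y\<close> shows that
  the unit \<open>T \<rightarrow> f\<^sup>* Lan T\<close> induces an isomorphism of chain complexes \<open>C(X, T) \<rightarrow> C(Y, Lan T)\<close>. So the
  spectral sequence collapses to the Gabriel-Zisman homology of \<open>X\<close>, and its naturality is that of
  the unit with respect to base change.
\<close>

section \<open>Categories\<close>

text \<open>\<open>Lan\<close>, \<open>Lan_sat\<close> and \<open>coprod\<close> are selected by
  \<open>SOME\<close>, so only their universal properties are available. Explicit descriptions are
  therefore proved for a constructed model and carried over by a comparison. The fibrewise coproduct
  reaches the selected adjoint in this way. The selected satellites are compared with the extension
  of \<open>Lan\<close> by zero, and the identity of a positive satellite then factors through a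
  zero object. Exactness also makes base change meaningful: \<open>base_change_sat\<close> is given
  by \<open>THE\<close>, and a transformation into a family that is exact in degree 0 and zero above
  extends uniquely. Smallness is counted in \<open>'u\<close>, while the objects of \<Delta>/X are
  pairs of a dimension and a simplex; a fibre fixes the dimension, so its simplices index it by a
  subset of \<open>'u\<close>. From the second page on a differential changes the row, so a single
  nonzero row admits only zero differentials, and total degree n keeps one graded piece, in position
  (n, 0).\<close>

lemma HomI: "f \<in> Arr C \<Longrightarrow> Dom C f = x \<Longrightarrow> Cod C f = y \<Longrightarrow> f \<in> Hom C x y"
  by (simp add: Hom_def)

lemma HomD:
  assumes "f \<in> Hom C x y"
  shows "f \<in> Arr C" "Dom C f = x" "Cod C f = y"
  using assms by (simp_all add: Hom_def)

locale cat =
  fixes C :: "('o, 'a, 'z) category_scheme"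
  assumes cat: "is_category C"
begin

lemma Dom_Obj [simp]: "f \<in> Arr C \<Longrightarrow> Dom C f \<in> Obj C"
  and Cod_Obj [simp]: "f \<in> Arr C \<Longrightarrow> Cod C f \<in> Obj C"
  using cat by (auto simp: is_category_def)

lemma Hom_Obj:
  assumes "f \<in> Hom C x y"
  shows "x \<in> Obj C" "y \<in> Obj C"
  using assms by (auto simp: Hom_def)

lemma Ident_Hom [simp]: "x \<in> Obj C \<Longrightarrow> Ident C x \<in> Hom C x x"
  using cat by (auto simp: is_category_def)

lemma Comp_Hom: "f \<in> Hom C x y \<Longrightarrow> g \<in> Hom C y z \<Longrightarrow> Comp C g f \<in> Hom C x z"
  using cat unfolding is_category_def by (auto simp: Hom_def)

lemma Comp_Ident:
  assumes "f \<in> Hom C x y"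
  shows "Comp C f (Ident C x) = f" "Comp C (Ident C y) f = f"
  using cat assms unfolding is_category_def by (auto simp: Hom_def)

lemma Comp_assoc:
  assumes "f \<in> Hom C x y" "g \<in> Hom C y z" "h \<in> Hom C z w"
  shows "Comp C h (Comp C g f) = Comp C (Comp C h g) f"
proof -
  have "\<forall>f\<in>Arr C. \<forall>g\<in>Arr C. \<forall>h\<in>Arr C. Cod C f = Dom C g \<and> Cod C g = Dom C h \<longrightarrow>
      Comp C h (Comp C g f) = Comp C (Comp C h g) f"
    using cat by (auto simp: is_category_def)
  then show ?thesis
    using assms by (auto simp: Hom_def)
qed

lemma mono_cancel:
  assumes "is_mono C f" "f \<in> Hom C y z" "g \<in> Hom C x y" "h \<in> Hom C x y" "Comp C f g = Comp C f h"
  shows "g = h"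
  using assms by (auto simp: is_mono_def Hom_def)

lemma monoI:
  assumes "f \<in> Hom C y z"
    and "\<And>x g h. g \<in> Hom C x y \<Longrightarrow> h \<in> Hom C x y \<Longrightarrow> Comp C f g = Comp C f h \<Longrightarrow> g = h"
  shows "is_mono C f"
  using assms by (auto simp: is_mono_def Hom_def)

lemma epi_cancel:
  assumes "is_epi C f" "f \<in> Hom C x y" "g \<in> Hom C y z" "h \<in> Hom C y z" "Comp C g f = Comp C h f"
  shows "g = h"
  using assms by (auto simp: is_epi_def Hom_def)

lemma epiI:
  assumes "f \<in> Hom C x y"
    and "\<And>z g h. g \<in> Hom C y z \<Longrightarrow> h \<in> Hom C y z \<Longrightarrow> Comp C g f = Comp C h f \<Longrightarrow> g = h"
  shows "is_epi C f"
  using assms by (auto simp: is_epi_def Hom_def)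

lemma isoI:
  assumes "f \<in> Hom C x y" "g \<in> Hom C y x" "Comp C g f = Ident C x" "Comp C f g = Ident C y"
  shows "is_iso C f"
  using assms by (auto simp: is_iso_def Hom_def)

lemma isoE:
  assumes "is_iso C f" "f \<in> Hom C x y"
  obtains g where "g \<in> Hom C y x" "Comp C g f = Ident C x" "Comp C f g = Ident C y"
  using assms by (auto simp: is_iso_def Hom_def)

lemma iso_Ident: "x \<in> Obj C \<Longrightarrow> is_iso C (Ident C x)"
  using isoI[of "Ident C x" x x "Ident C x"] Comp_Ident[of "Ident C x" x x] by simp

lemma iso_mono:
  assumes "is_iso C f"
  shows "is_mono C f"
proof -
  let ?x = "Dom C f" and ?y = "Cod C f"
  have f: "f \<in> Hom C ?x ?y"
    using assms by (auto simp: is_iso_def Hom_def)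
  obtain k where k: "k \<in> Hom C ?y ?x" "Comp C k f = Ident C ?x"
    using isoE[OF assms f] by blast
  show ?thesis
  proof (rule monoI[OF f])
    fix w g h assume gh: "g \<in> Hom C w ?x" "h \<in> Hom C w ?x" "Comp C f g = Comp C f h"
    have "Comp C (Comp C k f) g = Comp C (Comp C k f) h"
      using gh Comp_assoc[OF gh(1) f k(1)] Comp_assoc[OF gh(2) f k(1)] by simp
    then show "g = h"
      using gh k(2) Comp_Ident(2) by metis
  qed
qed

lemma iso_epi:
  assumes "is_iso C f"
  shows "is_epi C f"
proof -
  let ?x = "Dom C f" and ?y = "Cod C f"
  have f: "f \<in> Hom C ?x ?y"
    using assms by (auto simp: is_iso_def Hom_def)
  obtain k where k: "k \<in> Hom C ?y ?x" "Comp C f k = Ident C ?y"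
    using isoE[OF assms f] by blast
  show ?thesis
  proof (rule epiI[OF f])
    fix w g h assume gh: "g \<in> Hom C ?y w" "h \<in> Hom C ?y w" "Comp C g f = Comp C h f"
    have "Comp C g (Comp C f k) = Comp C h (Comp C f k)"
      using gh Comp_assoc[OF k(1) f gh(1)] Comp_assoc[OF k(1) f gh(2)] by simp
    then show "g = h"
      using gh k(2) Comp_Ident(1) by metis
  qed
qed

lemma zero_object_Obj: "zero_object C z \<Longrightarrow> z \<in> Obj C"
  by (simp add: zero_object_def)

lemma zero_object_to:
  assumes "zero_object C z" "f \<in> Hom C x z" "g \<in> Hom C x z"
  shows "f = g"
  using assms Hom_Obj(1) unfolding zero_object_def by metis

lemma zero_object_from:
  assumes "zero_object C z" "f \<in> Hom C z x" "g \<in> Hom C z x"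
  shows "f = g"
  using assms Hom_Obj(2) unfolding zero_object_def by metis

lemma opcat_cat: "is_category (opcat C)"
  unfolding is_category_def opcat_def Hom_def using Ident_Hom Comp_Ident Comp_assoc Comp_Hom
  by (simp add: Hom_def)

end

lemma opcat_simps [simp]:
  "Obj (opcat C) = Obj C" "Arr (opcat C) = Arr C" "Dom (opcat C) = Cod C" "Cod (opcat C) = Dom C"
  "Ident (opcat C) = Ident C" "Comp (opcat C) g f = Comp C f g" "Hom (opcat C) x y = Hom C y x"
  by (auto simp: opcat_def Hom_def)

section \<open>Preadditive categories, kernels and homology\<close>

locale preadd = cat A for A :: "('o, 'a, 'z) abcat_scheme" +
  assumes preadd: "is_preadditive A"
begin

lemma Zero_Hom [simp]: "x \<in> Obj A \<Longrightarrow> y \<in> Obj A \<Longrightarrow> Zero A x y \<in> Hom A x y"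
  using preadd by (auto simp: is_preadditive_def)

lemma Add_Hom: "f \<in> Hom A x y \<Longrightarrow> g \<in> Hom A x y \<Longrightarrow> Add A f g \<in> Hom A x y"
  using preadd Hom_Obj[of f x y] unfolding is_preadditive_def by blast

lemma Add_commute: "f \<in> Hom A x y \<Longrightarrow> g \<in> Hom A x y \<Longrightarrow> Add A f g = Add A g f"
  using preadd Hom_Obj[of f x y] unfolding is_preadditive_def by blast

lemma Add_assoc: "f \<in> Hom A x y \<Longrightarrow> g \<in> Hom A x y \<Longrightarrow> h \<in> Hom A x y \<Longrightarrow>
    Add A (Add A f g) h = Add A f (Add A g h)"
  using preadd Hom_Obj[of f x y] unfolding is_preadditive_def by blast

lemma Add_Zero: "f \<in> Hom A x y \<Longrightarrow> Add A f (Zero A x y) = f"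
  using preadd Hom_Obj[of f x y] unfolding is_preadditive_def by blast

lemma Add_inverse: "f \<in> Hom A x y \<Longrightarrow> \<exists>g\<in>Hom A x y. Add A f g = Zero A x y"
  using preadd Hom_Obj[of f x y] unfolding is_preadditive_def by blast

lemma Comp_Add:
  assumes "f \<in> Hom A x y" "f' \<in> Hom A x y" "g \<in> Hom A y z" "g' \<in> Hom A y z"
  shows "Comp A g (Add A f f') = Add A (Comp A g f) (Comp A g f')"
    and "Comp A (Add A g g') f = Add A (Comp A g f) (Comp A g' f)"
  using preadd assms Hom_Obj[OF assms(1)] Hom_Obj[OF assms(3)] unfolding is_preadditive_def by blast+

lemma Add_cancel:
  assumes "f \<in> Hom A x y" "g \<in> Hom A x y" "h \<in> Hom A x y" "Add A f g = Add A f h"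
  shows "g = h"
proof -
  obtain k where k: "k \<in> Hom A x y" "Add A f k = Zero A x y"
    using Add_inverse assms by blast
  have "\<And>w. w \<in> Hom A x y \<Longrightarrow> Add A k (Add A f w) = w"
    using k assms(1) by (metis Add_Zero Add_assoc Add_commute Hom_Obj Zero_Hom)
  then show ?thesis
    using assms by metis
qed

lemma Add_idem:
  assumes "f \<in> Hom A x y" "Add A f f = f"
  shows "f = Zero A x y"
proof (rule Add_cancel[of f x y])
  show "Add A f f = Add A f (Zero A x y)"
    using assms by (simp add: Add_Zero)
qed (use assms Hom_Obj in auto)

text \<open>By bilinearity the composite equals its own double, and \<open>Add_idem\<close>
  identifies such an arrow as zero.\<close>

lemma Comp_Zero:
  assumes "f \<in> Hom A y z" "x \<in> Obj A"
  shows "Comp A f (Zero A x y) = Zero A x z"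
proof (rule Add_idem)
  have z: "Zero A x y \<in> Hom A x y"
    using assms Hom_Obj by simp
  then show "Comp A f (Zero A x y) \<in> Hom A x z"
    using assms Comp_Hom by blast
  show "Add A (Comp A f (Zero A x y)) (Comp A f (Zero A x y)) = Comp A f (Zero A x y)"
    using Comp_Add(1)[OF z z assms(1) assms(1)] Add_Zero[OF z] by simp
qed

lemma Zero_Comp:
  assumes "f \<in> Hom A x y" "z \<in> Obj A"
  shows "Comp A (Zero A y z) f = Zero A x z"
proof (rule Add_idem)
  have z: "Zero A y z \<in> Hom A y z"
    using assms Hom_Obj by simp
  then show "Comp A (Zero A y z) f \<in> Hom A x z"
    using assms Comp_Hom by blast
  show "Add A (Comp A (Zero A y z) f) (Comp A (Zero A y z) f) = Comp A (Zero A y z) f"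
    using Comp_Add(2)[OF assms(1) assms(1) z z] Add_Zero[OF z] by simp
qed

lemma Neg:
  assumes "f \<in> Hom A x y"
  shows "Neg A f \<in> Hom A x y" "Add A f (Neg A f) = Zero A x y"
proof -
  obtain g where g: "g \<in> Hom A x y" "Add A f g = Zero A x y"
    using Add_inverse assms by blast
  have "\<exists>!g. g \<in> Hom A (Dom A f) (Cod A f) \<and> Add A f g = Zero A (Dom A f) (Cod A f)"
    using g assms Add_cancel[OF assms] HomD[OF assms] by metis
  from theI'[OF this] show "Neg A f \<in> Hom A x y" "Add A f (Neg A f) = Zero A x y"
    using HomD[OF assms] by (simp_all add: Neg_def)
qed

lemma Neg_unique:
  assumes "f \<in> Hom A x y" "g \<in> Hom A x y" "Add A f g = Zero A x y"
  shows "Neg A f = g"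
  using assms Neg Add_cancel by metis

lemma Neg_Neg: "f \<in> Hom A x y \<Longrightarrow> Neg A (Neg A f) = f"
  using Neg Neg_unique Add_commute by metis

lemma Comp_Neg:
  assumes f: "f \<in> Hom A x y" and g: "g \<in> Hom A y z"
  shows "Comp A g (Neg A f) = Neg A (Comp A g f)" "Comp A (Neg A g) f = Neg A (Comp A g f)"
proof -
  have "Add A (Comp A g f) (Comp A g (Neg A f)) = Zero A x z"
    using Comp_Add(1)[OF f Neg(1)[OF f] g g] Neg(2)[OF f] Comp_Zero[OF g] f Hom_Obj by metis
  then show "Comp A g (Neg A f) = Neg A (Comp A g f)"
    using Neg_unique[of "Comp A g f" x z] Comp_Hom f g Neg(1)[OF f] by metis
  have "Add A (Comp A g f) (Comp A (Neg A g) f) = Zero A x z"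
    using Comp_Add(2)[OF f f g Neg(1)[OF g]] Neg(2)[OF g] Zero_Comp[OF f] g Hom_Obj by metis
  then show "Comp A (Neg A g) f = Neg A (Comp A g f)"
    using Neg_unique[of "Comp A g f" x z] Comp_Hom f g Neg(1)[OF g] by metis
qed

text \<open>Turns a universal property into an equation between two arrows; in a functor category
  such an equation can be checked and read off componentwise.\<close>

lemma zero_object_iff: "zero_object A z \<longleftrightarrow> z \<in> Obj A \<and> Ident A z = Zero A z z"
proof safe
  assume z: "zero_object A z"
  show "z \<in> Obj A" using z by (rule zero_object_Obj)
  then show "Ident A z = Zero A z z"
    by (intro zero_object_to[OF z, of _ z]) simp_all
next
  assume z: "z \<in> Obj A" "Ident A z = Zero A z z"
  show "zero_object A z"
    unfolding zero_object_def
  proof (intro conjI ballI z(1) ex1I)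
    fix x assume x: "x \<in> Obj A"
    show "Zero A x z \<in> Hom A x z" "Zero A z x \<in> Hom A z x"
      using x z by simp_all
    show "f = Zero A x z" if "f \<in> Hom A x z" for f
      using that z x Zero_Comp Comp_Ident by metis
    show "f = Zero A z x" if "f \<in> Hom A z x" for f
      using that z x Comp_Zero Comp_Ident by metis
  qed
qed

text \<open>A retract of a zero object is zero. The vanishing of the positive satellites ends with
  this argument.\<close>

lemma zero_object_if_id_factors:
  assumes "zero_object A z" "f \<in> Hom A x z" "g \<in> Hom A z x" "Comp A g f = Ident A x"
  shows "zero_object A x"
proof -
  have "f = Zero A x z"
    using assms Hom_Obj zero_object_to by (metis Zero_Hom)
  then show ?thesis
    using assms zero_object_iff Comp_Zero Hom_Obj by metis
qed

section \<open>Kernels, cokernels and their invariance under isomorphism\<close>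

lemma kernelI:
  assumes "g \<in> Hom A y z" "k \<in> Hom A x y" "Comp A g k = Zero A x z" "is_mono A k"
    and "\<And>w h. h \<in> Hom A w y \<Longrightarrow> Comp A g h = Zero A w z \<Longrightarrow> \<exists>u\<in>Hom A w x. Comp A k u = h"
  shows "is_kernel A g k"
  unfolding is_kernel_def
proof (intro conjI ballI impI ex_ex1I)
  fix h assume h: "h \<in> Arr A" "Cod A h = Dom A g \<and> Comp A g h = Zero A (Dom A h) (Cod A g)"
  then show "\<exists>u. u \<in> Hom A (Dom A h) (Dom A k) \<and> Comp A k u = h"
    using assms(5)[of h "Dom A h"] HomD[OF assms(1)] HomD[OF assms(2)] by (auto simp: Hom_def)
  show "u = v" if "u \<in> Hom A (Dom A h) (Dom A k) \<and> Comp A k u = h"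
    "v \<in> Hom A (Dom A h) (Dom A k) \<and> Comp A k v = h" for u v
    using that mono_cancel[OF assms(4)] HomD[OF assms(2)] assms(2) by metis
qed (use assms HomD in \<open>auto simp: Hom_def\<close>)

lemma cokernelI:
  assumes "f \<in> Hom A x y" "c \<in> Hom A y z" "Comp A c f = Zero A x z" "is_epi A c"
    and "\<And>w h. h \<in> Hom A y w \<Longrightarrow> Comp A h f = Zero A x w \<Longrightarrow> \<exists>u\<in>Hom A z w. Comp A u c = h"
  shows "is_cokernel A f c"
  unfolding is_cokernel_def
proof (intro conjI ballI impI ex_ex1I)
  fix h assume h: "h \<in> Arr A" "Dom A h = Cod A f \<and> Comp A h f = Zero A (Dom A f) (Cod A h)"
  then show "\<exists>u. u \<in> Hom A (Cod A c) (Cod A h) \<and> Comp A u c = h"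
    using assms(5)[of h "Cod A h"] HomD[OF assms(1)] HomD[OF assms(2)] by (auto simp: Hom_def)
  show "u = v" if "u \<in> Hom A (Cod A c) (Cod A h) \<and> Comp A u c = h"
    "v \<in> Hom A (Cod A c) (Cod A h) \<and> Comp A v c = h" for u v
    using that epi_cancel[OF assms(4)] HomD[OF assms(2)] assms(2) by metis
qed (use assms HomD in \<open>auto simp: Hom_def\<close>)

lemma kernel_lift_unique:
  assumes "is_kernel A g k" "g \<in> Hom A y z" "h \<in> Hom A w y" "Comp A g h = Zero A w z"
  shows "\<exists>!u. u \<in> Hom A w (Dom A k) \<and> Comp A k u = h"
proof -
  have "\<forall>h\<in>Arr A. Cod A h = Dom A g \<and> Comp A g h = Zero A (Dom A h) (Cod A g) \<longrightarrow>
      (\<exists>!u. u \<in> Hom A (Dom A h) (Dom A k) \<and> Comp A k u = h)"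
    using assms(1) unfolding is_kernel_def by blast
  from this[rule_format, OF HomD(1)[OF assms(3)]] show ?thesis
    using assms(4) by (simp add: HomD[OF assms(2)] HomD[OF assms(3)])
qed

lemma cokernel_desc_unique:
  assumes "is_cokernel A f c" "f \<in> Hom A x y" "h \<in> Hom A y w" "Comp A h f = Zero A x w"
  shows "\<exists>!u. u \<in> Hom A (Cod A c) w \<and> Comp A u c = h"
proof -
  have "\<forall>h\<in>Arr A. Dom A h = Cod A f \<and> Comp A h f = Zero A (Dom A f) (Cod A h) \<longrightarrow>
      (\<exists>!u. u \<in> Hom A (Cod A c) (Cod A h) \<and> Comp A u c = h)"
    using assms(1) unfolding is_cokernel_def by blast
  from this[rule_format, OF HomD(1)[OF assms(3)]] show ?thesis
    using assms(4) by (simp add: HomD[OF assms(2)] HomD[OF assms(3)])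
qed

lemma kernelD:
  assumes "is_kernel A g k" "g \<in> Hom A y z"
  shows "k \<in> Hom A (Dom A k) y" "Comp A g k = Zero A (Dom A k) z" "is_mono A k"
proof -
  show k: "k \<in> Hom A (Dom A k) y" and c: "Comp A g k = Zero A (Dom A k) z"
    using assms by (auto simp: is_kernel_def Hom_def)
  show "is_mono A k"
  proof (rule monoI[OF k])
    fix x u v assume uv: "u \<in> Hom A x (Dom A k)" "v \<in> Hom A x (Dom A k)" "Comp A k u = Comp A k v"
    let ?h = "Comp A k u"
    have h: "?h \<in> Hom A x y"
      using uv k Comp_Hom by blast
    have "Comp A g ?h = Comp A (Comp A g k) u"
      using Comp_assoc uv k assms by blast
    also have "\<dots> = Zero A x z"
      using c uv Zero_Comp assms Hom_Obj by metis
    finally have "\<exists>!u. u \<in> Hom A x (Dom A k) \<and> Comp A k u = ?h"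
      using kernel_lift_unique assms h by blast
    then show "u = v"
      using uv by metis
  qed
qed

lemma kernel_lift:
  assumes "is_kernel A g k" "g \<in> Hom A y z" "h \<in> Hom A w y" "Comp A g h = Zero A w z"
  obtains u where "u \<in> Hom A w (Dom A k)" "Comp A k u = h"
  using kernel_lift_unique[OF assms] by blast

lemma cokernelD:
  assumes "is_cokernel A f c" "f \<in> Hom A x y"
  shows "c \<in> Hom A y (Cod A c)" "Comp A c f = Zero A x (Cod A c)" "is_epi A c"
proof -
  show c: "c \<in> Hom A y (Cod A c)" and z: "Comp A c f = Zero A x (Cod A c)"
    using assms by (auto simp: is_cokernel_def Hom_def)
  show "is_epi A c"
  proof (rule epiI[OF c])
    fix w u v assume uv: "u \<in> Hom A (Cod A c) w" "v \<in> Hom A (Cod A c) w" "Comp A u c = Comp A v c"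
    let ?h = "Comp A u c"
    have h: "?h \<in> Hom A y w"
      using uv c Comp_Hom by blast
    have "Comp A ?h f = Comp A u (Comp A c f)"
      using Comp_assoc uv c assms by metis
    also have "\<dots> = Zero A x w"
      using z uv Comp_Zero assms Hom_Obj by metis
    finally have "\<exists>!u. u \<in> Hom A (Cod A c) w \<and> Comp A u c = ?h"
      using cokernel_desc_unique assms h by blast
    then show "u = v"
      using uv by metis
  qed
qed

lemma cokernel_desc:
  assumes "is_cokernel A f c" "f \<in> Hom A x y" "h \<in> Hom A y w" "Comp A h f = Zero A x w"
  obtains u where "u \<in> Hom A (Cod A c) w" "Comp A u c = h"
  using cokernel_desc_unique[OF assms] by blast

lemma kernel_unique:
  assumes "is_kernel A g k" "is_kernel A g k'" "g \<in> Hom A y z"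
  obtains u where "u \<in> Hom A (Dom A k) (Dom A k')" "is_iso A u" "Comp A k' u = k"
proof -
  note k = kernelD[OF assms(1,3)] and k' = kernelD[OF assms(2,3)]
  obtain u where u: "u \<in> Hom A (Dom A k) (Dom A k')" "Comp A k' u = k"
    using kernel_lift[OF assms(2,3) k(1,2)] by blast
  obtain v where v: "v \<in> Hom A (Dom A k') (Dom A k)" "Comp A k v = k'"
    using kernel_lift[OF assms(1,3) k'(1,2)] by blast
  have "Comp A k (Comp A v u) = Comp A k (Ident A (Dom A k))"
    using Comp_assoc[OF u(1) v(1) k(1)] u(2) v(2) Comp_Ident(1)[OF k(1)] by simp
  then have "Comp A v u = Ident A (Dom A k)"
    by (rule mono_cancel[OF k(3,1) Comp_Hom[OF u(1) v(1)] Ident_Hom[OF Hom_Obj(1)[OF k(1)]]])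
  moreover have "Comp A k' (Comp A u v) = Comp A k' (Ident A (Dom A k'))"
    using Comp_assoc[OF v(1) u(1) k'(1)] u(2) v(2) Comp_Ident(1)[OF k'(1)] by simp
  then have "Comp A u v = Ident A (Dom A k')"
    by (rule mono_cancel[OF k'(3,1) Comp_Hom[OF v(1) u(1)] Ident_Hom[OF Hom_Obj(1)[OF k'(1)]]])
  ultimately show ?thesis
    using that u v isoI by blast
qed

lemma cokernel_unique:
  assumes "is_cokernel A f c" "is_cokernel A f c'" "f \<in> Hom A x y"
  obtains u where "u \<in> Hom A (Cod A c) (Cod A c')" "is_iso A u" "Comp A u c = c'"
proof -
  note c = cokernelD[OF assms(1,3)] and c' = cokernelD[OF assms(2,3)]
  obtain u where u: "u \<in> Hom A (Cod A c) (Cod A c')" "Comp A u c = c'"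
    using cokernel_desc[OF assms(1,3) c'(1,2)] by blast
  obtain v where v: "v \<in> Hom A (Cod A c') (Cod A c)" "Comp A v c' = c"
    using cokernel_desc[OF assms(2,3) c(1,2)] by blast
  have "Comp A (Comp A v u) c = Comp A (Ident A (Cod A c)) c"
    using Comp_assoc[OF c(1) u(1) v(1)] u(2) v(2) Comp_Ident(2)[OF c(1)] by simp
  then have "Comp A v u = Ident A (Cod A c)"
    by (rule epi_cancel[OF c(3,1) Comp_Hom[OF u(1) v(1)] Ident_Hom[OF Hom_Obj(2)[OF c(1)]]])
  moreover have "Comp A (Comp A u v) c' = Comp A (Ident A (Cod A c')) c'"
    using Comp_assoc[OF c'(1) v(1) u(1)] u(2) v(2) Comp_Ident(2)[OF c'(1)] by simp
  then have "Comp A u v = Ident A (Cod A c')"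
    by (rule epi_cancel[OF c'(3,1) Comp_Hom[OF v(1) u(1)] Ident_Hom[OF Hom_Obj(2)[OF c'(1)]]])
  ultimately show ?thesis
    using that u v isoI by blast
qed

lemma short_exactD:
  assumes "short_exact A f g"
  shows "f \<in> Hom A (Dom A f) (Cod A f)" "g \<in> Hom A (Cod A f) (Cod A g)" "Dom A g = Cod A f"
    "Comp A g f = Zero A (Dom A f) (Cod A g)" "is_mono A f" "is_epi A g"
proof -
  have "g \<in> Arr A \<and> f \<in> Arr A \<and> Cod A f = Dom A g"
    using assms unfolding short_exact_def is_kernel_def by blast
  then show f: "f \<in> Hom A (Dom A f) (Cod A f)" and g: "g \<in> Hom A (Cod A f) (Cod A g)" and "Dom A g = Cod A f"
    by (simp_all add: Hom_def)
  show "Comp A g f = Zero A (Dom A f) (Cod A g)" "is_mono A f" "is_epi A g"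
    using kernelD[OF _ g] cokernelD[OF _ f] assms by (auto simp: short_exact_def)
qed

text \<open>The vertical isomorphisms run from the new diagram to the old one, so that a test arrow
  into \<open>y'\<close> can be pushed into \<open>y\<close> and lifted there. In
  \<open>cokernel_transport\<close> they run the other way, because test arrows leave
  \<open>y'\<close>.\<close>

lemma kernel_transport:
  assumes k: "is_kernel A g f" "f \<in> Hom A x y" "g \<in> Hom A y z"
    and f': "f' \<in> Hom A x' y'" and g': "g' \<in> Hom A y' z'"
    and u: "u \<in> Hom A x' x" "is_iso A u" and v: "v \<in> Hom A y' y" "is_iso A v"
    and w: "w \<in> Hom A z' z" "is_iso A w"
    and uf: "Comp A v f' = Comp A f u" and vg: "Comp A w g' = Comp A g v"
  shows "is_kernel A g' f'"
proof (rule kernelI[OF g' f'])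
  have fd: "Dom A f = x" using HomD[OF k(2)] by simp
  obtain v' where v': "v' \<in> Hom A y y'" "Comp A v' v = Ident A y'"
    using isoE[OF v(2,1)] by blast
  have "Comp A w (Comp A g' f') = Comp A (Comp A g v) f'"
    using Comp_assoc[OF f' g' w(1)] vg by simp
  also have "\<dots> = Comp A (Comp A g f) u"
    using Comp_assoc[OF f' v(1) k(3)] Comp_assoc[OF u(1) k(2,3)] uf by simp
  also have "\<dots> = Comp A w (Zero A x' z')"
    using kernelD(2)[OF k(1,3)] fd Zero_Comp[OF u(1)] Comp_Zero[OF w(1)] Hom_Obj[OF k(3)]
      Hom_Obj[OF u(1)] by simp
  finally show "Comp A g' f' = Zero A x' z'"
    using mono_cancel[OF iso_mono[OF w(2)] w(1)] Comp_Hom[OF f' g'] Zero_Hom Hom_Obj[OF f'] Hom_Obj[OF g']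
    by blast
  show "is_mono A f'"
  proof (rule monoI[OF f'])
    fix t a b assume a: "a \<in> Hom A t x'" and b: "b \<in> Hom A t x'" and ab: "Comp A f' a = Comp A f' b"
    have "Comp A f (Comp A u a) = Comp A f (Comp A u b)"
      using Comp_assoc[OF a u(1) k(2)] Comp_assoc[OF b u(1) k(2)] uf[symmetric]
        Comp_assoc[OF a f' v(1)] Comp_assoc[OF b f' v(1)] ab by simp
    then have "Comp A u a = Comp A u b"
      using mono_cancel[OF kernelD(3)[OF k(1,3)] k(2)] Comp_Hom[OF a u(1)] Comp_Hom[OF b u(1)] by blast
    then show "a = b"
      using mono_cancel[OF iso_mono[OF u(2)] u(1) a b] by blast
  qed
  fix t h assume h: "h \<in> Hom A t y'" and hz: "Comp A g' h = Zero A t z'"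
  have "Comp A g (Comp A v h) = Comp A w (Comp A g' h)"
    using Comp_assoc[OF h v(1) k(3)] Comp_assoc[OF h g' w(1)] vg by simp
  then have "Comp A g (Comp A v h) = Zero A t z"
    using hz Comp_Zero[OF w(1)] Hom_Obj[OF h] by simp
  then obtain a where a: "a \<in> Hom A t x" "Comp A f a = Comp A v h"
    using kernel_lift[OF k(1,3) Comp_Hom[OF h v(1)]] fd by metis
  obtain u' where u': "u' \<in> Hom A x x'" "Comp A u u' = Ident A x"
    using isoE[OF u(2,1)] by blast
  have "Comp A v (Comp A f' (Comp A u' a)) = Comp A (Comp A f u) (Comp A u' a)"
    using Comp_assoc[OF Comp_Hom[OF a(1) u'(1)] f' v(1)] uf by simp
  also have "\<dots> = Comp A f (Comp A (Comp A u u') a)"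
    using Comp_assoc[OF Comp_Hom[OF a(1) u'(1)] u(1) k(2)] Comp_assoc[OF a(1) u'(1) u(1)] by simp
  also have "\<dots> = Comp A v h"
    using a u'(2) Comp_Ident(2)[OF a(1)] by simp
  finally have "Comp A f' (Comp A u' a) = h"
    using mono_cancel[OF iso_mono[OF v(2)] v(1)] h Comp_Hom[OF Comp_Hom[OF a(1) u'(1)] f'] by blast
  then show "\<exists>u\<in>Hom A t x'. Comp A f' u = h"
    using Comp_Hom[OF a(1) u'(1)] by blast
qed

lemma cokernel_transport:
  assumes k: "is_cokernel A f g" "f \<in> Hom A x y" "g \<in> Hom A y z"
    and f': "f' \<in> Hom A x' y'" and g': "g' \<in> Hom A y' z'"
    and u: "u \<in> Hom A x x'" "is_iso A u" and v: "v \<in> Hom A y y'" "is_iso A v"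
    and w: "w \<in> Hom A z z'" "is_iso A w"
    and uf: "Comp A f' u = Comp A v f" and vg: "Comp A g' v = Comp A w g"
  shows "is_cokernel A f' g'"
proof (rule cokernelI[OF f' g'])
  have gd: "Cod A g = z" using HomD[OF k(3)] by simp
  have "Comp A (Comp A g' f') u = Comp A g' (Comp A v f)"
    using Comp_assoc[OF u(1) f' g'] uf by simp
  also have "\<dots> = Comp A w (Comp A g f)"
    using Comp_assoc[OF k(2) v(1) g'] Comp_assoc[OF k(2,3) w(1)] vg by simp
  also have "\<dots> = Comp A (Zero A x' z') u"
    using cokernelD(2)[OF k(1,2)] gd Zero_Comp[OF u(1)] Comp_Zero[OF w(1)] Hom_Obj[OF w(1)]
      Hom_Obj[OF u(1)] by simp
  finally show "Comp A g' f' = Zero A x' z'"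
    using epi_cancel[OF iso_epi[OF u(2)] u(1)] Comp_Hom[OF f' g'] Zero_Hom Hom_Obj[OF f'] Hom_Obj[OF g']
    by blast
  show "is_epi A g'"
  proof (rule epiI[OF g'])
    fix t a b assume a: "a \<in> Hom A z' t" and b: "b \<in> Hom A z' t" and ab: "Comp A a g' = Comp A b g'"
    have "Comp A (Comp A a w) g = Comp A (Comp A b w) g"
      using Comp_assoc[OF k(3) w(1) a] Comp_assoc[OF k(3) w(1) b] vg[symmetric]
        Comp_assoc[OF v(1) g' a] Comp_assoc[OF v(1) g' b] ab by simp
    then have "Comp A a w = Comp A b w"
      using epi_cancel[OF cokernelD(3)[OF k(1,2)] k(3)] Comp_Hom[OF w(1) a] Comp_Hom[OF w(1) b] by blast
    then show "a = b"
      using epi_cancel[OF iso_epi[OF w(2)] w(1) a b] by blast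
  qed
  fix t h assume h: "h \<in> Hom A y' t" and hz: "Comp A h f' = Zero A x' t"
  have "Comp A (Comp A h v) f = Comp A (Comp A h f') u"
    using Comp_assoc[OF k(2) v(1) h] Comp_assoc[OF u(1) f' h] uf by simp
  then have "Comp A (Comp A h v) f = Zero A x t"
    using hz Zero_Comp[OF u(1)] Hom_Obj[OF h] by simp
  then obtain a where a: "a \<in> Hom A z t" "Comp A a g = Comp A h v"
    using cokernel_desc[OF k(1,2) Comp_Hom[OF v(1) h]] gd by metis
  obtain w' where w': "w' \<in> Hom A z' z" "Comp A w' w = Ident A z"
    using isoE[OF w(2,1)] by blast
  have "Comp A (Comp A (Comp A a w') g') v = Comp A (Comp A a w') (Comp A w g)"
    using Comp_assoc[OF v(1) g' Comp_Hom[OF w'(1) a(1)]] vg by simp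
  also have "\<dots> = Comp A (Comp A a (Comp A w' w)) g"
    using Comp_assoc[OF k(3) w(1) Comp_Hom[OF w'(1) a(1)]] Comp_assoc[OF w(1) w'(1) a(1)] by simp
  also have "\<dots> = Comp A h v"
    using a w'(2) Comp_Ident(1)[OF a(1)] by simp
  finally have "Comp A (Comp A a w') g' = h"
    using epi_cancel[OF iso_epi[OF v(2)] v(1)] h Comp_Hom[OF g' Comp_Hom[OF w'(1) a(1)]] by blast
  then show "\<exists>u\<in>Hom A z' t. Comp A u g' = h"
    using Comp_Hom[OF w'(1) a(1)] by blast
qed

lemma kernel_iso:
  assumes "is_kernel A g k" "k' \<in> Hom A x' y" "u \<in> Hom A x' (Dom A k)" "is_iso A u" "Comp A k u = k'"
    and g: "g \<in> Hom A y z"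
  shows "is_kernel A g k'"
proof -
  note k = kernelD(1)[OF assms(1) g] and o = Hom_Obj[OF g]
  show ?thesis
    by (rule kernel_transport[OF assms(1) k g assms(2) g assms(3,4) Ident_Hom[OF o(1)] iso_Ident[OF o(1)]
          Ident_Hom[OF o(2)] iso_Ident[OF o(2)]])
      (use assms(5) Comp_Ident[OF assms(2)] Comp_Ident[OF g] in simp_all)
qed

lemma cokernel_iso:
  assumes "is_cokernel A f c" "c' \<in> Hom A y z'" "u \<in> Hom A (Cod A c) z'" "is_iso A u" "Comp A u c = c'"
    and f: "f \<in> Hom A x y"
  shows "is_cokernel A f c'"
proof -
  note c = cokernelD(1)[OF assms(1) f] and o = Hom_Obj[OF f]
  show ?thesis
    by (rule cokernel_transport[OF assms(1) f c f assms(2) Ident_Hom[OF o(1)] iso_Ident[OF o(1)]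
          Ident_Hom[OF o(2)] iso_Ident[OF o(2)] assms(3,4)])
      (use assms(5) Comp_Ident[OF assms(2)] Comp_Ident[OF f] in simp_all)
qed

end

text \<open>The structure shared by \<open>A\<close> and the functor categories over it, where
  kernels and cokernels are pointwise. Homology and satellites are developed once and used on both
  levels.\<close>

locale preabelian = preadd +
  assumes kernel_ex: "f \<in> Arr A \<Longrightarrow> \<exists>k. is_kernel A f k"
    and cokernel_ex: "f \<in> Arr A \<Longrightarrow> \<exists>c. is_cokernel A f c"
    and zero_object_ex: "\<exists>z. zero_object A z"
begin

lemma ker: "g \<in> Hom A y z \<Longrightarrow> is_kernel A g (ker A g)"
  unfolding ker_def using kernel_ex[of g] by (auto intro: someI dest: HomD)

lemma cok: "f \<in> Hom A x y \<Longrightarrow> is_cokernel A f (cok A f)"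
  unfolding cok_def using cokernel_ex[of f] by (auto intro: someI dest: HomD)

lemma ker_lift:
  assumes "g \<in> Hom A y z" "h \<in> Hom A w y" "Comp A g h = Zero A w z"
  shows "ker_lift A g h \<in> Hom A w (Dom A (ker A g))" "Comp A (ker A g) (ker_lift A g h) = h"
proof -
  have "\<exists>!u. u \<in> Hom A (Dom A h) (Dom A (ker A g)) \<and> Comp A (ker A g) u = h"
    using kernel_lift_unique[OF ker[OF assms(1)] assms] by (simp add: HomD[OF assms(2)])
  from theI'[OF this] show "ker_lift A g h \<in> Hom A w (Dom A (ker A g))"
    "Comp A (ker A g) (ker_lift A g h) = h"
    by (simp_all add: ker_lift_def HomD[OF assms(2)])
qed

lemma ker_lift_eqI:
  assumes "g \<in> Hom A y z" "u \<in> Hom A w (Dom A (ker A g))" "Comp A (ker A g) u = h"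
  shows "ker_lift A g h = u"
proof -
  note k = kernelD[OF ker[OF assms(1)] assms(1)]
  have h: "h \<in> Hom A w y"
    using assms(2,3) k(1) Comp_Hom by blast
  have "Comp A g h = Zero A w z"
    using Comp_assoc[OF assms(2) k(1) assms(1)] k(2) assms(3) Zero_Comp[OF assms(2)] Hom_Obj[OF assms(1)]
    by simp
  note l = ker_lift[OF assms(1) h this]
  show ?thesis
    by (rule mono_cancel[OF k(3,1) l(1) assms(2)]) (simp add: l(2) assms(3))
qed

lemma cok_desc:
  assumes "f \<in> Hom A x y" "h \<in> Hom A y w" "Comp A h f = Zero A x w"
  shows "cok_desc A f h \<in> Hom A (Cod A (cok A f)) w" "Comp A (cok_desc A f h) (cok A f) = h"
proof -
  have "\<exists>!u. u \<in> Hom A (Cod A (cok A f)) (Cod A h) \<and> Comp A u (cok A f) = h"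
    using cokernel_desc_unique[OF cok[OF assms(1)] assms] by (simp add: HomD[OF assms(2)])
  from theI'[OF this] show "cok_desc A f h \<in> Hom A (Cod A (cok A f)) w"
    "Comp A (cok_desc A f h) (cok A f) = h"
    by (simp_all add: cok_desc_def HomD[OF assms(2)])
qed

section \<open>Homology of three-term complexes\<close>

definition cpx :: "'b \<Rightarrow> 'b \<Rightarrow> 'a \<Rightarrow> 'a \<Rightarrow> 'a \<Rightarrow> bool" where
  "cpx f g x y z \<longleftrightarrow> f \<in> Hom A x y \<and> g \<in> Hom A y z \<and> Comp A g f = Zero A x z"

lemma cpxD:
  assumes "cpx f g x y z"
  shows "f \<in> Hom A x y" "g \<in> Hom A y z" "Comp A g f = Zero A x z"
    "ker A g \<in> Hom A (Dom A (ker A g)) y" "is_mono A (ker A g)"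
    "Comp A g (ker A g) = Zero A (Dom A (ker A g)) z"
    "ker_lift A g f \<in> Hom A x (Dom A (ker A g))" "Comp A (ker A g) (ker_lift A g f) = f"
    "homol_proj A f g \<in> Hom A (Dom A (ker A g)) (homol A f g)" "is_epi A (homol_proj A f g)"
    "Comp A (homol_proj A f g) (ker_lift A g f) = Zero A x (homol A f g)"
    "homol A f g \<in> Obj A"
proof -
  show f: "f \<in> Hom A x y" and g: "g \<in> Hom A y z" and gf: "Comp A g f = Zero A x z"
    using assms by (simp_all add: cpx_def)
  show "ker A g \<in> Hom A (Dom A (ker A g)) y" "is_mono A (ker A g)"
    "Comp A g (ker A g) = Zero A (Dom A (ker A g)) z"
    using kernelD[OF ker[OF g] g] by simp_all
  show l: "ker_lift A g f \<in> Hom A x (Dom A (ker A g))" and "Comp A (ker A g) (ker_lift A g f) = f"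
    using ker_lift[OF g f gf] by simp_all
  show "homol_proj A f g \<in> Hom A (Dom A (ker A g)) (homol A f g)" "is_epi A (homol_proj A f g)"
    "Comp A (homol_proj A f g) (ker_lift A g f) = Zero A x (homol A f g)"
    using cokernelD[OF cok[OF l] l] by (simp_all add: homol_def homol_proj_def)
  then show "homol A f g \<in> Obj A"
    using Hom_Obj by blast
qed

text \<open>The right square lets \<open>v\<close> restrict to the kernels, and the left square
  makes the restriction respect the lifts of \<open>f\<close> and \<open>f'\<close>; hence it
  descends to the cokernels.\<close>

lemma homol_map:
  assumes c: "cpx f g x y z" and c': "cpx f' g' x' y' z'"
    and u: "u \<in> Hom A x x'" and v: "v \<in> Hom A y y'" and w: "w \<in> Hom A z z'"
    and uv: "Comp A f' u = Comp A v f" and vw: "Comp A g' v = Comp A w g"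
  shows "ker_lift A g' (Comp A v (ker A g)) \<in> Hom A (Dom A (ker A g)) (Dom A (ker A g'))"
    "Comp A (ker A g') (ker_lift A g' (Comp A v (ker A g))) = Comp A v (ker A g)"
    "homol_map A f g f' g' v \<in> Hom A (homol A f g) (homol A f' g')"
    "Comp A (homol_map A f g f' g' v) (homol_proj A f g) =
     Comp A (homol_proj A f' g') (ker_lift A g' (Comp A v (ker A g)))"
proof -
  note C = cpxD[OF c] and C' = cpxD[OF c']
  have vk: "Comp A v (ker A g) \<in> Hom A (Dom A (ker A g)) y'"
    using C(4) v Comp_Hom by blast
  have "Comp A g' (Comp A v (ker A g)) = Comp A w (Comp A g (ker A g))"
    using Comp_assoc[OF C(4) v C'(2)] Comp_assoc[OF C(4,2) w] vw by simp
  also have "\<dots> = Zero A (Dom A (ker A g)) z'"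
    using C(6) Comp_Zero[OF w] Hom_Obj[OF C(4)] by simp
  finally have z: "Comp A g' (Comp A v (ker A g)) = Zero A (Dom A (ker A g)) z'" .
  let ?l = "ker_lift A g' (Comp A v (ker A g))"
  show l: "?l \<in> Hom A (Dom A (ker A g)) (Dom A (ker A g'))"
    and kl: "Comp A (ker A g') ?l = Comp A v (ker A g)"
    using ker_lift[OF C'(2) vk z] by simp_all
  have "Comp A (ker A g') (Comp A ?l (ker_lift A g f)) = Comp A v f"
    using Comp_assoc[OF C(7) l C'(4)] kl Comp_assoc[OF C(7,4) v] C(8) by simp
  also have "\<dots> = Comp A (ker A g') (Comp A (ker_lift A g' f') u)"
    using uv C'(8) Comp_assoc[OF u C'(7,4)] by simp
  finally have lf: "Comp A ?l (ker_lift A g f) = Comp A (ker_lift A g' f') u"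
    by (rule mono_cancel[OF C'(5,4) Comp_Hom[OF C(7) l] Comp_Hom[OF u C'(7)]])
  have "Comp A (Comp A (homol_proj A f' g') ?l) (ker_lift A g f) =
      Comp A (Comp A (homol_proj A f' g') (ker_lift A g' f')) u"
    using Comp_assoc[OF C(7) l C'(9)] Comp_assoc[OF u C'(7,9)] lf by simp
  also have "\<dots> = Zero A x (homol A f' g')"
    using C'(11,12) Zero_Comp[OF u] by simp
  finally show "homol_map A f g f' g' v \<in> Hom A (homol A f g) (homol A f' g')"
    "Comp A (homol_map A f g f' g' v) (homol_proj A f g) = Comp A (homol_proj A f' g') ?l"
    using cok_desc[OF C(7) Comp_Hom[OF l C'(9)]] by (simp_all add: homol_map_def homol_proj_def homol_def)
qed

text \<open>Since \<open>ker\<close> is monic and \<open>homol_proj\<close> is epic, any pair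
  \<open>l\<close>, \<open>h\<close> fitting the diagram is the induced pair. Functoriality then
  only requires exhibiting one.\<close>

lemma homol_map_eqI:
  assumes c: "cpx f g x y z" and c': "cpx f' g' x' y' z'"
    and u: "u \<in> Hom A x x'" and v: "v \<in> Hom A y y'" and w: "w \<in> Hom A z z'"
    and uv: "Comp A f' u = Comp A v f" and vw: "Comp A g' v = Comp A w g"
    and h: "h \<in> Hom A (homol A f g) (homol A f' g')"
    and l: "l \<in> Hom A (Dom A (ker A g)) (Dom A (ker A g'))" "Comp A (ker A g') l = Comp A v (ker A g)"
    and hl: "Comp A h (homol_proj A f g) = Comp A (homol_proj A f' g') l"
  shows "homol_map A f g f' g' v = h"
proof -
  note C = cpxD[OF c] and C' = cpxD[OF c']
  note H = homol_map[OF c c' u v w uv vw]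
  have "ker_lift A g' (Comp A v (ker A g)) = l"
    by (rule ker_lift_eqI[OF C'(2) l])
  then show ?thesis
    using epi_cancel[OF C(10,9) H(3) h] H(4) hl by simp
qed

lemma homol_map_Ident:
  assumes "cpx f g x y z"
  shows "homol_map A f g f g (Ident A y) = Ident A (homol A f g)"
proof -
  note C = cpxD[OF assms]
  note o = Hom_Obj[OF C(1)] Hom_Obj[OF C(2)]
  show ?thesis
    by (rule homol_map_eqI[OF assms assms Ident_Hom[OF o(1)] Ident_Hom[OF o(2)] Ident_Hom[OF o(4)] _ _
          _ Ident_Hom[of "Dom A (ker A g)"]])
      (use C Comp_Ident[OF C(1)] Comp_Ident[OF C(2)] Comp_Ident[OF C(4)] Comp_Ident[OF C(9)] Hom_Obj[OF C(4)]
        in simp_all)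
qed

lemma homol_map_Comp:
  assumes c: "cpx f g x y z" and c': "cpx f' g' x' y' z'" and c'': "cpx f'' g'' x'' y'' z''"
    and u: "u \<in> Hom A x x'" and v: "v \<in> Hom A y y'" and w: "w \<in> Hom A z z'"
    and uv: "Comp A f' u = Comp A v f" and vw: "Comp A g' v = Comp A w g"
    and u': "u' \<in> Hom A x' x''" and v': "v' \<in> Hom A y' y''" and w': "w' \<in> Hom A z' z''"
    and uv': "Comp A f'' u' = Comp A v' f'" and vw': "Comp A g'' v' = Comp A w' g'"
  shows "homol_map A f g f'' g'' (Comp A v' v) =
    Comp A (homol_map A f' g' f'' g'' v') (homol_map A f g f' g' v)"
proof -
  note C = cpxD[OF c] and C' = cpxD[OF c'] and C'' = cpxD[OF c'']
  note H = homol_map[OF c c' u v w uv vw] and H' = homol_map[OF c' c'' u' v' w' uv' vw']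
  let ?l = "ker_lift A g' (Comp A v (ker A g))" and ?l' = "ker_lift A g'' (Comp A v' (ker A g'))"
  show ?thesis
  proof (rule homol_map_eqI[OF c c'' Comp_Hom[OF u u'] Comp_Hom[OF v v'] Comp_Hom[OF w w'] _ _
        Comp_Hom[OF H(3) H'(3)] Comp_Hom[OF H(1) H'(1)]])
    show "Comp A f'' (Comp A u' u) = Comp A (Comp A v' v) f"
      using Comp_assoc[OF u u' C''(1)] uv' Comp_assoc[OF u C'(1) v'] uv Comp_assoc[OF C(1) v v'] by simp
    show "Comp A g'' (Comp A v' v) = Comp A (Comp A w' w) g"
      using Comp_assoc[OF v v' C''(2)] vw' Comp_assoc[OF v C'(2) w'] vw Comp_assoc[OF C(2) w w'] by simp
    show "Comp A (ker A g'') (Comp A ?l' ?l) = Comp A (Comp A v' v) (ker A g)"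
      using Comp_assoc[OF H(1) H'(1) C''(4)] H'(2) Comp_assoc[OF H(1) C'(4) v'] H(2)
        Comp_assoc[OF C(4) v v'] by simp
    show "Comp A (Comp A (homol_map A f' g' f'' g'' v') (homol_map A f g f' g' v)) (homol_proj A f g) =
        Comp A (homol_proj A f'' g'') (Comp A ?l' ?l)"
      using Comp_assoc[OF C(9) H(3) H'(3)] H(4) Comp_assoc[OF H(1) C'(9) H'(3)] H'(4)
        Comp_assoc[OF H(1) H'(1) C''(9)] by simp
  qed
qed

text \<open>The identity and the zero endomorphism of \<open>y\<close> agree after \<open>p\<close>,
  and \<open>p\<close> can be cancelled.\<close>

lemma zero_object_epi:
  assumes "is_epi A p" "p \<in> Hom A x y" "p = Zero A x y"
  shows "zero_object A y"
proof -
  have y: "y \<in> Obj A" "x \<in> Obj A"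
    using Hom_Obj assms(2) by simp_all
  have "Comp A (Ident A y) p = Comp A (Zero A y y) p"
    using assms Zero_Comp[OF assms(2)] Comp_Ident[OF assms(2)] y by simp
  then show ?thesis
    using epi_cancel[OF assms(1,2) Ident_Hom Zero_Hom] y zero_object_iff by blast
qed

lemma zero_object_mono:
  assumes "is_mono A k" "k \<in> Hom A x y" "k = Zero A x y"
  shows "zero_object A x"
proof -
  have x: "x \<in> Obj A"
    using Hom_Obj assms(2) by simp
  have "Comp A k (Ident A x) = Comp A k (Zero A x x)"
    using assms Comp_Zero[OF assms(2)] Comp_Ident[OF assms(2)] x by simp
  then show ?thesis
    using mono_cancel[OF assms(1,2) Ident_Hom Zero_Hom] x zero_object_iff by blast
qed

lemma zero_homol_if_ker_zero:
  assumes c: "cpx f g x y z" and "ker A g = Zero A (Dom A (ker A g)) y"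
  shows "zero_object A (homol A f g)"
proof -
  note C = cpxD[OF c]
  have z: "zero_object A (Dom A (ker A g))"
    using zero_object_mono[OF C(5,4) assms(2)] .
  show ?thesis
    by (rule zero_object_epi[OF C(10,9) zero_object_from[OF z C(9) Zero_Hom]])
      (use C(12) zero_object_Obj[OF z] in simp_all)
qed

lemma zero_homol:
  assumes c: "cpx f g x y z" and "zero_object A y"
  shows "zero_object A (homol A f g)"
proof -
  note C = cpxD[OF c]
  show ?thesis
    by (rule zero_homol_if_ker_zero[OF c])
      (use C(4) Hom_Obj[OF C(4)] in \<open>auto intro: zero_object_to[OF assms(2)]\<close>)
qed

lemma exact_atI: "cpx f g x y z \<Longrightarrow> zero_object A (homol A f g) \<Longrightarrow> exact_at A f g"
  unfolding exact_at_def cpx_def by (auto simp: Hom_def)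

lemma exact_at_zero:
  assumes "f \<in> Hom A x y" "g \<in> Hom A y z" "zero_object A y"
  shows "exact_at A f g"
proof -
  have y: "y \<in> Obj A" "z \<in> Obj A"
    using Hom_Obj assms by simp_all
  have "g = Zero A y z"
    by (rule zero_object_from[OF assms(3,2) Zero_Hom[OF y]])
  then have "cpx f g x y z"
    using assms Zero_Comp[OF assms(1)] y by (auto simp: cpx_def)
  then show ?thesis
    using exact_atI zero_homol assms by blast
qed

text \<open>A mono has zero kernel. This is exactness at the left end of an image sequence of an
  exact functor, where the preceding connecting morphism is zero.\<close>

lemma exact_at_mono:
  assumes "w \<in> Obj A" "f \<in> Hom A x y" "is_mono A f"
  shows "exact_at A (Zero A w x) f"
proof -
  have c: "cpx (Zero A w x) f w x y"
    using assms Comp_Zero Hom_Obj[OF assms(2)] by (auto simp: cpx_def)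
  note C = cpxD[OF c]
  have d: "Dom A (ker A f) \<in> Obj A" "x \<in> Obj A"
    using Hom_Obj[OF C(4)] by simp_all
  have "ker A f = Zero A (Dom A (ker A f)) x"
    by (rule mono_cancel[OF assms(3,2) C(4) Zero_Hom[OF d]]) (simp add: C(6) Comp_Zero[OF assms(2)] d)
  then show ?thesis
    using exact_atI[OF c] zero_homol_if_ker_zero[OF c] by blast
qed

text \<open>As \<open>f\<close> is itself a kernel of \<open>g\<close>, its lift to the selected
  kernel is an isomorphism, and an isomorphism has zero cokernel.\<close>

lemma exact_at_short_exact:
  assumes "short_exact A f g"
  shows "exact_at A f g"
proof -
  note S = short_exactD[OF assms]
  have c: "cpx f g (Dom A f) (Cod A f) (Cod A g)"
    using S by (simp add: cpx_def)
  note C = cpxD[OF c]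
  have "is_kernel A g f"
    using assms by (simp add: short_exact_def)
  then obtain u where u: "u \<in> Hom A (Dom A f) (Dom A (ker A g))" "is_iso A u" "Comp A (ker A g) u = f"
    using kernel_unique[OF _ ker[OF C(2)] C(2)] by blast
  have l: "ker_lift A g f = u"
    by (rule ker_lift_eqI[OF C(2) u(1,3)])
  have "homol_proj A f g = Zero A (Dom A (ker A g)) (homol A f g)"
    by (rule epi_cancel[OF iso_epi[OF u(2)] u(1) C(9) Zero_Hom])
      (use l C(11,12) Zero_Comp[OF u(1)] Hom_Obj[OF C(4)] in simp_all)
  then show ?thesis
    using exact_atI[OF c] zero_object_epi[OF C(10,9)] by blast
qed

text \<open>The canonical comparison from the homology at y, with zero maps on both sides, to y
  itself. It supplies \<open>next_page\<close> for a spectral sequence whose differentials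
  vanish.\<close>

definition homol_zero_iso :: "'b \<Rightarrow> 'b \<Rightarrow> 'b" where
  "homol_zero_iso f g = cok_desc A (ker_lift A g f) (ker A g)"

lemma homol_zero_iso:
  assumes o: "x \<in> Obj A" "y \<in> Obj A" "z \<in> Obj A"
  defines "f \<equiv> Zero A x y" and "g \<equiv> Zero A y z"
  shows "cpx f g x y z"
    and "homol_zero_iso f g \<in> Hom A (homol A f g) y" "is_iso A (homol_zero_iso f g)"
    and "Comp A (homol_zero_iso f g) (homol_proj A f g) = ker A g"
proof -
  show c: "cpx f g x y z"
    using o Comp_Zero[OF Zero_Hom[OF o(2,3)] o(1)] by (simp add: cpx_def f_def g_def)
  note C = cpxD[OF c]
  let ?k = "ker A g" and ?p = "homol_proj A f g" and ?n = "homol_zero_iso f g"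
  \<comment> \<open>The identity is another kernel of the zero arrow \<open>g\<close>, so the
    selected kernel \<open>?k\<close> has an inverse \<open>u\<close>. The inverse of the comparison
    is then \<open>?p\<close> after \<open>u\<close>.\<close>
  have "is_kernel A g (Ident A y)"
    by (rule kernelI[OF C(2) Ident_Hom[OF o(2)]])
      (use Comp_Ident(1)[OF Zero_Hom[OF o(2,3)]] Comp_Ident(2) iso_mono[OF iso_Ident] o in
        \<open>auto simp: g_def\<close>)
  then obtain u where u: "u \<in> Hom A y (Dom A ?k)" "Comp A ?k u = Ident A y"
    using kernel_unique[OF _ ker[OF C(2)] C(2)] HomD[OF Ident_Hom[OF o(2)]] by metis
  have "Comp A ?k (Comp A u ?k) = Comp A ?k (Ident A (Dom A ?k))"
    using Comp_assoc[OF C(4) u(1) C(4)] u(2) Comp_Ident[OF C(4)] by simp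
  then have uk: "Comp A u ?k = Ident A (Dom A ?k)"
    by (rule mono_cancel[OF C(5,4) Comp_Hom[OF C(4) u(1)] Ident_Hom[OF Hom_Obj(1)[OF C(4)]]])
  have l: "ker_lift A g f = Zero A x (Dom A ?k)"
    by (rule ker_lift_eqI[OF C(2) Zero_Hom])
      (use o Hom_Obj[OF C(4)] Comp_Zero[OF C(4)] in \<open>simp_all add: f_def\<close>)
  have "Comp A ?k (ker_lift A g f) = Zero A x y"
    using C(8) by (simp add: f_def)
  then show n: "?n \<in> Hom A (homol A f g) y" and np: "Comp A ?n ?p = ?k"
    using cok_desc[OF C(7,4)] by (simp_all add: homol_def homol_proj_def homol_zero_iso_def)
  show "is_iso A ?n"
  proof (rule isoI[OF n Comp_Hom[OF u(1) C(9)]])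
    have "Comp A (Comp A (Comp A ?p u) ?n) ?p = Comp A (Ident A (homol A f g)) ?p"
      using Comp_assoc[OF C(9) n Comp_Hom[OF u(1) C(9)]] np Comp_assoc[OF C(4) u(1) C(9)] uk Comp_Ident[OF C(9)]
      by simp
    then show "Comp A (Comp A ?p u) ?n = Ident A (homol A f g)"
      by (rule epi_cancel[OF C(10,9) Comp_Hom[OF n Comp_Hom[OF u(1) C(9)]] Ident_Hom[OF C(12)]])
    show "Comp A ?n (Comp A ?p u) = Ident A y"
      using Comp_assoc[OF u(1) C(9) n] np u(2) by simp
  qed
qed

text \<open>This is the compatibility of a morphism of spectral sequences with
  \<open>next_page\<close> when all differentials are zero.\<close>

lemma homol_zero_iso_natural:
  assumes o: "x \<in> Obj A" "y \<in> Obj A" "z \<in> Obj A" "x' \<in> Obj A" "y' \<in> Obj A" "z' \<in> Obj A"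
    and v: "v \<in> Hom A y y'"
  defines "f \<equiv> Zero A x y" and "g \<equiv> Zero A y z" and "f' \<equiv> Zero A x' y'" and "g' \<equiv> Zero A y' z'"
  shows "Comp A v (homol_zero_iso f g) = Comp A (homol_zero_iso f' g') (homol_map A f g f' g' v)"
proof -
  note I = homol_zero_iso[OF o(1-3), folded f_def g_def]
    and I' = homol_zero_iso[OF o(4-6), folded f'_def g'_def]
  note C = cpxD[OF I(1)] and C' = cpxD[OF I'(1)]
  have 1: "Comp A f' (Zero A x x') = Comp A v f"
    using Comp_Zero[OF v] Comp_Zero[OF C'(1)] o by (simp add: f_def)
  have 2: "Comp A g' v = Comp A (Zero A z z') g"
    using Zero_Comp[OF v] Zero_Comp[OF C(2)] o by (simp add: g'_def)
  note H = homol_map[OF I(1) I'(1) Zero_Hom[OF o(1,4)] v Zero_Hom[OF o(3,6)] 1 2]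
  show ?thesis
  proof (rule epi_cancel[OF C(10,9) Comp_Hom[OF I(2) v] Comp_Hom[OF H(3) I'(2)]])
    show "Comp A (Comp A v (homol_zero_iso f g)) (homol_proj A f g) =
        Comp A (Comp A (homol_zero_iso f' g') (homol_map A f g f' g' v)) (homol_proj A f g)"
      using Comp_assoc[OF C(9) I(2) v] I(4) Comp_assoc[OF C(9) H(3) I'(2)] H(4)
        Comp_assoc[OF H(1) C'(9) I'(2)] I'(4) H(2) by simp
  qed
qed

section \<open>Chain complexes, chain maps and their homology\<close>

definition chain_complex :: "(nat \<Rightarrow> 'a) \<Rightarrow> (nat \<Rightarrow> 'b) \<Rightarrow> bool" where
  "chain_complex K d \<longleftrightarrow> (\<forall>n. d n \<in> Hom A (K (Suc n)) (K n) \<and>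
     Comp A (d n) (d (Suc n)) = Zero A (K (Suc (Suc n))) (K n))"

definition chain_map ::
  "(nat \<Rightarrow> 'a) \<Rightarrow> (nat \<Rightarrow> 'b) \<Rightarrow> (nat \<Rightarrow> 'a) \<Rightarrow> (nat \<Rightarrow> 'b) \<Rightarrow> (nat \<Rightarrow> 'b) \<Rightarrow> bool" where
  "chain_map K d K' d' \<phi> \<longleftrightarrow> chain_complex K d \<and> chain_complex K' d' \<and>
     (\<forall>n. \<phi> n \<in> Hom A (K n) (K' n) \<and> Comp A (d' n) (\<phi> (Suc n)) = Comp A (\<phi> n) (d n))"

text \<open>Truncated subtraction gives \<open>out_obj K 0 = K 0\<close>, which is the target of \<open>out_diff\<close> in degree \<open>0\<close>.\<close>

definition out_obj :: "(nat \<Rightarrow> 'a) \<Rightarrow> nat \<Rightarrow> 'a" where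
  "out_obj K n = K (n - 1)"

lemma chain_complex_cpx:
  assumes "chain_complex K d"
  shows "cpx (d n) (out_diff A d n) (K (Suc n)) (K n) (out_obj K n)"
proof (cases n)
  case 0
  have d: "d 0 \<in> Hom A (K (Suc 0)) (K 0)"
    using assms by (simp add: chain_complex_def)
  then show ?thesis
    using 0 Zero_Comp[OF d] Hom_Obj[OF d] by (simp add: cpx_def out_diff_def out_obj_def HomD[OF d])
next
  case (Suc m)
  then show ?thesis
    using assms by (simp add: cpx_def out_diff_def out_obj_def chain_complex_def)
qed

lemma chain_mapD:
  assumes "chain_map K d K' d' \<phi>"
  shows "cpx (d n) (out_diff A d n) (K (Suc n)) (K n) (out_obj K n)"
    "cpx (d' n) (out_diff A d' n) (K' (Suc n)) (K' n) (out_obj K' n)"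
    "\<phi> (Suc n) \<in> Hom A (K (Suc n)) (K' (Suc n))" "\<phi> n \<in> Hom A (K n) (K' n)"
    "\<phi> (n - 1) \<in> Hom A (out_obj K n) (out_obj K' n)"
    "Comp A (d' n) (\<phi> (Suc n)) = Comp A (\<phi> n) (d n)"
    "Comp A (out_diff A d' n) (\<phi> n) = Comp A (\<phi> (n - 1)) (out_diff A d n)"
proof -
  have c: "chain_complex K d" "chain_complex K' d'"
    and h: "\<And>n. \<phi> n \<in> Hom A (K n) (K' n)" "\<And>n. Comp A (d' n) (\<phi> (Suc n)) = Comp A (\<phi> n) (d n)"
    using assms by (simp_all add: chain_map_def)
  show "cpx (d n) (out_diff A d n) (K (Suc n)) (K n) (out_obj K n)"
    "cpx (d' n) (out_diff A d' n) (K' (Suc n)) (K' n) (out_obj K' n)"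
    using c chain_complex_cpx by simp_all
  show "\<phi> (Suc n) \<in> Hom A (K (Suc n)) (K' (Suc n))" "\<phi> n \<in> Hom A (K n) (K' n)"
    "\<phi> (n - 1) \<in> Hom A (out_obj K n) (out_obj K' n)"
    "Comp A (d' n) (\<phi> (Suc n)) = Comp A (\<phi> n) (d n)"
    using h by (simp_all add: out_obj_def)
  show "Comp A (out_diff A d' n) (\<phi> n) = Comp A (\<phi> (n - 1)) (out_diff A d n)"
  proof (cases n)
    case 0
    have "Cod A (d 0) = K 0" "Cod A (d' 0) = K' 0"
      using c unfolding chain_complex_def by (auto dest: HomD)
    then show ?thesis
      using 0 Zero_Comp[OF h(1)[of 0]] Comp_Zero[OF h(1)[of 0]] Hom_Obj[OF h(1)[of 0]]
      by (simp add: out_diff_def)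
  next
    case (Suc m)
    then show ?thesis
      using h(2) by (simp add: out_diff_def)
  qed
qed

lemma chain_homology_Obj: "chain_complex K d \<Longrightarrow> chain_homology A d n \<in> Obj A"
  unfolding chain_homology_def using cpxD(12)[OF chain_complex_cpx] .

lemma chain_homology_map_Hom:
  assumes "chain_map K d K' d' \<phi>"
  shows "chain_homology_map A d d' \<phi> n \<in> Hom A (chain_homology A d n) (chain_homology A d' n)"
  unfolding chain_homology_map_def chain_homology_def
  using homol_map(3)[OF chain_mapD[OF assms, of n]] .

lemma chain_homology_map_Comp:
  assumes \<phi>: "chain_map K d K' d' \<phi>" and \<psi>: "chain_map K' d' K'' d'' \<psi>"
    and \<chi>: "\<And>n. \<chi> n = Comp A (\<psi> n) (\<phi> n)"
  shows "chain_homology_map A d d'' \<chi> n =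
    Comp A (chain_homology_map A d' d'' \<psi> n) (chain_homology_map A d d' \<phi> n)"
proof -
  note p = chain_mapD[OF \<phi>, of n] and q = chain_mapD[OF \<psi>, of n]
  show ?thesis
    unfolding chain_homology_map_def \<chi>
    by (rule homol_map_Comp[OF p(1,2) q(2) p(3-7) q(3-7)])
qed

text \<open>The degreewise inverses commute with the differentials, so they form a chain map;
  functoriality of homology turns it into an inverse.\<close>

lemma chain_homology_map_iso:
  assumes \<phi>: "chain_map K d K' d' \<phi>" and iso: "\<And>n. is_iso A (\<phi> n)"
  shows "is_iso A (chain_homology_map A d d' \<phi> n)"
proof -
  have h: "\<And>n. \<phi> n \<in> Hom A (K n) (K' n)" "\<And>n. Comp A (d' n) (\<phi> (Suc n)) = Comp A (\<phi> n) (d n)"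
    and c: "chain_complex K d" "chain_complex K' d'"
    using \<phi> by (simp_all add: chain_map_def)
  have d: "\<And>n. d n \<in> Hom A (K (Suc n)) (K n)" "\<And>n. d' n \<in> Hom A (K' (Suc n)) (K' n)"
    using c by (simp_all add: chain_complex_def)
  have "\<forall>n. \<exists>g. g \<in> Hom A (K' n) (K n) \<and> Comp A g (\<phi> n) = Ident A (K n) \<and> Comp A (\<phi> n) g = Ident A (K' n)"
    using isoE[OF iso h(1)] by metis
  then obtain \<psi> where \<psi>: "\<And>n. \<psi> n \<in> Hom A (K' n) (K n)"
    "\<And>n. Comp A (\<psi> n) (\<phi> n) = Ident A (K n)" "\<And>n. Comp A (\<phi> n) (\<psi> n) = Ident A (K' n)"
    by metis
  have "Comp A (d n) (\<psi> (Suc n)) = Comp A (\<psi> n) (d' n)" for n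
  proof (rule mono_cancel[OF iso_mono[OF iso] h(1)[of n] Comp_Hom[OF \<psi>(1) d(1)] Comp_Hom[OF d(2) \<psi>(1)]])
    have "Comp A (\<phi> n) (Comp A (d n) (\<psi> (Suc n))) = Comp A (Comp A (d' n) (\<phi> (Suc n))) (\<psi> (Suc n))"
      using Comp_assoc[OF \<psi>(1) d(1) h(1)] h(2) by simp
    also have "\<dots> = d' n"
      using Comp_assoc[OF \<psi>(1) h(1) d(2)] \<psi>(3) Comp_Ident[OF d(2)] by simp
    also have "\<dots> = Comp A (\<phi> n) (Comp A (\<psi> n) (d' n))"
      using Comp_assoc[OF d(2) \<psi>(1) h(1)] \<psi>(3) Comp_Ident[OF d(2)] by simp
    finally show "Comp A (\<phi> n) (Comp A (d n) (\<psi> (Suc n))) = Comp A (\<phi> n) (Comp A (\<psi> n) (d' n))" .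
  qed
  then have \<psi>c: "chain_map K' d' K d \<psi>"
    using c \<psi>(1) by (simp add: chain_map_def)
  note p = chain_mapD[OF \<phi>, of n] and q = chain_mapD[OF \<psi>c, of n]
  have "homol_map A (d n) (out_diff A d n) (d n) (out_diff A d n) (Comp A (\<psi> n) (\<phi> n)) =
      Ident A (chain_homology A d n)"
    unfolding \<psi>(2) chain_homology_def by (rule homol_map_Ident[OF p(1)])
  moreover have "homol_map A (d' n) (out_diff A d' n) (d' n) (out_diff A d' n) (Comp A (\<phi> n) (\<psi> n)) =
      Ident A (chain_homology A d' n)"
    unfolding \<psi>(3) chain_homology_def by (rule homol_map_Ident[OF p(2)])
  ultimately show ?thesis
    using isoI[OF chain_homology_map_Hom[OF \<phi>] chain_homology_map_Hom[OF \<psi>c]]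
      homol_map_Comp[OF p(1,2) q(2) p(3-7) q(3-7)] homol_map_Comp[OF q(1,2) p(2) q(3-7) p(3-7)]
    by (simp add: chain_homology_map_def)
qed

lemma chain_homology_zero:
  assumes "chain_complex K d" "zero_object A (K n)"
  shows "zero_object A (chain_homology A d n)"
  unfolding chain_homology_def using zero_homol[OF chain_complex_cpx] assms by blast

end

locale abel = fixes A :: "('o, 'a, 'z) abcat_scheme"
  assumes abel: "is_abelian A"

sublocale abel \<subseteq> preabelian A
proof
  show "is_category A" "is_preadditive A" "\<exists>z. zero_object A z"
    using abel unfolding is_abelian_def is_preadditive_def by blast+
  show "\<exists>k. is_kernel A f k" "\<exists>c. is_cokernel A f c" if "f \<in> Arr A" for f
    using abel that unfolding is_abelian_def by blast+
qed

section \<open>Coproducts\<close>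

context cat
begin

lemma coproductD:
  assumes "is_coproduct C I D c \<iota>"
  shows "c \<in> Obj C" "i \<in> I \<Longrightarrow> \<iota> i \<in> Hom C (D i) c"
  using assms by (auto simp: is_coproduct_def)

lemma coproduct_univ:
  assumes "is_coproduct C I D c \<iota>" "x \<in> Obj C" "\<And>i. i \<in> I \<Longrightarrow> h i \<in> Hom C (D i) x"
  obtains u where "u \<in> Hom C c x" "\<And>i. i \<in> I \<Longrightarrow> Comp C u (\<iota> i) = h i"
proof -
  have "\<exists>!u. u \<in> Hom C c x \<and> (\<forall>i\<in>I. Comp C u (\<iota> i) = h i)"
    using assms unfolding is_coproduct_def by simp
  then show ?thesis
    using that by blast
qed

lemma coproduct_ext:
  assumes c: "is_coproduct C I D c \<iota>" and u: "u \<in> Hom C c x" and v: "v \<in> Hom C c x"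
    and uv: "\<And>i. i \<in> I \<Longrightarrow> Comp C u (\<iota> i) = Comp C v (\<iota> i)"
  shows "u = v"
proof -
  have "x \<in> Obj C" "\<forall>i\<in>I. Comp C u (\<iota> i) \<in> Hom C (D i) x"
    using Hom_Obj u coproductD[OF c] Comp_Hom by blast+
  then have "\<exists>!w. w \<in> Hom C c x \<and> (\<forall>i\<in>I. Comp C w (\<iota> i) = Comp C u (\<iota> i))"
    using c unfolding is_coproduct_def by simp
  then show ?thesis
    using u v uv by metis
qed

lemma coproductI:
  assumes "c \<in> Obj C" "\<And>i. i \<in> I \<Longrightarrow> \<iota> i \<in> Hom C (D i) c"
    and "\<And>x h. x \<in> Obj C \<Longrightarrow> (\<And>i. i \<in> I \<Longrightarrow> h i \<in> Hom C (D i) x) \<Longrightarrow>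
      \<exists>u\<in>Hom C c x. \<forall>i\<in>I. Comp C u (\<iota> i) = h i"
    and "\<And>x u v. u \<in> Hom C c x \<Longrightarrow> v \<in> Hom C c x \<Longrightarrow>
      (\<And>i. i \<in> I \<Longrightarrow> Comp C u (\<iota> i) = Comp C v (\<iota> i)) \<Longrightarrow> u = v"
  shows "is_coproduct C I D c \<iota>"
  unfolding is_coproduct_def
proof (intro conjI ballI allI impI ex_ex1I)
  fix x h assume "x \<in> Obj C" "\<forall>i\<in>I. h i \<in> Hom C (D i) x"
  then show "\<exists>u. u \<in> Hom C c x \<and> (\<forall>i\<in>I. Comp C u (\<iota> i) = h i)"
    using assms(3)[of x h] by blast
next
  fix x h u v
  assume "u \<in> Hom C c x \<and> (\<forall>i\<in>I. Comp C u (\<iota> i) = h i)" "v \<in> Hom C c x \<and> (\<forall>i\<in>I. Comp C v (\<iota> i) = h i)"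
  then show "u = v"
    using assms(4)[of u x v] by simp
qed (use assms in auto)

lemma coproduct_comparison_iso:
  assumes c: "is_coproduct C I D c \<iota>" and c': "is_coproduct C I D c' \<iota>'"
    and u: "u \<in> Hom C c c'" and u\<iota>: "\<And>i. i \<in> I \<Longrightarrow> Comp C u (\<iota> i) = \<iota>' i"
  shows "is_iso C u"
proof -
  obtain v where v: "v \<in> Hom C c' c" "\<And>i. i \<in> I \<Longrightarrow> Comp C v (\<iota>' i) = \<iota> i"
    using coproduct_univ[OF c' coproductD(1)[OF c] coproductD(2)[OF c]] by blast
  show ?thesis
  proof (rule isoI[OF u v(1)])
    show "Comp C v u = Ident C c"
      by (rule coproduct_ext[OF c Comp_Hom[OF u v(1)] Ident_Hom[OF coproductD(1)[OF c]]])
        (use u\<iota> v(2) Comp_assoc[OF coproductD(2)[OF c] u v(1)] Comp_Ident(2)[OF coproductD(2)[OF c]] in simp)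
    show "Comp C u v = Ident C c'"
      by (rule coproduct_ext[OF c' Comp_Hom[OF v(1) u] Ident_Hom[OF coproductD(1)[OF c']]])
        (use u\<iota> v(2) Comp_assoc[OF coproductD(2)[OF c'] v(1) u] Comp_Ident(2)[OF coproductD(2)[OF c']] in simp)
  qed
qed

lemma coproduct_iso:
  assumes c: "is_coproduct C I D c \<iota>" and u: "u \<in> Hom C c c'" "is_iso C u"
    and \<iota>': "\<And>i. i \<in> I \<Longrightarrow> Comp C u (\<iota> i) = \<iota>' i"
  shows "is_coproduct C I D c' \<iota>'"
proof -
  obtain v where v: "v \<in> Hom C c' c" "Comp C v u = Ident C c" "Comp C u v = Ident C c'"
    using isoE[OF u(2,1)] by blast
  have \<iota>: "\<And>i. i \<in> I \<Longrightarrow> \<iota> i \<in> Hom C (D i) c" "c \<in> Obj C"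
    using coproductD[OF c] by simp_all
  show ?thesis
  proof (rule coproductI)
    show "c' \<in> Obj C" using Hom_Obj u(1) by blast
    show "\<iota>' i \<in> Hom C (D i) c'" if "i \<in> I" for i
      using \<iota>'[OF that] Comp_Hom[OF \<iota>(1)[OF that] u(1)] by simp
    show "\<exists>w\<in>Hom C c' x. \<forall>i\<in>I. Comp C w (\<iota>' i) = h i"
      if x: "x \<in> Obj C" and h: "\<And>i. i \<in> I \<Longrightarrow> h i \<in> Hom C (D i) x" for x h
    proof -
      obtain w where w: "w \<in> Hom C c x" "\<And>i. i \<in> I \<Longrightarrow> Comp C w (\<iota> i) = h i"
        using coproduct_univ[OF c x h] by blast
      have "Comp C (Comp C w v) (\<iota>' i) = h i" if i: "i \<in> I" for i
        using \<iota>'[OF i, symmetric] Comp_assoc[OF \<iota>(1)[OF i] u(1) Comp_Hom[OF v(1) w(1)]]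
          Comp_assoc[OF u(1) v(1) w(1)] v(2) Comp_Ident(1)[OF w(1)] w(2)[OF i] by simp
      then show ?thesis
        using Comp_Hom[OF v(1) w(1)] by blast
    qed
    show "a = b" if a: "a \<in> Hom C c' x" and b: "b \<in> Hom C c' x"
      and ab: "\<And>i. i \<in> I \<Longrightarrow> Comp C a (\<iota>' i) = Comp C b (\<iota>' i)" for x a b
    proof -
      have "Comp C a u = Comp C b u"
        by (rule coproduct_ext[OF c Comp_Hom[OF u(1) a] Comp_Hom[OF u(1) b]])
          (use Comp_assoc[OF \<iota>(1) u(1) a] Comp_assoc[OF \<iota>(1) u(1) b] \<iota>' ab in simp)
      then show ?thesis
        using epi_cancel[OF iso_epi[OF u(2)] u(1) a b] by blast
    qed
  qed
qed

text \<open>Objects and injections have to match on the index set only. With the identity as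
  \<open>h\<close> the lemma therefore also replaces a family by one that agrees with it
  there.\<close>

lemma coproduct_reindex:
  assumes c: "is_coproduct C I D c \<iota>" and h: "bij_betw h I' I"
    and D: "\<And>j. j \<in> I' \<Longrightarrow> D' j = D (h j)" and \<iota>: "\<And>j. j \<in> I' \<Longrightarrow> \<iota>' j = \<iota> (h j)"
  shows "is_coproduct C I' D' c \<iota>'"
proof -
  have hI: "h ` I' = I" and inj: "inj_on h I'"
    using h by (auto simp: bij_betw_def)
  show ?thesis
  proof (rule coproductI)
    show "c \<in> Obj C" using coproductD[OF c] by simp
    show "\<iota>' j \<in> Hom C (D' j) c" if "j \<in> I'" for j
      using that D \<iota> coproductD(2)[OF c] hI by auto
    show "\<exists>w\<in>Hom C c x. \<forall>j\<in>I'. Comp C w (\<iota>' j) = k j"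
      if x: "x \<in> Obj C" and k: "\<And>j. j \<in> I' \<Longrightarrow> k j \<in> Hom C (D' j) x" for x k
    proof -
      have "k (inv_into I' h i) \<in> Hom C (D i) x" if "i \<in> I" for i
        using k[of "inv_into I' h i"] D[of "inv_into I' h i"] that hI
        by (simp add: inv_into_into f_inv_into_f)
      then obtain w where w: "w \<in> Hom C c x" "\<And>i. i \<in> I \<Longrightarrow> Comp C w (\<iota> i) = k (inv_into I' h i)"
        using coproduct_univ[OF c x, of "\<lambda>i. k (inv_into I' h i)"] by blast
      have "Comp C w (\<iota>' j) = k j" if "j \<in> I'" for j
        using w(2)[of "h j"] that hI \<iota> inv_into_f_f[OF inj] by auto
      then show ?thesis
        using w(1) by blast
    qed
    show "a = b" if "a \<in> Hom C c x" "b \<in> Hom C c x" "\<And>j. j \<in> I' \<Longrightarrow> Comp C a (\<iota>' j) = Comp C b (\<iota>' j)"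
      for x a b
      by (rule coproduct_ext[OF c that(1,2)]) (use that(3) \<iota> hI in force)
  qed
qed

text \<open>A coproduct of coproducts over the fibres of \<open>p\<close> is a coproduct over the
  whole index set. This regroups the summands of a chain object over X by their images in Y.\<close>

lemma coproduct_flatten:
  assumes c: "is_coproduct C J E c \<kappa>"
    and f: "\<And>j. j \<in> J \<Longrightarrow> is_coproduct C {i \<in> I. p i = j} D (E j) (\<iota> j)"
    and p: "p \<in> I \<rightarrow> J"
  shows "is_coproduct C I D c (\<lambda>i. Comp C (\<kappa> (p i)) (\<iota> (p i) i))"
proof -
  have \<iota>: "\<And>i. i \<in> I \<Longrightarrow> \<iota> (p i) i \<in> Hom C (D i) (E (p i))"
    using coproductD(2)[OF f] p by blast
  have \<kappa>: "\<And>i. i \<in> I \<Longrightarrow> \<kappa> (p i) \<in> Hom C (E (p i)) c"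
    using coproductD(2)[OF c] p by blast
  show ?thesis
  proof (rule coproductI)
    show "c \<in> Obj C" using coproductD[OF c] by simp
    show "Comp C (\<kappa> (p i)) (\<iota> (p i) i) \<in> Hom C (D i) c" if "i \<in> I" for i
      using Comp_Hom \<iota> \<kappa> that by blast
    show "\<exists>w\<in>Hom C c x. \<forall>i\<in>I. Comp C w (Comp C (\<kappa> (p i)) (\<iota> (p i) i)) = h i"
      if x: "x \<in> Obj C" and h: "\<And>i. i \<in> I \<Longrightarrow> h i \<in> Hom C (D i) x" for x h
    proof -
      have "\<exists>v. v \<in> Hom C (E j) x \<and> (\<forall>i\<in>I. p i = j \<longrightarrow> Comp C v (\<iota> j i) = h i)" if j: "j \<in> J" for j
      proof -
        obtain v where "v \<in> Hom C (E j) x" "\<And>i. i \<in> {i \<in> I. p i = j} \<Longrightarrow> Comp C v (\<iota> j i) = h i"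
          by (rule coproduct_univ[OF f[OF j] x, of h]) (use h in auto)
        then show ?thesis by blast
      qed
      then obtain v where v: "\<And>j. j \<in> J \<Longrightarrow> v j \<in> Hom C (E j) x"
        "\<And>j i. j \<in> J \<Longrightarrow> i \<in> I \<Longrightarrow> p i = j \<Longrightarrow> Comp C (v j) (\<iota> j i) = h i"
        by metis
      obtain w where w: "w \<in> Hom C c x" "\<And>j. j \<in> J \<Longrightarrow> Comp C w (\<kappa> j) = v j"
        using coproduct_univ[OF c x, of v] v(1) by blast
      have "Comp C w (Comp C (\<kappa> (p i)) (\<iota> (p i) i)) = h i" if i: "i \<in> I" for i
        using Comp_assoc[OF \<iota>[OF i] \<kappa>[OF i] w(1)] w(2) v(2)[OF _ i refl] p i by (simp add: Pi_iff)
      then show ?thesis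
        using w(1) by blast
    qed
    show "a = b" if a: "a \<in> Hom C c x" and b: "b \<in> Hom C c x"
      and ab: "\<And>i. i \<in> I \<Longrightarrow> Comp C a (Comp C (\<kappa> (p i)) (\<iota> (p i) i)) =
        Comp C b (Comp C (\<kappa> (p i)) (\<iota> (p i) i))" for x a b
    proof (rule coproduct_ext[OF c a b])
      fix j assume j: "j \<in> J"
      note \<kappa>j = coproductD(2)[OF c j]
      show "Comp C a (\<kappa> j) = Comp C b (\<kappa> j)"
      proof (rule coproduct_ext[OF f[OF j] Comp_Hom[OF \<kappa>j a] Comp_Hom[OF \<kappa>j b]])
        fix i assume i: "i \<in> {i \<in> I. p i = j}"
        note \<iota>i = coproductD(2)[OF f[OF j] i]
        show "Comp C (Comp C a (\<kappa> j)) (\<iota> j i) = Comp C (Comp C b (\<kappa> j)) (\<iota> j i)"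
          using ab[of i] i Comp_assoc[OF \<iota>i \<kappa>j a] Comp_assoc[OF \<iota>i \<kappa>j b] by auto
      qed
    qed
  qed
qed

lemma coprod:
  assumes "\<exists>c \<iota>. is_coproduct C I D c \<iota>"
  shows "is_coproduct C I D (coprod C I D) (coprod_inj C I D)"
proof -
  have "case coprod_sel C I D of (c, \<iota>) \<Rightarrow> is_coproduct C I D c \<iota>"
    unfolding coprod_sel_def by (rule someI_ex) (use assms in auto)
  then show ?thesis
    by (simp add: coprod_def coprod_inj_def split_beta)
qed

lemma cotuple:
  assumes "\<exists>c \<iota>. is_coproduct C I D c \<iota>" "x \<in> Obj C" "\<And>i. i \<in> I \<Longrightarrow> h i \<in> Hom C (D i) x"
  shows "cotuple C I D x h \<in> Hom C (coprod C I D) x"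
    "i \<in> I \<Longrightarrow> Comp C (cotuple C I D x h) (coprod_inj C I D i) = h i"
proof -
  have "\<exists>!u. u \<in> Hom C (coprod C I D) x \<and> (\<forall>i\<in>I. Comp C u (coprod_inj C I D i) = h i)"
    using coprod[OF assms(1)] assms(2,3) unfolding is_coproduct_def by simp
  from theI'[OF this] show "cotuple C I D x h \<in> Hom C (coprod C I D) x"
    "i \<in> I \<Longrightarrow> Comp C (cotuple C I D x h) (coprod_inj C I D i) = h i"
    by (simp_all add: cotuple_def)
qed

end

locale cocomp = abel A for A :: "('o, 'a) abcat" +
  fixes U :: "'u itself"
  assumes cocomplete: "cocomplete U A"
    and exact: "exact_coproducts U A"
begin

text \<open>A coproduct is a colimit over a discrete category. The elements of \<open>I\<close>
  serve both as objects and as their own identity arrows, which gives the diagram the type that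
  \<open>cocomplete\<close> speaks about.\<close>

lemma small_coproduct_ex:
  fixes I :: "'u set"
  assumes D: "\<And>i. i \<in> I \<Longrightarrow> D i \<in> Obj A"
  shows "\<exists>c \<iota>. is_coproduct A I D c \<iota>"
proof -
  define J :: "('u, 'u) category" where
    "J = \<lparr>Obj = I, Arr = I, Dom = (\<lambda>x. x), Cod = (\<lambda>x. x), Ident = (\<lambda>x. x), Comp = (\<lambda>g f. f)\<rparr>"
  define F where "F = \<lparr>onob = (\<lambda>i\<in>I. D i), onar = (\<lambda>i\<in>I. Ident A (D i))\<rparr>"
  have J: "is_category J"
    by (auto simp: is_category_def J_def Hom_def)
  have F: "is_functor J A F"
    using D Comp_Ident(1)[OF Ident_Hom[OF D]] HomD[OF Ident_Hom] by (auto simp: is_functor_def J_def F_def)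
  obtain c \<iota> where c: "is_colimit J A F c \<iota>"
    using cocomplete J F unfolding cocomplete_def by blast
  have cocone: "is_cocone J A F x h \<longleftrightarrow> x \<in> Obj A \<and> (\<forall>i\<in>I. h i \<in> Hom A (D i) x)" for x h
    using Comp_Ident(1) by (auto simp: is_cocone_def J_def F_def)
  have "is_coproduct A I D c \<iota>"
    unfolding is_coproduct_def
  proof (intro conjI ballI allI impI)
    show "c \<in> Obj A" "\<And>i. i \<in> I \<Longrightarrow> \<iota> i \<in> Hom A (D i) c"
      using c cocone by (auto simp: is_colimit_def)
    fix x h assume "x \<in> Obj A" "\<forall>i\<in>I. h i \<in> Hom A (D i) x"
    then have "is_cocone J A F x h"
      using cocone by blast
    then have "\<exists>!u. u \<in> Hom A c x \<and> (\<forall>i\<in>Obj J. Comp A u (\<iota> i) = h i)"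
      using c unfolding is_colimit_def by blast
    then show "\<exists>!u. u \<in> Hom A c x \<and> (\<forall>i\<in>I. Comp A u (\<iota> i) = h i)"
      by (simp add: J_def)
  qed
  then show ?thesis by blast
qed

text \<open>Only subsets of \<open>'u\<close> count as small. An injection \<open>h\<close> into
  \<open>'u\<close> extends the existence result to index sets of another type, such as sets of
  pairs of a dimension and a simplex.\<close>

lemma coproduct_ex:
  fixes I :: "'i set" and h :: "'i \<Rightarrow> 'u"
  assumes "inj_on h I" and D: "\<And>i. i \<in> I \<Longrightarrow> D i \<in> Obj A"
  shows "\<exists>c \<iota>. is_coproduct A I D c \<iota>"
proof -
  have "\<And>j. j \<in> h ` I \<Longrightarrow> D (inv_into I h j) \<in> Obj A"
    using D by (simp add: inv_into_into)
  then obtain c \<iota> where c: "is_coproduct A (h ` I) (\<lambda>j. D (inv_into I h j)) c \<iota>"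
    using small_coproduct_ex[of "h ` I" "\<lambda>j. D (inv_into I h j)"] by blast
  have "is_coproduct A I D c (\<lambda>i. \<iota> (h i))"
    by (rule coproduct_reindex[OF c, of h]) (use assms in \<open>auto simp: bij_betw_def\<close>)
  then show ?thesis by blast
qed

text \<open>\<open>exact_coproducts\<close> speaks about the selected coproducts and the map
  \<open>coprod_map\<close> between them. The comparison isomorphisms \<open>u1\<close>,
  \<open>u2\<close>, \<open>u3\<close> carry its conclusion to arbitrary coproducts of the same
  families.\<close>

lemma short_exact_small_coproduct:
  fixes I :: "'u set"
  assumes se: "\<And>i. i \<in> I \<Longrightarrow> short_exact A (f i) (g i)"
    and f: "\<And>i. i \<in> I \<Longrightarrow> f i \<in> Hom A (D1 i) (D2 i)" and g: "\<And>i. i \<in> I \<Longrightarrow> g i \<in> Hom A (D2 i) (D3 i)"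
    and c1: "is_coproduct A I D1 c1 \<iota>1" and c2: "is_coproduct A I D2 c2 \<iota>2" and c3: "is_coproduct A I D3 c3 \<iota>3"
    and F: "F \<in> Hom A c1 c2" "\<And>i. i \<in> I \<Longrightarrow> Comp A F (\<iota>1 i) = Comp A (\<iota>2 i) (f i)"
    and G: "G \<in> Hom A c2 c3" "\<And>i. i \<in> I \<Longrightarrow> Comp A G (\<iota>2 i) = Comp A (\<iota>3 i) (g i)"
  shows "short_exact A F G"
proof -
  obtain z where z: "zero_object A z"
    using zero_object_ex by blast
  \<comment> \<open>Outside \<open>I\<close> the families are redefined so that \<open>Cod (f' i) = Dom (g' i)\<close> holds for every \<open>i\<close>:
    the selected coproduct \<open>coprod\<close> depends on the whole family, not only on its restriction to \<open>I\<close>.\<close>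
  define f' g' where "f' i = (if i \<in> I then f i else Ident A z)" and "g' i = (if i \<in> I then g i else Ident A z)"
    for i
  define E1 E2 E3 where "E1 = (\<lambda>i. Dom A (f' i))" and "E2 = (\<lambda>i. Cod A (f' i))" and "E3 = (\<lambda>i. Cod A (g' i))"
  have E2': "(\<lambda>i. Dom A (g' i)) = E2"
    using HomD[OF f] HomD[OF g] HomD[OF Ident_Hom[OF zero_object_Obj[OF z]]]
    by (auto simp: E2_def f'_def g'_def fun_eq_iff)
  have E: "\<And>i. i \<in> I \<Longrightarrow> E1 i = D1 i" "\<And>i. i \<in> I \<Longrightarrow> E2 i = D2 i" "\<And>i. i \<in> I \<Longrightarrow> E3 i = D3 i"
    using HomD[OF f] HomD[OF g] by (auto simp: E1_def E2_def E3_def f'_def g'_def)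
  have O: "\<And>i. i \<in> I \<Longrightarrow> E1 i \<in> Obj A" "\<And>i. i \<in> I \<Longrightarrow> E2 i \<in> Obj A" "\<And>i. i \<in> I \<Longrightarrow> E3 i \<in> Obj A"
    using E Hom_Obj[OF f] Hom_Obj[OF g] by auto
  have ex: "\<exists>c \<iota>. is_coproduct A I E1 c \<iota>" "\<exists>c \<iota>. is_coproduct A I E2 c \<iota>" "\<exists>c \<iota>. is_coproduct A I E3 c \<iota>"
    using small_coproduct_ex[of I E1] small_coproduct_ex[of I E2] small_coproduct_ex[of I E3] O by blast+
  note c1' = coprod[OF ex(1)] and c2' = coprod[OF ex(2)] and c3' = coprod[OF ex(3)]
  let ?f = "coprod_map A I f'" and ?g = "coprod_map A I g'"
  have fi: "\<And>i. i \<in> I \<Longrightarrow> f' i \<in> Hom A (E1 i) (E2 i)" "\<And>i. i \<in> I \<Longrightarrow> g' i \<in> Hom A (E2 i) (E3 i)"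
    using f g E by (auto simp: f'_def g'_def)
  have mf: "?f \<in> Hom A (coprod A I E1) (coprod A I E2)"
    "\<And>i. i \<in> I \<Longrightarrow> Comp A ?f (coprod_inj A I E1 i) = Comp A (coprod_inj A I E2 i) (f' i)"
    unfolding coprod_map_def E1_def[symmetric] E2_def[symmetric]
    using cotuple[OF ex(1) coproductD(1)[OF c2'], of "\<lambda>i. Comp A (coprod_inj A I E2 i) (f' i)"]
      Comp_Hom[OF fi(1) coproductD(2)[OF c2']] by blast+
  have mg: "?g \<in> Hom A (coprod A I E2) (coprod A I E3)"
    "\<And>i. i \<in> I \<Longrightarrow> Comp A ?g (coprod_inj A I E2 i) = Comp A (coprod_inj A I E3 i) (g' i)"
    unfolding coprod_map_def E2' E3_def[symmetric]
    using cotuple[OF ex(2) coproductD(1)[OF c3'], of "\<lambda>i. Comp A (coprod_inj A I E3 i) (g' i)"]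
      Comp_Hom[OF fi(2) coproductD(2)[OF c3']] by blast+
  have se': "short_exact A ?f ?g"
    using exact se unfolding exact_coproducts_def by (simp add: f'_def g'_def)
  have iso: "\<exists>u. u \<in> Hom A (coprod A I E) c \<and> is_iso A u \<and> (\<forall>i\<in>I. Comp A u (coprod_inj A I E i) = \<iota> i)"
    if c: "is_coproduct A I D c \<iota>" and c': "is_coproduct A I E (coprod A I E) (coprod_inj A I E)"
      and DE: "\<And>i. i \<in> I \<Longrightarrow> E i = D i" for c \<iota> D E
  proof -
    have c'': "is_coproduct A I E c \<iota>"
      by (rule coproduct_reindex[OF c, of "\<lambda>x. x"]) (use DE in \<open>auto simp: bij_betw_def\<close>)
    obtain u where "u \<in> Hom A (coprod A I E) c" "\<And>i. i \<in> I \<Longrightarrow> Comp A u (coprod_inj A I E i) = \<iota> i"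
      using coproduct_univ[OF c' coproductD(1)[OF c''] coproductD(2)[OF c'']] by blast
    then show ?thesis
      using coproduct_comparison_iso[OF c' c''] by blast
  qed
  obtain u1 where u1: "u1 \<in> Hom A (coprod A I E1) c1" "is_iso A u1" "\<forall>i\<in>I. Comp A u1 (coprod_inj A I E1 i) = \<iota>1 i"
    using iso[OF c1 c1' E(1)] by blast
  obtain u2 where u2: "u2 \<in> Hom A (coprod A I E2) c2" "is_iso A u2" "\<forall>i\<in>I. Comp A u2 (coprod_inj A I E2 i) = \<iota>2 i"
    using iso[OF c2 c2' E(2)] by blast
  obtain u3 where u3: "u3 \<in> Hom A (coprod A I E3) c3" "is_iso A u3" "\<forall>i\<in>I. Comp A u3 (coprod_inj A I E3 i) = \<iota>3 i"
    using iso[OF c3 c3' E(3)] by blast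
  have sq1: "Comp A F u1 = Comp A u2 ?f"
  proof (rule coproduct_ext[OF c1' Comp_Hom[OF u1(1) F(1)] Comp_Hom[OF mf(1) u2(1)]])
    fix i assume i: "i \<in> I"
    show "Comp A (Comp A F u1) (coprod_inj A I E1 i) = Comp A (Comp A u2 ?f) (coprod_inj A I E1 i)"
      using i Comp_assoc[OF coproductD(2)[OF c1' i] u1(1) F(1)] u1(3) F(2)[OF i]
        Comp_assoc[OF coproductD(2)[OF c1' i] mf(1) u2(1)] mf(2)[OF i]
        Comp_assoc[OF fi(1)[OF i] coproductD(2)[OF c2' i] u2(1)] u2(3)
      by (simp add: f'_def)
  qed
  have sq2: "Comp A G u2 = Comp A u3 ?g"
  proof (rule coproduct_ext[OF c2' Comp_Hom[OF u2(1) G(1)] Comp_Hom[OF mg(1) u3(1)]])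
    fix i assume i: "i \<in> I"
    show "Comp A (Comp A G u2) (coprod_inj A I E2 i) = Comp A (Comp A u3 ?g) (coprod_inj A I E2 i)"
      using i Comp_assoc[OF coproductD(2)[OF c2' i] u2(1) G(1)] u2(3) G(2)[OF i]
        Comp_assoc[OF coproductD(2)[OF c2' i] mg(1) u3(1)] mg(2)[OF i]
        Comp_assoc[OF fi(2)[OF i] coproductD(2)[OF c3' i] u3(1)] u3(3)
      by (simp add: g'_def)
  qed
  have "is_cokernel A F G"
    by (rule cokernel_transport[OF _ mf(1) mg(1) F(1) G(1) u1(1,2) u2(1,2) u3(1,2) sq1 sq2])
      (use se' in \<open>simp add: short_exact_def\<close>)
  moreover have "is_kernel A G F"
  proof -
    \<comment> \<open>\<open>kernel_transport\<close> expects isomorphisms from the given coproducts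
      to the selected ones, so the comparisons are inverted; \<open>inv\<close> inverts the two
      commuting squares accordingly.\<close>
    obtain v1 where v1: "v1 \<in> Hom A c1 (coprod A I E1)" "Comp A v1 u1 = Ident A (coprod A I E1)"
      "Comp A u1 v1 = Ident A c1" using isoE[OF u1(2,1)] by blast
    obtain v2 where v2: "v2 \<in> Hom A c2 (coprod A I E2)" "Comp A v2 u2 = Ident A (coprod A I E2)"
      "Comp A u2 v2 = Ident A c2" using isoE[OF u2(2,1)] by blast
    obtain v3 where v3: "v3 \<in> Hom A c3 (coprod A I E3)" "Comp A v3 u3 = Ident A (coprod A I E3)"
      "Comp A u3 v3 = Ident A c3" using isoE[OF u3(2,1)] by blast
    have inv: "Comp A v' h = Comp A k v"
      if h: "h \<in> Hom A c c'" and k: "k \<in> Hom A d d'" and u: "u \<in> Hom A d c" and u': "u' \<in> Hom A d' c'"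
        and v: "v \<in> Hom A c d" "Comp A u v = Ident A c" and v': "v' \<in> Hom A c' d'" "Comp A v' u' = Ident A d'"
        and e: "Comp A h u = Comp A u' k" for h k c c' d d' u u' v v'
    proof -
      have "Comp A v' h = Comp A v' (Comp A (Comp A h u) v)"
        using Comp_assoc[OF v(1) u h] v(2) Comp_Ident[OF h] by simp
      also have "\<dots> = Comp A (Comp A (Comp A v' u') k) v"
        using e Comp_assoc[OF v(1) k u'] Comp_assoc[OF Comp_Hom[OF v(1) k] u' v'(1)] v'(2)
          Comp_Ident(2)[OF Comp_Hom[OF v(1) k]] Comp_Ident(2)[OF k] by simp
      finally show ?thesis
        using v'(2) Comp_Ident(2)[OF k] by simp
    qed
    show ?thesis
      by (rule kernel_transport[OF _ mf(1) mg(1) F(1) G(1) v1(1) isoI[OF v1(1) u1(1) v1(3,2)]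
            v2(1) isoI[OF v2(1) u2(1) v2(3,2)] v3(1) isoI[OF v3(1) u3(1) v3(3,2)]
            inv[OF F(1) mf(1) u1(1) u2(1) v1(1,3) v2(1,2) sq1]
            inv[OF G(1) mg(1) u2(1) u3(1) v2(1,3) v3(1,2) sq2]])
        (use se' in \<open>simp add: short_exact_def\<close>)
  qed
  ultimately show ?thesis
    by (simp add: short_exact_def)
qed

lemma short_exact_coproduct:
  fixes I :: "'i set" and h :: "'i \<Rightarrow> 'u"
  assumes h: "inj_on h I"
    and se: "\<And>i. i \<in> I \<Longrightarrow> short_exact A (f i) (g i)"
    and f: "\<And>i. i \<in> I \<Longrightarrow> f i \<in> Hom A (D1 i) (D2 i)" and g: "\<And>i. i \<in> I \<Longrightarrow> g i \<in> Hom A (D2 i) (D3 i)"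
    and c1: "is_coproduct A I D1 c1 \<iota>1" and c2: "is_coproduct A I D2 c2 \<iota>2" and c3: "is_coproduct A I D3 c3 \<iota>3"
    and F: "F \<in> Hom A c1 c2" "\<And>i. i \<in> I \<Longrightarrow> Comp A F (\<iota>1 i) = Comp A (\<iota>2 i) (f i)"
    and G: "G \<in> Hom A c2 c3" "\<And>i. i \<in> I \<Longrightarrow> Comp A G (\<iota>2 i) = Comp A (\<iota>3 i) (g i)"
  shows "short_exact A F G"
proof -
  let ?k = "inv_into I h"
  have k: "bij_betw ?k (h ` I) I" and kI: "\<And>j. j \<in> h ` I \<Longrightarrow> ?k j \<in> I"
    using h by (auto simp: bij_betw_inv_into inv_into_into inj_on_imp_bij_betw)
  show ?thesis
    by (rule short_exact_small_coproduct[OF _ _ _ coproduct_reindex[OF c1 k refl refl]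
          coproduct_reindex[OF c2 k refl refl] coproduct_reindex[OF c3 k refl refl] F(1) _ G(1)])
      (use se f g F(2) G(2) kI in auto)
qed

end

section \<open>Functors and functor categories\<close>

lemma functor_Obj: "is_functor C D F \<Longrightarrow> x \<in> Obj C \<Longrightarrow> onob F x \<in> Obj D"
  by (auto simp: is_functor_def)

lemma functor_Hom: "is_functor C D F \<Longrightarrow> f \<in> Hom C x y \<Longrightarrow> onar F f \<in> Hom D (onob F x) (onob F y)"
  unfolding is_functor_def by (auto simp: Hom_def)

lemma functor_Ident: "is_functor C D F \<Longrightarrow> x \<in> Obj C \<Longrightarrow> onar F (Ident C x) = Ident D (onob F x)"
  by (simp add: is_functor_def)

lemma functor_Comp: "is_functor C D F \<Longrightarrow> f \<in> Hom C x y \<Longrightarrow> g \<in> Hom C y z \<Longrightarrow>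
    onar F (Comp C g f) = Comp D (onar F g) (onar F f)"
  by (simp add: is_functor_def Hom_def)

lemma functorI:
  assumes C: "is_category C" and D: "is_category D"
    and "onob F \<in> extensional (Obj C)" "onar F \<in> extensional (Arr C)"
    and ob: "\<And>x. x \<in> Obj C \<Longrightarrow> onob F x \<in> Obj D"
    and ar: "\<And>f x y. f \<in> Hom C x y \<Longrightarrow> onar F f \<in> Hom D (onob F x) (onob F y)"
    and id: "\<And>x. x \<in> Obj C \<Longrightarrow> onar F (Ident C x) = Ident D (onob F x)"
    and co: "\<And>f g x y z. f \<in> Hom C x y \<Longrightarrow> g \<in> Hom C y z \<Longrightarrow>
      onar F (Comp C g f) = Comp D (onar F g) (onar F f)"
  shows "is_functor C D F"
proof -
  have ar': "onar F f \<in> Hom D (onob F (Dom C f)) (onob F (Cod C f))" if "f \<in> Arr C" for f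
    by (rule ar) (simp add: Hom_def that)
  have co': "onar F (Comp C g f) = Comp D (onar F g) (onar F f)"
    if "f \<in> Arr C" "g \<in> Arr C" "Cod C f = Dom C g" for f g
    by (rule co[of f "Dom C f" "Cod C f" g "Cod C g"]) (simp_all add: Hom_def that)
  show ?thesis
    unfolding is_functor_def using assms(3,4) ob ar' HomD(1)[OF ar'] id co'
    by (auto simp: PiE_def)
qed

lemma mk_functor:
  assumes C: "is_category C" and D: "is_category D"
    and ob: "\<And>x. x \<in> Obj C \<Longrightarrow> p x \<in> Obj D"
    and ar: "\<And>f x y. f \<in> Hom C x y \<Longrightarrow> a f \<in> Hom D (p x) (p y)"
    and id: "\<And>x. x \<in> Obj C \<Longrightarrow> a (Ident C x) = Ident D (p x)"
    and co: "\<And>f g x y z. f \<in> Hom C x y \<Longrightarrow> g \<in> Hom C y z \<Longrightarrow> a (Comp C g f) = Comp D (a g) (a f)"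
  shows "is_functor C D \<lparr>onob = (\<lambda>x\<in>Obj C. p x), onar = (\<lambda>f\<in>Arr C. a f)\<rparr>" (is "is_functor C D ?F")
proof -
  interpret C: cat C by standard (rule C)
  have r: "onar ?F f = a f" if "f \<in> Hom C x y" for f x y
    using HomD(1)[OF that] by simp
  show ?thesis
  proof (rule functorI[OF C D])
    show "onar ?F f \<in> Hom D (onob ?F x) (onob ?F y)" if f: "f \<in> Hom C x y" for f x y
      using ar[OF f] C.Hom_Obj[OF f] r[OF f] by simp
    show "onar ?F (Ident C x) = Ident D (onob ?F x)" if x: "x \<in> Obj C" for x
      using id[OF x] x r[OF C.Ident_Hom[OF x]] by simp
    show "onar ?F (Comp C g f) = Comp D (onar ?F g) (onar ?F f)"
      if f: "f \<in> Hom C x y" and g: "g \<in> Hom C y z" for f g x y z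
      using co[OF f g] r[OF f] r[OF g] r[OF C.Comp_Hom[OF f g]] by simp
  qed (use ob in auto)
qed

lemma functor_eqI:
  assumes "is_functor C D F" "is_functor C D G"
    and "\<And>x. x \<in> Obj C \<Longrightarrow> onob F x = onob G x" "\<And>f. f \<in> Arr C \<Longrightarrow> onar F f = onar G f"
  shows "F = G"
proof -
  have "onob F = onob G"
    by (rule extensionalityI[of _ "Obj C"]) (use assms in \<open>auto simp: is_functor_def PiE_def\<close>)
  moreover have "onar F = onar G"
    by (rule extensionalityI[of _ "Arr C"]) (use assms in \<open>auto simp: is_functor_def PiE_def\<close>)
  ultimately show ?thesis by simp
qed

lemma comp_functor:
  assumes C: "is_category C" and E: "is_category E" and F: "is_functor C D F" and G: "is_functor D E G"
  shows "is_functor C E (comp_functor C G F)"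
  unfolding comp_functor_def
proof (rule mk_functor[OF C E])
  show "onob G (onob F x) \<in> Obj E" if "x \<in> Obj C" for x
    using functor_Obj[OF G functor_Obj[OF F that]] .
  show "onar G (onar F f) \<in> Hom E (onob G (onob F x)) (onob G (onob F y))" if "f \<in> Hom C x y" for f x y
    using functor_Hom[OF G functor_Hom[OF F that]] .
  show "onar G (onar F (Ident C x)) = Ident E (onob G (onob F x))" if "x \<in> Obj C" for x
    using functor_Ident[OF F that] functor_Ident[OF G functor_Obj[OF F that]] by simp
  show "onar G (onar F (Comp C g f)) = Comp E (onar G (onar F g)) (onar G (onar F f))"
    if f: "f \<in> Hom C x y" and g: "g \<in> Hom C y z" for f g x y z
    using functor_Comp[OF F f g] functor_Comp[OF G functor_Hom[OF F f] functor_Hom[OF F g]] by simp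
qed

lemma comp_functor_simps [simp]:
  "x \<in> Obj C \<Longrightarrow> onob (comp_functor C G F) x = onob G (onob F x)"
  "f \<in> Arr C \<Longrightarrow> onar (comp_functor C G F) f = onar G (onar F f)"
  by (simp_all add: comp_functor_def)

lemma is_natI:
  assumes "\<eta> \<in> extensional (Obj C)" "\<And>x. x \<in> Obj C \<Longrightarrow> \<eta> x \<in> Hom D (onob F x) (onob G x)"
    and n: "\<And>f x y. f \<in> Hom C x y \<Longrightarrow> Comp D (onar G f) (\<eta> x) = Comp D (\<eta> y) (onar F f)"
  shows "is_nat C D F G \<eta>"
proof -
  have "Comp D (onar G f) (\<eta> (Dom C f)) = Comp D (\<eta> (Cod C f)) (onar F f)" if "f \<in> Arr C" for f
    by (rule n) (simp add: Hom_def that)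
  then show ?thesis
    using assms(1,2) by (simp add: is_nat_def)
qed

lemma is_natD:
  assumes "is_nat C D F G \<eta>"
  shows "\<eta> \<in> extensional (Obj C)" "x \<in> Obj C \<Longrightarrow> \<eta> x \<in> Hom D (onob F x) (onob G x)"
    "f \<in> Hom C x y \<Longrightarrow> Comp D (onar G f) (\<eta> x) = Comp D (\<eta> y) (onar F f)"
  using assms by (auto simp: is_nat_def Hom_def)

text \<open>An arrow \<open>f\<close> is sent to the unique \<open>l f\<close> that makes the unit
  natural. Identities and composites are preserved because both candidates solve the same universal
  problem.\<close>

lemma left_adjoint_of_universal_arrows:
  assumes C: "is_category C" and D: "is_category D" and G: "is_functor D C G"
    and univ: "\<And>c. c \<in> Obj C \<Longrightarrow> \<exists>d\<in>Obj D. \<exists>\<eta>\<in>Hom C c (onob G d).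
      \<forall>d'\<in>Obj D. \<forall>h\<in>Hom C c (onob G d'). \<exists>!k. k \<in> Hom D d d' \<and> Comp C (onar G k) \<eta> = h"
  shows "\<exists>F \<eta>. left_adjoint_unit C D G F \<eta>"
proof -
  interpret C: cat C by standard (rule C)
  interpret D: cat D by standard (rule D)
  have "\<forall>c\<in>Obj C. \<exists>p. fst p \<in> Obj D \<and> snd p \<in> Hom C c (onob G (fst p)) \<and>
      (\<forall>d'\<in>Obj D. \<forall>h\<in>Hom C c (onob G d'). \<exists>!k. k \<in> Hom D (fst p) d' \<and> Comp C (onar G k) (snd p) = h)"
  proof
    fix c assume "c \<in> Obj C"
    then obtain d \<eta> where "d \<in> Obj D" "\<eta> \<in> Hom C c (onob G d)"
      "\<forall>d'\<in>Obj D. \<forall>h\<in>Hom C c (onob G d'). \<exists>!k. k \<in> Hom D d d' \<and> Comp C (onar G k) \<eta> = h"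
      using univ by blast
    then show "\<exists>p. fst p \<in> Obj D \<and> snd p \<in> Hom C c (onob G (fst p)) \<and>
      (\<forall>d'\<in>Obj D. \<forall>h\<in>Hom C c (onob G d'). \<exists>!k. k \<in> Hom D (fst p) d' \<and> Comp C (onar G k) (snd p) = h)"
      by (intro exI[of _ "(d, \<eta>)"]) simp
  qed
  then obtain p where p: "\<And>c. c \<in> Obj C \<Longrightarrow> fst (p c) \<in> Obj D"
    "\<And>c. c \<in> Obj C \<Longrightarrow> snd (p c) \<in> Hom C c (onob G (fst (p c)))"
    "\<And>c d' h. c \<in> Obj C \<Longrightarrow> d' \<in> Obj D \<Longrightarrow> h \<in> Hom C c (onob G d') \<Longrightarrow>
      \<exists>!k. k \<in> Hom D (fst (p c)) d' \<and> Comp C (onar G k) (snd (p c)) = h"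
    by metis
  define L \<eta> where "L c = fst (p c)" and "\<eta> c = snd (p c)" for c
  note L = p(1)[folded L_def] and \<eta> = p(2)[folded L_def \<eta>_def] and U = p(3)[folded L_def \<eta>_def]
  define l where "l f = (THE k. k \<in> Hom D (L (Dom C f)) (L (Cod C f)) \<and>
      Comp C (onar G k) (\<eta> (Dom C f)) = Comp C (\<eta> (Cod C f)) f)" for f
  have l: "l f \<in> Hom D (L x) (L y) \<and> Comp C (onar G (l f)) (\<eta> x) = Comp C (\<eta> y) f"
    if f: "f \<in> Hom C x y" for f x y
    using theI'[OF U[OF C.Hom_Obj(1)[OF f] L[OF C.Hom_Obj(2)[OF f]]
        C.Comp_Hom[OF f \<eta>[OF C.Hom_Obj(2)[OF f]]]]]
    by (simp add: l_def HomD[OF f])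
  have eq: "k = k'" if c: "c \<in> Obj C" and k: "k \<in> Hom D (L c) d" and k': "k' \<in> Hom D (L c) d"
    and e: "Comp C (onar G k) (\<eta> c) = Comp C (onar G k') (\<eta> c)" for c d k k'
    using U[OF c D.Hom_Obj(2)[OF k] C.Comp_Hom[OF \<eta>[OF c] functor_Hom[OF G k]]] k k' e by metis
  define F where "F = \<lparr>onob = (\<lambda>c\<in>Obj C. L c), onar = (\<lambda>f\<in>Arr C. l f)\<rparr>"
  have "is_functor C D F"
    unfolding F_def
  proof (rule mk_functor[OF C D])
    fix c assume c: "c \<in> Obj C"
    then have i: "Ident C c \<in> Hom C c c" by simp
    show "l (Ident C c) = Ident D (L c)"
      by (rule eq[OF c conjunct1[OF l[OF i]]])
        (use l[OF i] L[OF c] \<eta>[OF c] functor_Ident[OF G L[OF c]] C.Comp_Ident[OF \<eta>[OF c]] in simp_all)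
  next
    fix f g x y z assume f: "f \<in> Hom C x y" and g: "g \<in> Hom C y z"
    note lf = conjunct1[OF l[OF f]] conjunct2[OF l[OF f]] and lg = conjunct1[OF l[OF g]] conjunct2[OF l[OF g]]
    note x = C.Hom_Obj(1)[OF f] and y = C.Hom_Obj(1)[OF g] and z = C.Hom_Obj(2)[OF g]
    have gf: "Comp C g f \<in> Hom C x z" using C.Comp_Hom f g by blast
    show "l (Comp C g f) = Comp D (l g) (l f)"
    proof (rule eq[OF x conjunct1[OF l[OF gf]] D.Comp_Hom[OF lf(1) lg(1)]])
      have "Comp C (onar G (Comp D (l g) (l f))) (\<eta> x) = Comp C (onar G (l g)) (Comp C (\<eta> y) f)"
        using functor_Comp[OF G lf(1) lg(1)] lf(2)
          C.Comp_assoc[OF \<eta>[OF x] functor_Hom[OF G lf(1)] functor_Hom[OF G lg(1)]] by simp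
      also have "\<dots> = Comp C (\<eta> z) (Comp C g f)"
        using C.Comp_assoc[OF f \<eta>[OF y] functor_Hom[OF G lg(1)]] lg(2) C.Comp_assoc[OF f g \<eta>[OF z]] by simp
      finally show "Comp C (onar G (l (Comp C g f))) (\<eta> x) = Comp C (onar G (Comp D (l g) (l f))) (\<eta> x)"
        using l[OF gf] by simp
    qed
  qed (use L l in auto)
  then have "left_adjoint_unit C D G F \<eta>"
    unfolding left_adjoint_unit_def using G \<eta> U l[OF HomI[OF _ refl refl]] C.Dom_Obj C.Cod_Obj
    by (auto simp: F_def)
  then show ?thesis by blast
qed

section \<open>Functor categories with pointwise structure\<close>

abbreviation cmp :: "('o, 'a, 'p, 'b) ntrans \<Rightarrow> 'o \<Rightarrow> 'b" where
  "cmp t \<equiv> snd (snd t)"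

locale fun_category = C: cat C + A: preadd A
  for C :: "('o, 'a, 'x) category_scheme" and A :: "('p, 'b, 'z) abcat_scheme"
begin

abbreviation "FC \<equiv> fun_cat C A"

lemma Obj_FC [simp]: "Obj FC = {F. is_functor C A F}"
  by (simp add: fun_cat_def)

lemma FC_HomI:
  assumes "is_functor C A F" "is_functor C A G"
    and "\<And>x. x \<in> Obj C \<Longrightarrow> \<eta> x \<in> Hom A (onob F x) (onob G x)"
    and "\<And>f x y. f \<in> Hom C x y \<Longrightarrow> Comp A (onar G f) (\<eta> x) = Comp A (\<eta> y) (onar F f)"
  shows "(F, G, \<lambda>x\<in>Obj C. \<eta> x) \<in> Hom FC F G"
proof -
  have "is_nat C A F G (\<lambda>x\<in>Obj C. \<eta> x)"
    by (rule is_natI) (use assms(3,4) C.Hom_Obj in auto)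
  then show ?thesis
    using assms(1,2) by (simp add: fun_cat_def Hom_def)
qed

lemma FC_HomD:
  assumes "t \<in> Hom FC F G"
  shows "is_functor C A F" "is_functor C A G" "t = (F, G, cmp t)" "cmp t \<in> extensional (Obj C)"
    "x \<in> Obj C \<Longrightarrow> cmp t x \<in> Hom A (onob F x) (onob G x)"
    "f \<in> Hom C x y \<Longrightarrow> Comp A (onar G f) (cmp t x) = Comp A (cmp t y) (onar F f)"
proof -
  have t: "is_functor C A F \<and> is_functor C A G \<and> t = (F, G, cmp t) \<and> is_nat C A F G (cmp t)"
    using assms by (auto simp: Hom_def fun_cat_def)
  then show "is_functor C A F" "is_functor C A G" "t = (F, G, cmp t)" "cmp t \<in> extensional (Obj C)"
    "x \<in> Obj C \<Longrightarrow> cmp t x \<in> Hom A (onob F x) (onob G x)"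
    "f \<in> Hom C x y \<Longrightarrow> Comp A (onar G f) (cmp t x) = Comp A (cmp t y) (onar F f)"
    using is_natD[of C A F G "cmp t"] by simp_all
qed

lemma FC_ext:
  assumes t: "t \<in> Hom FC F G" and s: "s \<in> Hom FC F G" and "\<And>x. x \<in> Obj C \<Longrightarrow> cmp t x = cmp s x"
  shows "t = s"
proof -
  have "cmp t = cmp s"
    by (rule extensionalityI[OF FC_HomD(4)[OF t] FC_HomD(4)[OF s]]) (rule assms(3))
  then show ?thesis
    using FC_HomD(3)[OF t] FC_HomD(3)[OF s] by metis
qed

lemma FC_Comp:
  assumes t: "t \<in> Hom FC F G" and s: "s \<in> Hom FC G H"
  shows "Comp FC s t \<in> Hom FC F H" "x \<in> Obj C \<Longrightarrow> cmp (Comp FC s t) x = Comp A (cmp s x) (cmp t x)"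
proof -
  note T = FC_HomD[OF t] and S = FC_HomD[OF s]
  have e: "Comp FC s t = (F, H, \<lambda>x\<in>Obj C. Comp A (cmp s x) (cmp t x))"
    by (subst T(3), subst S(3)) (simp add: fun_cat_def)
  show "Comp FC s t \<in> Hom FC F H"
    unfolding e
  proof (rule FC_HomI[OF T(1) S(2)])
    show "Comp A (cmp s x) (cmp t x) \<in> Hom A (onob F x) (onob H x)" if "x \<in> Obj C" for x
      using T(5) S(5) A.Comp_Hom that by blast
    fix f x y assume f: "f \<in> Hom C x y"
    note o = C.Hom_Obj[OF f]
    show "Comp A (onar H f) (Comp A (cmp s x) (cmp t x)) = Comp A (Comp A (cmp s y) (cmp t y)) (onar F f)"
      using A.Comp_assoc[OF T(5)[OF o(1)] S(5)[OF o(1)] functor_Hom[OF S(2) f]] S(6)[OF f]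
        A.Comp_assoc[OF T(5)[OF o(1)] functor_Hom[OF S(1) f] S(5)[OF o(2)]] T(6)[OF f]
        A.Comp_assoc[OF functor_Hom[OF T(1) f] T(5)[OF o(2)] S(5)[OF o(2)]] by simp
  qed
  show "cmp (Comp FC s t) x = Comp A (cmp s x) (cmp t x)" if "x \<in> Obj C"
    using that by (simp add: e)
qed

lemma FC_Ident:
  assumes F: "is_functor C A F"
  shows "Ident FC F \<in> Hom FC F F" "x \<in> Obj C \<Longrightarrow> cmp (Ident FC F) x = Ident A (onob F x)"
proof -
  have e: "Ident FC F = (F, F, \<lambda>x\<in>Obj C. Ident A (onob F x))"
    by (simp add: fun_cat_def)
  show "Ident FC F \<in> Hom FC F F"
    unfolding e by (rule FC_HomI[OF F F])
      (use functor_Obj[OF F] A.Comp_Ident[OF functor_Hom[OF F]] in auto)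
  show "cmp (Ident FC F) x = Ident A (onob F x)" if "x \<in> Obj C"
    using that by (simp add: e)
qed

lemma FC_Zero:
  assumes F: "is_functor C A F" and G: "is_functor C A G"
  shows "Zero FC F G \<in> Hom FC F G" "x \<in> Obj C \<Longrightarrow> cmp (Zero FC F G) x = Zero A (onob F x) (onob G x)"
proof -
  have e: "Zero FC F G = (F, G, \<lambda>x\<in>Obj C. Zero A (onob F x) (onob G x))"
    by (simp add: fun_cat_def)
  show "Zero FC F G \<in> Hom FC F G"
    unfolding e by (rule FC_HomI[OF F G])
      (use functor_Obj[OF F] functor_Obj[OF G] A.Comp_Zero[OF functor_Hom[OF G]]
        A.Zero_Comp[OF functor_Hom[OF F]] C.Hom_Obj in auto)
  show "cmp (Zero FC F G) x = Zero A (onob F x) (onob G x)" if "x \<in> Obj C"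
    using that by (simp add: e)
qed

lemma FC_Add:
  assumes t: "t \<in> Hom FC F G" and s: "s \<in> Hom FC F G"
  shows "Add FC t s \<in> Hom FC F G" "x \<in> Obj C \<Longrightarrow> cmp (Add FC t s) x = Add A (cmp t x) (cmp s x)"
proof -
  note T = FC_HomD[OF t] and S = FC_HomD[OF s]
  have e: "Add FC t s = (F, G, \<lambda>x\<in>Obj C. Add A (cmp t x) (cmp s x))"
    by (subst T(3), subst S(3)) (simp add: fun_cat_def)
  show "Add FC t s \<in> Hom FC F G"
    unfolding e
  proof (rule FC_HomI[OF T(1,2)])
    show "Add A (cmp t x) (cmp s x) \<in> Hom A (onob F x) (onob G x)" if "x \<in> Obj C" for x
      using T(5) S(5) A.Add_Hom that by blast
    fix f x y assume f: "f \<in> Hom C x y"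
    note o = C.Hom_Obj[OF f]
    show "Comp A (onar G f) (Add A (cmp t x) (cmp s x)) = Comp A (Add A (cmp t y) (cmp s y)) (onar F f)"
      using A.Comp_Add(1)[OF T(5)[OF o(1)] S(5)[OF o(1)] functor_Hom[OF T(2) f] functor_Hom[OF T(2) f]]
        A.Comp_Add(2)[OF functor_Hom[OF T(1) f] functor_Hom[OF T(1) f] T(5)[OF o(2)] S(5)[OF o(2)]]
        T(6)[OF f] S(6)[OF f] by simp
  qed
  show "cmp (Add FC t s) x = Add A (cmp t x) (cmp s x)" if "x \<in> Obj C"
    using that by (simp add: e)
qed

lemma FC_Arr: "t \<in> Arr FC \<Longrightarrow> t \<in> Hom FC (Dom FC t) (Cod FC t)"
  by (simp add: Hom_def)

lemma FC_category: "is_category FC"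
  unfolding is_category_def
proof (intro conjI ballI impI)
  fix t assume "t \<in> Arr FC"
  note t = FC_Arr[OF this]
  note T = FC_HomD[OF t]
  show "Dom FC t \<in> Obj FC" "Cod FC t \<in> Obj FC"
    using T by simp_all
  show "Comp FC t (Ident FC (Dom FC t)) = t"
    by (rule FC_ext[OF FC_Comp(1)[OF FC_Ident(1)[OF T(1)] t] t])
      (use FC_Comp(2)[OF FC_Ident(1)[OF T(1)] t] FC_Ident(2)[OF T(1)] A.Comp_Ident[OF T(5)] in simp)
  show "Comp FC (Ident FC (Cod FC t)) t = t"
    by (rule FC_ext[OF FC_Comp(1)[OF t FC_Ident(1)[OF T(2)]] t])
      (use FC_Comp(2)[OF t FC_Ident(1)[OF T(2)]] FC_Ident(2)[OF T(2)] A.Comp_Ident[OF T(5)] in simp)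
next
  fix f g assume f: "f \<in> Arr FC" and "g \<in> Arr FC" "Cod FC f = Dom FC g"
  then have "g \<in> Hom FC (Cod FC f) (Cod FC g)"
    by (simp add: Hom_def)
  then show "Comp FC g f \<in> Hom FC (Dom FC f) (Cod FC g)"
    by (rule FC_Comp(1)[OF FC_Arr[OF f]])
next
  fix f g h
  assume f: "f \<in> Arr FC" and "g \<in> Arr FC" "h \<in> Arr FC" "Cod FC f = Dom FC g \<and> Cod FC g = Dom FC h"
  then have g: "g \<in> Hom FC (Cod FC f) (Cod FC g)" and h: "h \<in> Hom FC (Cod FC g) (Cod FC h)"
    by (simp_all add: Hom_def)
  note f = FC_Arr[OF f]
  note gf = FC_Comp[OF f g] and hg = FC_Comp[OF g h]
  show "Comp FC h (Comp FC g f) = Comp FC (Comp FC h g) f"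
    by (rule FC_ext[OF FC_Comp(1)[OF gf(1) h] FC_Comp(1)[OF f hg(1)]])
      (use FC_Comp(2)[OF gf(1) h] FC_Comp(2)[OF f hg(1)] gf(2) hg(2)
        A.Comp_assoc[OF FC_HomD(5)[OF f] FC_HomD(5)[OF g] FC_HomD(5)[OF h]] in simp)
next
  fix F assume "F \<in> Obj FC"
  then show "Ident FC F \<in> Hom FC F F"
    using FC_Ident by simp
qed

lemma FC_Neg_ex:
  assumes t: "t \<in> Hom FC F G"
  shows "\<exists>s\<in>Hom FC F G. Add FC t s = Zero FC F G"
proof
  note T = FC_HomD[OF t]
  show s: "(F, G, \<lambda>x\<in>Obj C. Neg A (cmp t x)) \<in> Hom FC F G"
  proof (rule FC_HomI[OF T(1,2)])
    show "Neg A (cmp t x) \<in> Hom A (onob F x) (onob G x)" if "x \<in> Obj C" for x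
      using A.Neg(1)[OF T(5)[OF that]] .
    fix f x y assume f: "f \<in> Hom C x y"
    note o = C.Hom_Obj[OF f]
    show "Comp A (onar G f) (Neg A (cmp t x)) = Comp A (Neg A (cmp t y)) (onar F f)"
      using A.Comp_Neg(1)[OF T(5)[OF o(1)] functor_Hom[OF T(2) f]]
        A.Comp_Neg(2)[OF functor_Hom[OF T(1) f] T(5)[OF o(2)]] T(6)[OF f] by simp
  qed
  show "Add FC t (F, G, \<lambda>x\<in>Obj C. Neg A (cmp t x)) = Zero FC F G"
    by (rule FC_ext[OF FC_Add(1)[OF t s] FC_Zero(1)[OF T(1,2)]])
      (use FC_Add(2)[OF t s] FC_Zero(2)[OF T(1,2)] A.Neg(2)[OF T(5)] in simp)
qed

lemma FC_preadditive: "is_preadditive FC"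
  unfolding is_preadditive_def
proof (intro conjI ballI FC_category)
  fix F G assume FG: "F \<in> Obj FC" "G \<in> Obj FC"
  show "Zero FC F G \<in> Hom FC F G"
    using FG FC_Zero by simp
  fix t assume t: "t \<in> Hom FC F G"
  note T = FC_HomD[OF t]
  show "\<exists>s\<in>Hom FC F G. Add FC t s = Zero FC F G"
    by (rule FC_Neg_ex[OF t])
  show "Add FC t (Zero FC F G) = t"
    by (rule FC_ext[OF FC_Add(1)[OF t FC_Zero(1)[OF T(1,2)]] t])
      (use FC_Add(2)[OF t FC_Zero(1)[OF T(1,2)]] FC_Zero(2)[OF T(1,2)] A.Add_Zero[OF T(5)] in simp)
  fix s assume s: "s \<in> Hom FC F G"
  note S = FC_HomD[OF s]
  show "Add FC t s \<in> Hom FC F G"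
    by (rule FC_Add(1)[OF t s])
  show "Add FC t s = Add FC s t"
    by (rule FC_ext[OF FC_Add(1)[OF t s] FC_Add(1)[OF s t]])
      (use FC_Add(2)[OF t s] FC_Add(2)[OF s t] A.Add_commute[OF T(5) S(5)] in simp)
  fix r assume r: "r \<in> Hom FC F G"
  note R = FC_HomD[OF r]
  show "Add FC (Add FC t s) r = Add FC t (Add FC s r)"
    by (rule FC_ext[OF FC_Add(1)[OF FC_Add(1)[OF t s] r] FC_Add(1)[OF t FC_Add(1)[OF s r]]])
      (use FC_Add(2)[OF FC_Add(1)[OF t s] r] FC_Add(2)[OF t FC_Add(1)[OF s r]] FC_Add(2)[OF t s]
        FC_Add(2)[OF s r] A.Add_assoc[OF T(5) S(5) R(5)] in simp)
next
  fix F G H f f' g g' assume f: "f \<in> Hom FC F G" and f': "f' \<in> Hom FC F G"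
    and g: "g \<in> Hom FC G H" and g': "g' \<in> Hom FC G H"
  note c = A.Comp_Add[OF FC_HomD(5)[OF f] FC_HomD(5)[OF f'] FC_HomD(5)[OF g] FC_HomD(5)[OF g']]
  show "Comp FC g (Add FC f f') = Add FC (Comp FC g f) (Comp FC g f')"
    by (rule FC_ext[OF FC_Comp(1)[OF FC_Add(1)[OF f f'] g] FC_Add(1)[OF FC_Comp(1)[OF f g] FC_Comp(1)[OF f' g]]])
      (use c FC_Comp(2)[OF FC_Add(1)[OF f f'] g] FC_Add(2)[OF FC_Comp(1)[OF f g] FC_Comp(1)[OF f' g]]
        FC_Comp(2)[OF f g] FC_Comp(2)[OF f' g] FC_Add(2)[OF f f'] in simp)
  show "Comp FC (Add FC g g') f = Add FC (Comp FC g f) (Comp FC g' f)"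
    by (rule FC_ext[OF FC_Comp(1)[OF f FC_Add(1)[OF g g']] FC_Add(1)[OF FC_Comp(1)[OF f g] FC_Comp(1)[OF f g']]])
      (use c FC_Comp(2)[OF f FC_Add(1)[OF g g']] FC_Add(2)[OF FC_Comp(1)[OF f g] FC_Comp(1)[OF f g']]
        FC_Comp(2)[OF f g] FC_Comp(2)[OF f g'] FC_Add(2)[OF g g'] in simp)
qed

end

sublocale fun_category \<subseteq> FC: preadd FC
  by standard (use FC_preadditive FC_category in auto)

context fun_category
begin

lemma FC_zero_object:
  assumes "is_functor C A F" "\<And>x. x \<in> Obj C \<Longrightarrow> zero_object A (onob F x)"
  shows "zero_object FC F"
proof -
  have "Ident FC F = Zero FC F F"
    by (rule FC_ext[OF FC_Ident(1) FC_Zero(1)])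
      (use assms FC_Ident(2)[OF assms(1)] FC_Zero(2)[OF assms(1,1)] A.zero_object_iff in auto)
  then show ?thesis
    using assms FC.zero_object_iff by simp
qed

lemma FC_zero_objectD:
  assumes "zero_object FC F" "x \<in> Obj C"
  shows "zero_object A (onob F x)"
proof -
  have F: "is_functor C A F" "Ident FC F = Zero FC F F"
    using assms FC.zero_object_iff by simp_all
  then have "Ident A (onob F x) = Zero A (onob F x) (onob F x)"
    using FC_Ident(2)[OF F(1) assms(2)] FC_Zero(2)[OF F(1,1) assms(2)] by simp
  then show ?thesis
    using A.zero_object_iff functor_Obj[OF F(1) assms(2)] by simp
qed

lemma FC_zero_object_ex:
  assumes z: "zero_object A z"
  shows "\<exists>F. zero_object FC F"
proof -
  define F where "F = \<lparr>onob = (\<lambda>x\<in>Obj C. z), onar = (\<lambda>x\<in>Arr C. Ident A z)\<rparr>"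
  have zi: "Ident A z \<in> Hom A z z" "z \<in> Obj A"
    using A.zero_object_Obj[OF z] by simp_all
  have "is_functor C A F"
    unfolding F_def by (rule mk_functor[OF C.cat A.cat]) (use zi A.Comp_Ident(1)[OF zi(1)] in simp_all)
  then show ?thesis
    using FC_zero_object[of F] z by (auto simp: F_def)
qed

lemma FC_mono:
  assumes t: "t \<in> Hom FC F G" and "\<And>x. x \<in> Obj C \<Longrightarrow> is_mono A (cmp t x)"
  shows "is_mono FC t"
proof (rule FC.monoI[OF t])
  fix H g h assume g: "g \<in> Hom FC H F" and h: "h \<in> Hom FC H F" and e: "Comp FC t g = Comp FC t h"
  have e': "Comp A (cmp t x) (cmp g x) = Comp A (cmp t x) (cmp h x)" if "x \<in> Obj C" for x
    using FC_Comp(2)[OF g t that] FC_Comp(2)[OF h t that] e by simp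
  show "g = h"
    by (rule FC_ext[OF g h])
      (use assms(2) e' A.mono_cancel[OF _ FC_HomD(5)[OF t] FC_HomD(5)[OF g] FC_HomD(5)[OF h]] in blast)
qed

lemma FC_epi:
  assumes t: "t \<in> Hom FC F G" and "\<And>x. x \<in> Obj C \<Longrightarrow> is_epi A (cmp t x)"
  shows "is_epi FC t"
proof (rule FC.epiI[OF t])
  fix H g h assume g: "g \<in> Hom FC G H" and h: "h \<in> Hom FC G H" and e: "Comp FC g t = Comp FC h t"
  have e': "Comp A (cmp g x) (cmp t x) = Comp A (cmp h x) (cmp t x)" if "x \<in> Obj C" for x
    using FC_Comp(2)[OF t g that] FC_Comp(2)[OF t h that] e by simp
  show "g = h"
    by (rule FC_ext[OF g h])
      (use assms(2) e' A.epi_cancel[OF _ FC_HomD(5)[OF t] FC_HomD(5)[OF g] FC_HomD(5)[OF h]] in blast)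
qed

lemma FC_iso_cmp:
  assumes t: "t \<in> Hom FC F G" "is_iso FC t" and x: "x \<in> Obj C"
  shows "is_iso A (cmp t x)"
proof -
  note T = FC_HomD[OF t(1)]
  obtain s where s: "s \<in> Hom FC G F" "Comp FC s t = Ident FC F" "Comp FC t s = Ident FC G"
    using FC.isoE[OF t(2,1)] by blast
  show ?thesis
    by (rule A.isoI[OF T(5)[OF x] FC_HomD(5)[OF s(1) x]])
      (use FC_Comp(2)[OF t(1) s(1) x] FC_Comp(2)[OF s(1) t(1) x] s(2,3) FC_Ident(2)[OF T(1) x]
        FC_Ident(2)[OF T(2) x] in simp_all)
qed

text \<open>The factorisations chosen at the individual objects form a natural transformation
  because the components of \<open>k\<close> are monic.\<close>

lemma FC_kernel:
  assumes t: "t \<in> Hom FC F G" and k: "k \<in> Hom FC K F"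
    and ker: "\<And>x. x \<in> Obj C \<Longrightarrow> is_kernel A (cmp t x) (cmp k x)"
  shows "is_kernel FC t k"
proof (rule FC.kernelI[OF t k])
  note T = FC_HomD[OF t] and K = FC_HomD[OF k]
  note kD = A.kernelD[OF ker T(5)]
  show "Comp FC t k = Zero FC K G"
    by (rule FC_ext[OF FC_Comp(1)[OF k t] FC_Zero(1)[OF K(1) T(2)]])
      (use kD FC_Comp(2)[OF k t] FC_Zero(2)[OF K(1) T(2)] HomD(2)[OF K(5)] in simp)
  show "is_mono FC k"
    by (rule FC_mono[OF k]) (rule kD(3))
  fix H h assume h: "h \<in> Hom FC H F" and z: "Comp FC t h = Zero FC H G"
  note Hh = FC_HomD[OF h]
  have "\<exists>u. u \<in> Hom A (onob H x) (onob K x) \<and> Comp A (cmp k x) u = cmp h x" if x: "x \<in> Obj C" for x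
    using A.kernel_lift[OF ker[OF x] T(5)[OF x] Hh(5)[OF x]] FC_Comp(2)[OF h t x] z
      FC_Zero(2)[OF Hh(1) T(2) x] HomD(2)[OF K(5)[OF x]] by metis
  then obtain u where u: "\<And>x. x \<in> Obj C \<Longrightarrow> u x \<in> Hom A (onob H x) (onob K x)"
    "\<And>x. x \<in> Obj C \<Longrightarrow> Comp A (cmp k x) (u x) = cmp h x"
    by metis
  have U: "(H, K, \<lambda>x\<in>Obj C. u x) \<in> Hom FC H K"
  proof (rule FC_HomI[OF Hh(1) K(1) u(1)])
    fix f x y assume f: "f \<in> Hom C x y"
    note o = C.Hom_Obj[OF f]
    note Kf = functor_Hom[OF K(1) f] and Hf = functor_Hom[OF Hh(1) f]
    show "Comp A (onar K f) (u x) = Comp A (u y) (onar H f)"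
    proof (rule A.mono_cancel[OF kD(3)[OF o(2) o(2)] K(5)[OF o(2)] A.Comp_Hom[OF u(1)[OF o(1)] Kf]
          A.Comp_Hom[OF Hf u(1)[OF o(2)]]])
      show "Comp A (cmp k y) (Comp A (onar K f) (u x)) = Comp A (cmp k y) (Comp A (u y) (onar H f))"
        using A.Comp_assoc[OF u(1)[OF o(1)] Kf K(5)[OF o(2)]] K(6)[OF f, symmetric]
          A.Comp_assoc[OF u(1)[OF o(1)] K(5)[OF o(1)] functor_Hom[OF K(2) f]] u(2)[OF o(1)] Hh(6)[OF f]
          A.Comp_assoc[OF Hf u(1)[OF o(2)] K(5)[OF o(2)]] u(2)[OF o(2)] by simp
    qed
  qed
  have "Comp FC k (H, K, \<lambda>x\<in>Obj C. u x) = h"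
    by (rule FC_ext[OF FC_Comp(1)[OF U k] h]) (use FC_Comp(2)[OF U k] u(2) in simp)
  then show "\<exists>u\<in>Hom FC H K. Comp FC k u = h"
    using U by blast
qed

lemma FC_cokernel:
  assumes t: "t \<in> Hom FC F G" and k: "k \<in> Hom FC G K"
    and cok: "\<And>x. x \<in> Obj C \<Longrightarrow> is_cokernel A (cmp t x) (cmp k x)"
  shows "is_cokernel FC t k"
proof (rule FC.cokernelI[OF t k])
  note T = FC_HomD[OF t] and K = FC_HomD[OF k]
  note kD = A.cokernelD[OF cok T(5)]
  show "Comp FC k t = Zero FC F K"
    by (rule FC_ext[OF FC_Comp(1)[OF t k] FC_Zero(1)[OF T(1) K(2)]])
      (use kD FC_Comp(2)[OF t k] FC_Zero(2)[OF T(1) K(2)] HomD(3)[OF K(5)] in simp)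
  show "is_epi FC k"
    by (rule FC_epi[OF k]) (rule kD(3))
  fix H h assume h: "h \<in> Hom FC G H" and z: "Comp FC h t = Zero FC F H"
  note Hh = FC_HomD[OF h]
  have "\<exists>u. u \<in> Hom A (onob K x) (onob H x) \<and> Comp A u (cmp k x) = cmp h x" if x: "x \<in> Obj C" for x
    using A.cokernel_desc[OF cok[OF x] T(5)[OF x] Hh(5)[OF x]] FC_Comp(2)[OF t h x] z
      FC_Zero(2)[OF T(1) Hh(2) x] HomD(3)[OF K(5)[OF x]] by metis
  then obtain u where u: "\<And>x. x \<in> Obj C \<Longrightarrow> u x \<in> Hom A (onob K x) (onob H x)"
    "\<And>x. x \<in> Obj C \<Longrightarrow> Comp A (u x) (cmp k x) = cmp h x"
    by metis
  have U: "(K, H, \<lambda>x\<in>Obj C. u x) \<in> Hom FC K H"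
  proof (rule FC_HomI[OF K(2) Hh(2) u(1)])
    fix f x y assume f: "f \<in> Hom C x y"
    note o = C.Hom_Obj[OF f]
    note Kf = functor_Hom[OF K(2) f] and Hf = functor_Hom[OF Hh(2) f]
    show "Comp A (onar H f) (u x) = Comp A (u y) (onar K f)"
    proof (rule A.epi_cancel[OF kD(3)[OF o(1) o(1)] K(5)[OF o(1)] A.Comp_Hom[OF u(1)[OF o(1)] Hf]
          A.Comp_Hom[OF Kf u(1)[OF o(2)]]])
      show "Comp A (Comp A (onar H f) (u x)) (cmp k x) = Comp A (Comp A (u y) (onar K f)) (cmp k x)"
        using A.Comp_assoc[OF K(5)[OF o(1)] u(1)[OF o(1)] Hf] u(2)[OF o(1)] Hh(6)[OF f]
          A.Comp_assoc[OF K(5)[OF o(1)] Kf u(1)[OF o(2)]] K(6)[OF f]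
          A.Comp_assoc[OF functor_Hom[OF K(1) f] K(5)[OF o(2)] u(1)[OF o(2)]] u(2)[OF o(2)] by simp
    qed
  qed
  have "Comp FC (K, H, \<lambda>x\<in>Obj C. u x) k = h"
    by (rule FC_ext[OF FC_Comp(1)[OF k U] h]) (use FC_Comp(2)[OF k U] u(2) in simp)
  then show "\<exists>u\<in>Hom FC K H. Comp FC u k = h"
    using U by blast
qed

end

locale fun_preabelian = C: cat C + A: preabelian A
  for C :: "('o, 'a, 'x) category_scheme" and A :: "('p, 'b, 'z) abcat_scheme"

sublocale fun_preabelian \<subseteq> fun_category C A ..

context fun_preabelian
begin

text \<open>By naturality of \<open>t\<close>, the action of \<open>F\<close> on an arrow carries
  the kernel at its source into the kernel at its target. Monicity of the kernels makes these
  restrictions functorial.\<close>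

lemma pointwise_kernel_ex:
  assumes t: "t \<in> Hom FC F G"
  shows "\<exists>K k. k \<in> Hom FC K F \<and> (\<forall>x\<in>Obj C. is_kernel A (cmp t x) (cmp k x))"
proof -
  note T = FC_HomD[OF t]
  define k where "k x = ker A (cmp t x)" for x
  have ker: "\<And>x. x \<in> Obj C \<Longrightarrow> is_kernel A (cmp t x) (k x)"
    unfolding k_def using A.ker[OF T(5)] .
  note kD = A.kernelD[OF ker T(5)]
  have "\<exists>u. u \<in> Hom A (Dom A (k x)) (Dom A (k y)) \<and> Comp A (k y) u = Comp A (onar F f) (k x)"
    if f: "f \<in> Hom C x y" for f x y
  proof -
    note o = C.Hom_Obj[OF f]
    note Ff = functor_Hom[OF T(1) f] and Gf = functor_Hom[OF T(2) f]
    have "Comp A (cmp t y) (Comp A (onar F f) (k x)) = Comp A (onar G f) (Comp A (cmp t x) (k x))"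
      using A.Comp_assoc[OF kD(1)[OF o(1) o(1)] Ff T(5)[OF o(2)]] T(6)[OF f]
        A.Comp_assoc[OF kD(1)[OF o(1) o(1)] T(5)[OF o(1)] Gf] by simp
    also have "\<dots> = Zero A (Dom A (k x)) (onob G y)"
      using kD(2)[OF o(1) o(1)] A.Comp_Zero[OF Gf] A.Hom_Obj[OF kD(1)[OF o(1) o(1)]] by simp
    finally show ?thesis
      using A.kernel_lift[OF ker[OF o(2)] T(5)[OF o(2)] A.Comp_Hom[OF kD(1)[OF o(1) o(1)] Ff]] by metis
  qed
  then have "\<forall>f\<in>Arr C. \<exists>u. u \<in> Hom A (Dom A (k (Dom C f))) (Dom A (k (Cod C f))) \<and>
      Comp A (k (Cod C f)) u = Comp A (onar F f) (k (Dom C f))"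
    by (simp add: Hom_def)
  then obtain u where u: "\<forall>f\<in>Arr C. u f \<in> Hom A (Dom A (k (Dom C f))) (Dom A (k (Cod C f))) \<and>
      Comp A (k (Cod C f)) (u f) = Comp A (onar F f) (k (Dom C f))"
    by metis
  have u1: "u f \<in> Hom A (Dom A (k x)) (Dom A (k y))" and u2: "Comp A (k y) (u f) = Comp A (onar F f) (k x)"
    if "f \<in> Hom C x y" for f x y
    using u HomD[OF that] by auto
  define K where "K = \<lparr>onob = (\<lambda>x\<in>Obj C. Dom A (k x)), onar = (\<lambda>f\<in>Arr C. u f)\<rparr>"
  have K: "is_functor C A K"
    unfolding K_def
  proof (rule mk_functor[OF C.cat A.cat])
    fix x assume x: "x \<in> Obj C"
    note i = C.Ident_Hom[OF x]
    show "u (Ident C x) = Ident A (Dom A (k x))"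
      by (rule A.mono_cancel[OF kD(3)[OF x x] kD(1)[OF x x] u1[OF i] A.Ident_Hom[OF A.Hom_Obj(1)[OF kD(1)[OF x x]]]])
        (use u2[OF i] functor_Ident[OF T(1) x] A.Comp_Ident[OF kD(1)[OF x x]] in simp)
  next
    fix f g x y z assume f: "f \<in> Hom C x y" and g: "g \<in> Hom C y z"
    note gf = C.Comp_Hom[OF f g]
    note x = C.Hom_Obj(1)[OF f] and y = C.Hom_Obj(1)[OF g] and z = C.Hom_Obj(2)[OF g]
    note Ff = functor_Hom[OF T(1) f] and Fg = functor_Hom[OF T(1) g]
    show "u (Comp C g f) = Comp A (u g) (u f)"
      by (rule A.mono_cancel[OF kD(3)[OF z z] kD(1)[OF z z] u1[OF gf] A.Comp_Hom[OF u1[OF f] u1[OF g]]])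
        (use u2[OF gf] functor_Comp[OF T(1) f g] A.Comp_assoc[OF u1[OF f] u1[OF g] kD(1)[OF z z]] u2[OF g]
          A.Comp_assoc[OF u1[OF f] kD(1)[OF y y] Fg] u2[OF f] A.Comp_assoc[OF kD(1)[OF x x] Ff Fg] in simp)
  qed (use A.Hom_Obj(1)[OF kD(1)] u1 in auto)
  have Kar: "onar K f = u f" if "f \<in> Hom C x y" for f x y
    using HomD(1)[OF that] by (simp add: K_def)
  have "(K, F, \<lambda>x\<in>Obj C. k x) \<in> Hom FC K F"
    by (rule FC_HomI[OF K T(1)]) (use kD(1) u2 Kar in \<open>auto simp: K_def\<close>)
  then show ?thesis
    using ker by (intro exI conjI ballI) auto
qed

lemma pointwise_cokernel_ex:
  assumes t: "t \<in> Hom FC F G"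
  shows "\<exists>K k. k \<in> Hom FC G K \<and> (\<forall>x\<in>Obj C. is_cokernel A (cmp t x) (cmp k x))"
proof -
  note T = FC_HomD[OF t]
  define k where "k x = cok A (cmp t x)" for x
  have cok: "\<And>x. x \<in> Obj C \<Longrightarrow> is_cokernel A (cmp t x) (k x)"
    unfolding k_def using A.cok[OF T(5)] .
  note kD = A.cokernelD[OF cok T(5)]
  have "\<exists>u. u \<in> Hom A (Cod A (k x)) (Cod A (k y)) \<and> Comp A u (k x) = Comp A (k y) (onar G f)"
    if f: "f \<in> Hom C x y" for f x y
  proof -
    note o = C.Hom_Obj[OF f]
    note Ff = functor_Hom[OF T(1) f] and Gf = functor_Hom[OF T(2) f]
    have "Comp A (Comp A (k y) (onar G f)) (cmp t x) = Comp A (Comp A (k y) (cmp t y)) (onar F f)"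
      using A.Comp_assoc[OF T(5)[OF o(1)] Gf kD(1)[OF o(2) o(2)]] T(6)[OF f]
        A.Comp_assoc[OF Ff T(5)[OF o(2)] kD(1)[OF o(2) o(2)]] by simp
    also have "\<dots> = Zero A (onob F x) (Cod A (k y))"
      using kD(2)[OF o(2) o(2)] A.Zero_Comp[OF Ff] A.Hom_Obj[OF kD(1)[OF o(2) o(2)]] by simp
    finally show ?thesis
      using A.cokernel_desc[OF cok[OF o(1)] T(5)[OF o(1)] A.Comp_Hom[OF Gf kD(1)[OF o(2) o(2)]]] by metis
  qed
  then have "\<forall>f\<in>Arr C. \<exists>u. u \<in> Hom A (Cod A (k (Dom C f))) (Cod A (k (Cod C f))) \<and>
      Comp A u (k (Dom C f)) = Comp A (k (Cod C f)) (onar G f)"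
    by (simp add: Hom_def)
  then obtain u where u: "\<forall>f\<in>Arr C. u f \<in> Hom A (Cod A (k (Dom C f))) (Cod A (k (Cod C f))) \<and>
      Comp A (u f) (k (Dom C f)) = Comp A (k (Cod C f)) (onar G f)"
    by metis
  have u1: "u f \<in> Hom A (Cod A (k x)) (Cod A (k y))" and u2: "Comp A (u f) (k x) = Comp A (k y) (onar G f)"
    if "f \<in> Hom C x y" for f x y
    using u HomD[OF that] by auto
  define K where "K = \<lparr>onob = (\<lambda>x\<in>Obj C. Cod A (k x)), onar = (\<lambda>f\<in>Arr C. u f)\<rparr>"
  have K: "is_functor C A K"
    unfolding K_def
  proof (rule mk_functor[OF C.cat A.cat])
    fix x assume x: "x \<in> Obj C"
    note i = C.Ident_Hom[OF x]
    show "u (Ident C x) = Ident A (Cod A (k x))"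
      by (rule A.epi_cancel[OF kD(3)[OF x x] kD(1)[OF x x] u1[OF i] A.Ident_Hom[OF A.Hom_Obj(2)[OF kD(1)[OF x x]]]])
        (use u2[OF i] functor_Ident[OF T(2) x] A.Comp_Ident[OF kD(1)[OF x x]] in simp)
  next
    fix f g x y z assume f: "f \<in> Hom C x y" and g: "g \<in> Hom C y z"
    note gf = C.Comp_Hom[OF f g]
    note x = C.Hom_Obj(1)[OF f] and y = C.Hom_Obj(1)[OF g] and z = C.Hom_Obj(2)[OF g]
    note Gf = functor_Hom[OF T(2) f] and Gg = functor_Hom[OF T(2) g]
    show "u (Comp C g f) = Comp A (u g) (u f)"
      by (rule A.epi_cancel[OF kD(3)[OF x x] kD(1)[OF x x] u1[OF gf] A.Comp_Hom[OF u1[OF f] u1[OF g]]])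
        (use u2[OF gf] functor_Comp[OF T(2) f g] A.Comp_assoc[OF kD(1)[OF x x] u1[OF f] u1[OF g]] u2[OF f]
          A.Comp_assoc[OF Gf kD(1)[OF y y] u1[OF g]] u2[OF g] A.Comp_assoc[OF Gf Gg kD(1)[OF z z]] in simp)
  qed (use A.Hom_Obj(2)[OF kD(1)] u1 in auto)
  have Kar: "onar K f = u f" if "f \<in> Hom C x y" for f x y
    using HomD(1)[OF that] by (simp add: K_def)
  have "(G, K, \<lambda>x\<in>Obj C. k x) \<in> Hom FC G K"
    by (rule FC_HomI[OF T(2) K]) (use kD(1) u2 Kar in \<open>auto simp: K_def\<close>)
  then show ?thesis
    using cok by (intro exI conjI ballI) auto
qed

lemma FC_short_exactI:
  assumes "f \<in> Hom FC F G" "g \<in> Hom FC G H" "\<And>x. x \<in> Obj C \<Longrightarrow> short_exact A (cmp f x) (cmp g x)"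
  shows "short_exact FC f g"
  using assms FC_kernel[of g G H f F] FC_cokernel[of f F G g H] by (simp add: short_exact_def)

text \<open>A pointwise kernel exists and kernels are unique up to isomorphism, so every kernel in
  the functor category is pointwise; likewise for cokernels.\<close>

lemma FC_short_exactD:
  assumes se: "short_exact FC f g" and x: "x \<in> Obj C"
  shows "short_exact A (cmp f x) (cmp g x)"
proof -
  note S = FC.short_exactD[OF se]
  obtain K k where k: "k \<in> Hom FC K (Cod FC f)" "\<And>x. x \<in> Obj C \<Longrightarrow> is_kernel A (cmp g x) (cmp k x)"
    using pointwise_kernel_ex[OF S(2)] by blast
  obtain u where u: "u \<in> Hom FC (Dom FC f) K" "is_iso FC u" "Comp FC k u = f"
    using FC.kernel_unique[OF _ FC_kernel[OF S(2) k] S(2), of f] se HomD[OF k(1)]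
    by (auto simp: short_exact_def)
  have "is_kernel A (cmp g x) (cmp f x)"
    by (rule A.kernel_iso[OF k(2)[OF x] FC_HomD(5)[OF S(1) x] _ FC_iso_cmp[OF u(1,2) x] _ FC_HomD(5)[OF S(2) x]])
      (use FC_HomD(5)[OF u(1) x] HomD[OF FC_HomD(5)[OF k(1) x]] FC_Comp(2)[OF u(1) k(1) x] u(3) in simp_all)
  moreover
  obtain K' k' where k': "k' \<in> Hom FC (Cod FC f) K'" "\<And>x. x \<in> Obj C \<Longrightarrow> is_cokernel A (cmp f x) (cmp k' x)"
    using pointwise_cokernel_ex[OF S(1)] by blast
  obtain u' where u': "u' \<in> Hom FC K' (Cod FC g)" "is_iso FC u'" "Comp FC u' k' = g"
    using FC.cokernel_unique[OF FC_cokernel[OF S(1) k'] _ S(1), of g] se HomD[OF k'(1)]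
    by (auto simp: short_exact_def)
  have "is_cokernel A (cmp f x) (cmp g x)"
    by (rule A.cokernel_iso[OF k'(2)[OF x] FC_HomD(5)[OF S(2) x] _ FC_iso_cmp[OF u'(1,2) x] _ FC_HomD(5)[OF S(1) x]])
      (use FC_HomD(5)[OF u'(1) x] HomD[OF FC_HomD(5)[OF k'(1) x]] FC_Comp(2)[OF k'(1) u'(1) x] u'(3) in simp_all)
  ultimately show ?thesis
    by (simp add: short_exact_def)
qed

end

sublocale fun_preabelian \<subseteq> FC: preabelian FC
proof
  show "\<exists>k. is_kernel FC f k" "\<exists>c. is_cokernel FC f c" if "f \<in> Arr FC" for f
    using pointwise_kernel_ex[OF FC_Arr[OF that]] pointwise_cokernel_ex[OF FC_Arr[OF that]]
      FC_kernel[OF FC_Arr[OF that]] FC_cokernel[OF FC_Arr[OF that]] by blast+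
  show "\<exists>z. zero_object FC z"
    using A.zero_object_ex FC_zero_object_ex by blast
qed

section \<open>Precomposition and Kan extension along a discrete opfibration\<close>

locale precomp = C: cat C + D: cat D + A: preabelian A
  for C :: "('o, 'a, 'x) category_scheme" and D :: "('p, 'b, 'y) category_scheme"
    and A :: "('q, 'c, 'z) abcat_scheme" and K :: "('o, 'a, 'p, 'b) ftor" +
  assumes K: "is_functor C D K"
begin

sublocale FX: fun_preabelian C A ..
sublocale FY: fun_preabelian D A ..

abbreviation "P \<equiv> precomposition C D A K"

lemma P_ob:
  assumes "is_functor D A F"
  shows "onob P F = comp_functor C F K" "is_functor C A (onob P F)"
    "x \<in> Obj C \<Longrightarrow> onob (onob P F) x = onob F (onob K x)"
    "f \<in> Hom C x y \<Longrightarrow> onar (onob P F) f = onar F (onar K f)"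
proof -
  show e: "onob P F = comp_functor C F K"
    using assms by (simp add: precomposition_def)
  then show "is_functor C A (onob P F)"
    using comp_functor[OF C.cat A.cat K assms] by simp
  show "x \<in> Obj C \<Longrightarrow> onob (onob P F) x = onob F (onob K x)"
    "f \<in> Hom C x y \<Longrightarrow> onar (onob P F) f = onar F (onar K f)"
    using HomD(1)[of f C x y] by (simp_all add: e)
qed

lemma P_ar:
  assumes t: "t \<in> Hom FY.FC F G"
  shows "onar P t \<in> Hom FX.FC (onob P F) (onob P G)"
    "x \<in> Obj C \<Longrightarrow> cmp (onar P t) x = cmp t (onob K x)"
proof -
  note T = FY.FC_HomD[OF t]
  note F = P_ob[OF T(1)] and G = P_ob[OF T(2)]
  have "fst t = F" "fst (snd t) = G"
    using T(3) by (metis fst_conv snd_conv)+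
  then have e: "onar P t = (onob P F, onob P G, \<lambda>x\<in>Obj C. cmp t (onob K x))"
    using HomD(1)[OF t] F(1) G(1) by (simp add: precomposition_def split_beta)
  show "onar P t \<in> Hom FX.FC (onob P F) (onob P G)"
    unfolding e
    by (rule FX.FC_HomI[OF F(2) G(2)])
      (use F(3,4) G(3,4) T(5)[OF functor_Obj[OF K]] T(6)[OF functor_Hom[OF K]] in simp_all)
  show "cmp (onar P t) x = cmp t (onob K x)" if "x \<in> Obj C"
    using that e by simp
qed

lemma P_functor: "is_functor FY.FC FX.FC P"
proof (rule functorI[OF FY.FC_category FX.FC_category])
  fix F assume "F \<in> Obj FY.FC"
  then have F: "is_functor D A F" by simp
  show "onob P F \<in> Obj FX.FC"
    using P_ob(2)[OF F] by simp
  show "onar P (Ident FY.FC F) = Ident FX.FC (onob P F)"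
    by (rule FX.FC_ext[OF P_ar(1)[OF FY.FC_Ident(1)[OF F]] FX.FC_Ident(1)[OF P_ob(2)[OF F]]])
      (use P_ar(2)[OF FY.FC_Ident(1)[OF F]] FY.FC_Ident(2)[OF F functor_Obj[OF K]]
        FX.FC_Ident(2)[OF P_ob(2)[OF F]] P_ob(3)[OF F] in simp)
next
  fix f g F G H assume f: "f \<in> Hom FY.FC F G" and g: "g \<in> Hom FY.FC G H"
  show "onar P (Comp FY.FC g f) = Comp FX.FC (onar P g) (onar P f)"
    by (rule FX.FC_ext[OF P_ar(1)[OF FY.FC_Comp(1)[OF f g]] FX.FC_Comp(1)[OF P_ar(1)[OF f] P_ar(1)[OF g]]])
      (use P_ar(2)[OF FY.FC_Comp(1)[OF f g]] FY.FC_Comp(2)[OF f g functor_Obj[OF K]] P_ar(2)[OF f] P_ar(2)[OF g]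
        FX.FC_Comp(2)[OF P_ar(1)[OF f] P_ar(1)[OF g]] in simp)
next
  show "onob P \<in> extensional (Obj FY.FC)" "onar P \<in> extensional (Arr FY.FC)"
    by (simp_all add: precomposition_def)
qed (rule P_ar(1))

text \<open>Exactness is pointwise on both sides, and the component of \<open>onar P t\<close> at x
  is the component of \<open>t\<close> at \<open>onob K x\<close>.\<close>

lemma P_short_exact:
  assumes "short_exact FY.FC f g"
  shows "short_exact FX.FC (onar P f) (onar P g)"
proof -
  note S = FY.FC.short_exactD[OF assms]
  show ?thesis
    by (rule FX.FC_short_exactI[OF P_ar(1)[OF S(1)] P_ar(1)[OF S(2)]])
      (use P_ar(2)[OF S(1)] P_ar(2)[OF S(2)] FY.FC_short_exactD[OF assms functor_Obj[OF K]] in simp)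
qed

end

text \<open>Natural systems live on the opposite of the simplex category, so the lifting property is
  stated with a prescribed source. \<open>code\<close> embeds each single fibre in
  \<open>'u\<close>, which is what makes the coproduct over that fibre small.\<close>

locale discrete_opfibration = cocomp A U + precomp C D A K
  for A :: "('q, 'c) abcat" and U :: "'u itself" and C :: "('o, 'a, 'x) category_scheme"
    and D :: "('p, 'b, 'y) category_scheme" and K :: "('o, 'a, 'p, 'b) ftor" +
  fixes code :: "'o \<Rightarrow> 'u"
  assumes lift: "c \<in> Obj C \<Longrightarrow> g \<in> Hom D (onob K c) d \<Longrightarrow> \<exists>!f. f \<in> Arr C \<and> Dom C f = c \<and> onar K f = g"
    and code: "inj_on code {c \<in> Obj C. onob K c = d}"
begin

abbreviation fibre :: "'p \<Rightarrow> 'o set" where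
  "fibre d \<equiv> {c \<in> Obj C. onob K c = d}"

definition lift_arr :: "'o \<Rightarrow> 'b \<Rightarrow> 'a" where
  "lift_arr c g = (THE f. f \<in> Arr C \<and> Dom C f = c \<and> onar K f = g)"

definition lift_cod :: "'o \<Rightarrow> 'b \<Rightarrow> 'o" where
  "lift_cod c g = Cod C (lift_arr c g)"

lemma lift_arr:
  assumes "c \<in> fibre d" "g \<in> Hom D d d'"
  shows "lift_arr c g \<in> Hom C c (lift_cod c g)" "onar K (lift_arr c g) = g" "lift_cod c g \<in> fibre d'"
proof -
  have l: "lift_arr c g \<in> Arr C \<and> Dom C (lift_arr c g) = c \<and> onar K (lift_arr c g) = g"
    unfolding lift_arr_def by (rule theI') (use lift[of c g d'] assms in auto)
  then show h: "lift_arr c g \<in> Hom C c (lift_cod c g)" "onar K (lift_arr c g) = g"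
    by (auto simp: Hom_def lift_cod_def)
  show "lift_cod c g \<in> fibre d'"
    using functor_Hom[OF K h(1)] h(2) assms(2) C.Hom_Obj[OF h(1)] by (auto simp: Hom_def)
qed

text \<open>Uniqueness of lifts: every arrow of \<open>C\<close> is the chosen lift of its own
  image.\<close>

lemma lift_arr_eqI:
  assumes "f \<in> Hom C c c'"
  shows "lift_arr c (onar K f) = f" "lift_cod c (onar K f) = c'"
proof -
  have "\<exists>!h. h \<in> Arr C \<and> Dom C h = c \<and> onar K h = onar K f"
    using lift[OF C.Hom_Obj(1)[OF assms] functor_Hom[OF K assms]] .
  then show "lift_arr c (onar K f) = f"
    unfolding lift_arr_def by (rule the1_equality) (use HomD[OF assms] in simp)
  then show "lift_cod c (onar K f) = c'"
    using HomD[OF assms] by (simp add: lift_cod_def)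
qed

lemma fibre_coprod:
  assumes "is_functor C A T"
  shows "\<exists>c \<iota>. is_coproduct A (fibre d) (onob T) c \<iota>"
  by (rule coproduct_ex[OF code]) (use functor_Obj[OF assms] in simp)

text \<open>The general formula takes a colimit over pairs of an object c and an arrow from
  \<open>onob K c\<close> to d. Lifting that arrow moves c to a unique object of the fibre over d,
  so the discrete fibre is cofinal and the colimit becomes a coproduct. The proof verifies the
  universal property directly.\<close>

lemma fibrewise_coproduct_universal:
  assumes T: "is_functor C A T"
  shows "\<exists>L \<eta>. is_functor D A L \<and> \<eta> \<in> Hom FX.FC T (onob P L) \<and>
    (\<forall>d\<in>Obj D. is_coproduct A (fibre d) (onob T) (onob L d) (cmp \<eta>)) \<and>
    (\<forall>G\<in>Obj FY.FC. \<forall>h\<in>Hom FX.FC T (onob P G). \<exists>!k. k \<in> Hom FY.FC L G \<and> Comp FX.FC (onar P k) \<eta> = h)"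
proof -
  define l where "l d = coprod A (fibre d) (onob T)" for d
  define \<iota> where "\<iota> d = coprod_inj A (fibre d) (onob T)" for d
  note cp = coprod[OF fibre_coprod[OF T], folded l_def \<iota>_def]
  note l_Obj = coproductD(1)[OF cp] and \<iota>_Hom = coproductD(2)[OF cp]
  \<comment> \<open>The summand of c is sent to the summand at the end of the lift of
    \<open>g\<close>, through the action of \<open>T\<close> on that lift.\<close>
  define a where "a g = cotuple A (fibre (Dom D g)) (onob T) (l (Cod D g))
      (\<lambda>c. Comp A (\<iota> (Cod D g) (lift_cod c g)) (onar T (lift_arr c g)))" for g
  have a1: "a g \<in> Hom A (l d) (l d')"
    and a2: "\<And>c. c \<in> fibre d \<Longrightarrow>
        Comp A (a g) (\<iota> d c) = Comp A (\<iota> d' (lift_cod c g)) (onar T (lift_arr c g))"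
    if g: "g \<in> Hom D d d'" for g d d'
  proof -
    have h: "Comp A (\<iota> d' (lift_cod c g)) (onar T (lift_arr c g)) \<in> Hom A (onob T c) (l d')"
      if "c \<in> fibre d" for c
      using Comp_Hom[OF functor_Hom[OF T lift_arr(1)[OF that g]] \<iota>_Hom[OF lift_arr(3)[OF that g]]] .
    note ct = cotuple[OF fibre_coprod[OF T] l_Obj h]
    show "a g \<in> Hom A (l d) (l d')"
      using ct(1) by (simp add: a_def HomD[OF g] l_def)
    show "Comp A (a g) (\<iota> d c) = Comp A (\<iota> d' (lift_cod c g)) (onar T (lift_arr c g))"
      if "c \<in> fibre d" for c
      using ct(2)[OF _ that] by (simp add: a_def HomD[OF g] l_def \<iota>_def)
  qed
  define L where "L = \<lparr>onob = (\<lambda>d\<in>Obj D. l d), onar = (\<lambda>g\<in>Arr D. a g)\<rparr>"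
  have L: "is_functor D A L"
    unfolding L_def
  proof (rule mk_functor[OF D.cat cat])
    show "l d \<in> Obj A" for d by (rule l_Obj)
    show "a g \<in> Hom A (l d) (l d')" if "g \<in> Hom D d d'" for g d d'
      by (rule a1[OF that])
    fix d assume d: "d \<in> Obj D"
    note i = D.Ident_Hom[OF d]
    show "a (Ident D d) = Ident A (l d)"
    proof (rule coproduct_ext[OF cp a1[OF i] Ident_Hom[OF l_Obj]])
      fix c assume c: "c \<in> fibre d"
      have "lift_arr c (Ident D d) = Ident C c" "lift_cod c (Ident D d) = c"
        using lift_arr_eqI[OF C.Ident_Hom, of c] functor_Ident[OF K, of c] c by auto
      then show "Comp A (a (Ident D d)) (\<iota> d c) = Comp A (Ident A (l d)) (\<iota> d c)"
        using a2[OF i c] functor_Ident[OF T, of c] Comp_Ident[OF \<iota>_Hom[OF c]] c by simp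
    qed
  next
    fix f g x y z assume f: "f \<in> Hom D x y" and g: "g \<in> Hom D y z"
    note gf = D.Comp_Hom[OF f g]
    show "a (Comp D g f) = Comp A (a g) (a f)"
    proof (rule coproduct_ext[OF cp a1[OF gf] Comp_Hom[OF a1[OF f] a1[OF g]]])
      fix c assume c: "c \<in> fibre x"
      note lf = lift_arr[OF c f]
      note lg = lift_arr[OF lf(3) g]
      let ?lf = "lift_arr c f" and ?lg = "lift_arr (lift_cod c f) g"
      \<comment> \<open>The composite of the two lifts lies over the composite arrow, so by
        uniqueness it is the lift of that composite. This makes \<open>a\<close> functorial.\<close>
      have "onar K (Comp C ?lg ?lf) = Comp D g f"
        using functor_Comp[OF K lf(1) lg(1)] lf(2) lg(2) by simp
      then have e: "lift_arr c (Comp D g f) = Comp C ?lg ?lf"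
        "lift_cod c (Comp D g f) = lift_cod (lift_cod c f) g"
        using lift_arr_eqI[OF C.Comp_Hom[OF lf(1) lg(1)]] by simp_all
      note Tf = functor_Hom[OF T lf(1)] and Tg = functor_Hom[OF T lg(1)]
      have "Comp A (Comp A (a g) (a f)) (\<iota> x c) = Comp A (Comp A (a g) (\<iota> y (lift_cod c f))) (onar T ?lf)"
        using Comp_assoc[OF \<iota>_Hom[OF c] a1[OF f] a1[OF g]] a2[OF f c]
          Comp_assoc[OF Tf \<iota>_Hom[OF lf(3)] a1[OF g]] by simp
      also have "\<dots> = Comp A (a (Comp D g f)) (\<iota> x c)"
        using a2[OF g lf(3)] a2[OF gf c] Comp_assoc[OF Tf Tg \<iota>_Hom[OF lg(3)]] e
          functor_Comp[OF T lf(1) lg(1)] by simp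
      finally show "Comp A (a (Comp D g f)) (\<iota> x c) = Comp A (Comp A (a g) (a f)) (\<iota> x c)"
        by simp
    qed
  qed
  have Ld: "onob L d = l d" if "d \<in> Obj D" for d
    using that by (simp add: L_def)
  have Lg: "onar L g = a g" if "g \<in> Hom D d d'" for g d d'
    using HomD(1)[OF that] by (simp add: L_def)
  note PL = P_ob[OF L]
  let ?\<eta> = "(T, onob P L, \<lambda>c\<in>Obj C. \<iota> (onob K c) c)"
  have \<iota>_Hom': "\<iota> (onob K c) c \<in> Hom A (onob T c) (l (onob K c))" if "c \<in> Obj C" for c
    by (rule \<iota>_Hom) (use that in simp)
  have \<eta>: "?\<eta> \<in> Hom FX.FC T (onob P L)"
  proof (rule FX.FC_HomI[OF T PL(2)])
    show "\<iota> (onob K c) c \<in> Hom A (onob T c) (onob (onob P L) c)" if "c \<in> Obj C" for c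
      using \<iota>_Hom'[OF that] PL(3)[OF that] Ld[OF functor_Obj[OF K that]] by simp
    show "Comp A (onar (onob P L) f) (\<iota> (onob K c) c) = Comp A (\<iota> (onob K c') c') (onar T f)"
      if f: "f \<in> Hom C c c'" for f c c'
      using PL(4)[OF f] Lg[OF functor_Hom[OF K f]] a2[OF functor_Hom[OF K f], of c] C.Hom_Obj[OF f]
        lift_arr_eqI[OF f] by simp
  qed
  \<comment> \<open>The injections may be read off the single family \<open>cmp ?\<eta>\<close>,
    which does not mention d: on the fibre over d it coincides with
    \<open>\<iota> d\<close>.\<close>
  have cop: "is_coproduct A (fibre d) (onob T) (onob L d) (cmp ?\<eta>)" if d: "d \<in> Obj D" for d
    unfolding Ld[OF d]
    by (rule coproduct_reindex[OF cp, of "\<lambda>x. x" _ d]) (auto simp: bij_betw_def)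
  have "\<exists>!k. k \<in> Hom FY.FC L G \<and> Comp FX.FC (onar P k) ?\<eta> = h"
    if "G \<in> Obj FY.FC" and h: "h \<in> Hom FX.FC T (onob P G)" for G h
  proof -
    have G: "is_functor D A G" using that(1) by simp
    note PG = P_ob[OF G] and H = FX.FC_HomD[OF h]
    have hc: "cmp h c \<in> Hom A (onob T c) (onob G d)" if "c \<in> fibre d" for c d
      using H(5)[of c] PG(3)[of c] that by simp
    have "\<forall>d\<in>Obj D. \<exists>u. u \<in> Hom A (l d) (onob G d) \<and> (\<forall>c\<in>fibre d. Comp A u (\<iota> d c) = cmp h c)"
    proof
      fix d assume d: "d \<in> Obj D"
      show "\<exists>u. u \<in> Hom A (l d) (onob G d) \<and> (\<forall>c\<in>fibre d. Comp A u (\<iota> d c) = cmp h c)"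
        by (rule coproduct_univ[OF cp[of d] functor_Obj[OF G d], of "cmp h"]) (use hc in auto)
    qed
    from bchoice[OF this] obtain u where
      u': "\<forall>d\<in>Obj D. u d \<in> Hom A (l d) (onob G d) \<and> (\<forall>c\<in>fibre d. Comp A (u d) (\<iota> d c) = cmp h c)" ..
    then have u: "\<And>d. d \<in> Obj D \<Longrightarrow> u d \<in> Hom A (l d) (onob G d)"
      "\<And>d c. d \<in> Obj D \<Longrightarrow> c \<in> fibre d \<Longrightarrow> Comp A (u d) (\<iota> d c) = cmp h c"
      by blast+
    let ?k = "(L, G, \<lambda>d\<in>Obj D. u d)"
    have k: "?k \<in> Hom FY.FC L G"
    proof (rule FY.FC_HomI[OF L G])
      show "u d \<in> Hom A (onob L d) (onob G d)" if "d \<in> Obj D" for d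
        using u(1)[OF that] Ld[OF that] by simp
      fix g d d' assume g: "g \<in> Hom D d d'"
      note o = D.Hom_Obj[OF g]
      note Gg = functor_Hom[OF G g]
      have "Comp A (onar G g) (u d) = Comp A (u d') (a g)"
      proof (rule coproduct_ext[OF cp Comp_Hom[OF u(1)[OF o(1)] Gg] Comp_Hom[OF a1[OF g] u(1)[OF o(2)]]])
        fix c assume c: "c \<in> fibre d"
        note lc = lift_arr[OF c g]
        have "Comp A (Comp A (onar G g) (u d)) (\<iota> d c) = Comp A (onar G (onar K (lift_arr c g))) (cmp h c)"
          using Comp_assoc[OF \<iota>_Hom[OF c] u(1)[OF o(1)] Gg] u(2)[OF o(1) c] lc(2) by simp
        also have "\<dots> = Comp A (cmp h (lift_cod c g)) (onar T (lift_arr c g))"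
          using H(6)[OF lc(1)] PG(4)[OF lc(1)] by simp
        also have "\<dots> = Comp A (Comp A (u d') (a g)) (\<iota> d c)"
          using Comp_assoc[OF \<iota>_Hom[OF c] a1[OF g] u(1)[OF o(2)]] a2[OF g c] u(2)[OF o(2) lc(3)]
            Comp_assoc[OF functor_Hom[OF T lc(1)] \<iota>_Hom[OF lc(3)] u(1)[OF o(2)]] by simp
        finally show "Comp A (Comp A (onar G g) (u d)) (\<iota> d c) = Comp A (Comp A (u d') (a g)) (\<iota> d c)" .
      qed
      then show "Comp A (onar G g) (u d) = Comp A (u d') (onar L g)"
        using Lg[OF g] by simp
    qed
    have "Comp FX.FC (onar P ?k) ?\<eta> = h"
    proof (rule FX.FC_ext[OF FX.FC_Comp(1)[OF \<eta> P_ar(1)[OF k]] h])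
      fix c assume c: "c \<in> Obj C"
      show "cmp (Comp FX.FC (onar P ?k) ?\<eta>) c = cmp h c"
        using FX.FC_Comp(2)[OF \<eta> P_ar(1)[OF k] c] P_ar(2)[OF k c] functor_Obj[OF K c]
          u(2)[of "onob K c" c] c by simp
    qed
    moreover have "k' = ?k" if k': "k' \<in> Hom FY.FC L G" and e: "Comp FX.FC (onar P k') ?\<eta> = h" for k'
    proof (rule FY.FC_ext[OF k' k])
      fix d assume d: "d \<in> Obj D"
      show "cmp k' d = cmp ?k d"
      proof (rule coproduct_ext[OF cop[OF d] FY.FC_HomD(5)[OF k' d] FY.FC_HomD(5)[OF k d]])
        fix c assume c: "c \<in> fibre d"
        then have cC: "c \<in> Obj C" by simp
        show "Comp A (cmp k' d) (cmp ?\<eta> c) = Comp A (cmp ?k d) (cmp ?\<eta> c)"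
          using FX.FC_Comp(2)[OF \<eta> P_ar(1)[OF k'] cC] P_ar(2)[OF k' cC] e u(2)[OF d c] c d by simp
      qed
    qed
    ultimately show ?thesis
      using k by blast
  qed
  then show ?thesis
    using L \<eta> cop by blast
qed

lemma left_adjoint_ex: "\<exists>F \<eta>. left_adjoint_unit FX.FC FY.FC P F \<eta>"
proof (rule left_adjoint_of_universal_arrows[OF FX.FC_category FY.FC_category P_functor])
  fix T assume "T \<in> Obj FX.FC"
  then have "is_functor C A T" by simp
  from fibrewise_coproduct_universal[OF this]
  show "\<exists>L\<in>Obj FY.FC. \<exists>\<eta>\<in>Hom FX.FC T (onob P L). \<forall>G\<in>Obj FY.FC. \<forall>h\<in>Hom FX.FC T (onob P G).
      \<exists>!k. k \<in> Hom FY.FC L G \<and> Comp FX.FC (onar P k) \<eta> = h"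
    by auto
qed

end

text \<open>Works with an arbitrary left adjoint of the pullback, since the selected
  \<open>Lan\<close> is known by its adjunction alone.\<close>

locale opfibration_adjoint = discrete_opfibration A U C D K code
  for A :: "('q, 'c) abcat" and U :: "'u itself" and C :: "('o, 'a, 'x) category_scheme"
    and D :: "('p, 'b, 'y) category_scheme" and K :: "('o, 'a, 'p, 'b) ftor" and code :: "'o \<Rightarrow> 'u" +
  fixes F :: "(('o, 'a, 'q, 'c) ftor, ('o, 'a, 'q, 'c) ntrans, ('p, 'b, 'q, 'c) ftor, ('p, 'b, 'q, 'c) ntrans) ftor"
    and \<eta> :: "('o, 'a, 'q, 'c) ftor \<Rightarrow> ('o, 'a, 'q, 'c) ntrans"
  assumes adj: "left_adjoint_unit FX.FC FY.FC P F \<eta>"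
begin

lemma F_functor: "is_functor FX.FC FY.FC F"
  using adj by (simp add: left_adjoint_unit_def)

lemma F_ob:
  assumes "is_functor C A T"
  shows "is_functor D A (onob F T)" "\<eta> T \<in> Hom FX.FC T (onob P (onob F T))"
  using adj functor_Obj[OF F_functor, of T] assms by (simp_all add: left_adjoint_unit_def)

lemma F_ar: "t \<in> Hom FX.FC T T' \<Longrightarrow> onar F t \<in> Hom FY.FC (onob F T) (onob F T')"
  by (rule functor_Hom[OF F_functor])

lemma unit_natural:
  "t \<in> Hom FX.FC T T' \<Longrightarrow> Comp FX.FC (onar P (onar F t)) (\<eta> T) = Comp FX.FC (\<eta> T') t"
  using adj by (auto simp: left_adjoint_unit_def Hom_def)

lemma unit_universal:
  assumes "is_functor C A T" "is_functor D A G" "h \<in> Hom FX.FC T (onob P G)"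
  shows "\<exists>!k. k \<in> Hom FY.FC (onob F T) G \<and> Comp FX.FC (onar P k) (\<eta> T) = h"
  using adj assms by (simp add: left_adjoint_unit_def)

text \<open>The model and \<open>F\<close> solve the same universal problem, so they are isomorphic
  compatibly with the units. A coproduct may be transported along an isomorphism.\<close>

lemma F_coproduct:
  assumes T: "is_functor C A T" and d: "d \<in> Obj D"
  shows "is_coproduct A (fibre d) (onob T) (onob (onob F T) d) (cmp (\<eta> T))"
proof -
  obtain L \<gamma> where L: "is_functor D A L" and \<gamma>: "\<gamma> \<in> Hom FX.FC T (onob P L)"
    and cop: "is_coproduct A (fibre d) (onob T) (onob L d) (cmp \<gamma>)"
    and univ: "\<And>G h. is_functor D A G \<Longrightarrow> h \<in> Hom FX.FC T (onob P G) \<Longrightarrow>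
      \<exists>!k. k \<in> Hom FY.FC L G \<and> Comp FX.FC (onar P k) \<gamma> = h"
    using fibrewise_coproduct_universal[OF T] d by auto
  let ?M = "onob F T"
  note M = F_ob[OF T]
  note P_comp = functor_Comp[OF P_functor]
  obtain u where u: "u \<in> Hom FY.FC L ?M" "Comp FX.FC (onar P u) \<gamma> = \<eta> T"
    using univ[OF M] by blast
  obtain v where v: "v \<in> Hom FY.FC ?M L" "Comp FX.FC (onar P v) (\<eta> T) = \<gamma>"
    using unit_universal[OF T L \<gamma>] by blast
  have "Comp FX.FC (onar P (Comp FY.FC v u)) \<gamma> = \<gamma>"
    using P_comp[OF u(1) v(1)] FX.FC.Comp_assoc[OF \<gamma> P_ar(1)[OF u(1)] P_ar(1)[OF v(1)]] u(2) v(2) by simp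
  moreover have "Comp FX.FC (onar P (Ident FY.FC L)) \<gamma> = \<gamma>"
    using functor_Ident[OF P_functor, of L] L FX.FC.Comp_Ident(2)[OF \<gamma>] by simp
  ultimately have vu: "Comp FY.FC v u = Ident FY.FC L"
    using univ[OF L \<gamma>] FY.FC_Comp(1)[OF u(1) v(1)] FY.FC_Ident(1)[OF L] by metis
  have "Comp FX.FC (onar P (Comp FY.FC u v)) (\<eta> T) = \<eta> T"
    using P_comp[OF v(1) u(1)] FX.FC.Comp_assoc[OF M(2) P_ar(1)[OF v(1)] P_ar(1)[OF u(1)]] u(2) v(2) by simp
  moreover have "Comp FX.FC (onar P (Ident FY.FC ?M)) (\<eta> T) = \<eta> T"
    using functor_Ident[OF P_functor, of ?M] M FX.FC.Comp_Ident(2)[OF M(2)] by simp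
  ultimately have uv: "Comp FY.FC u v = Ident FY.FC ?M"
    using unit_universal[OF T M] FY.FC_Comp(1)[OF v(1) u(1)] FY.FC_Ident(1)[OF M(1)] by metis
  have "is_iso FY.FC u"
    by (rule FY.FC.isoI[OF u(1) v(1) vu uv])
  then have "is_iso A (cmp u d)"
    using FY.FC_iso_cmp[OF u(1) _ d] by blast
  then show ?thesis
  proof (rule coproduct_iso[OF cop FY.FC_HomD(5)[OF u(1) d]])
    fix c assume c: "c \<in> fibre d"
    then have cC: "c \<in> Obj C" by simp
    show "Comp A (cmp u d) (cmp \<gamma> c) = cmp (\<eta> T) c"
      using FX.FC_Comp(2)[OF \<gamma> P_ar(1)[OF u(1)] cC] u(2) P_ar(2)[OF u(1) cC] c by simp
  qed
qed

text \<open>Naturality of the unit, read at one object of the fibre: on the summand of c, the arrow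
  \<open>onar F t\<close> acts as \<open>cmp t c\<close>.\<close>

lemma F_cmp_unit:
  assumes t: "t \<in> Hom FX.FC T T'" and c: "c \<in> fibre d"
  shows "Comp A (cmp (onar F t) d) (cmp (\<eta> T) c) = Comp A (cmp (\<eta> T') c) (cmp t c)"
proof -
  have T: "is_functor C A T" and T': "is_functor C A T'" and cC: "c \<in> Obj C"
    using FX.FC_HomD[OF t] c by simp_all
  show ?thesis
    using FX.FC_Comp(2)[OF F_ob(2)[OF T] P_ar(1)[OF F_ar[OF t]] cC] unit_natural[OF t]
      FX.FC_Comp(2)[OF t F_ob(2)[OF T'] cC] P_ar(2)[OF F_ar[OF t] cC] c by simp
qed

text \<open>Arrows out of a coproduct are compared on its summands, where \<open>F_cmp_unit\<close>
  reduces the claim to bilinearity of composition.\<close>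

lemma F_additive: "additive_functor FX.FC FY.FC F"
  unfolding additive_functor_def
proof (intro conjI ballI F_functor)
  fix T T' s t assume s: "s \<in> Hom FX.FC T T'" and t: "t \<in> Hom FX.FC T T'"
  have T: "is_functor C A T" and T': "is_functor C A T'"
    using FX.FC_HomD[OF t] by simp_all
  note st = FX.FC_Add[OF s t]
  note Fst = FY.FC_Add[OF F_ar[OF s] F_ar[OF t]]
  show "onar F (Add FX.FC s t) = Add FY.FC (onar F s) (onar F t)"
  proof (rule FY.FC_ext[OF F_ar[OF st(1)] Fst(1)])
    fix d assume d: "d \<in> Obj D"
    show "cmp (onar F (Add FX.FC s t)) d = cmp (Add FY.FC (onar F s) (onar F t)) d"
    proof (rule coproduct_ext[OF F_coproduct[OF T d] FY.FC_HomD(5)[OF F_ar[OF st(1)] d]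
          FY.FC_HomD(5)[OF Fst(1) d]])
      fix c assume c: "c \<in> fibre d"
      then have cC: "c \<in> Obj C" by simp
      note \<eta>c = coproductD(2)[OF F_coproduct[OF T d] c] and \<eta>c' = coproductD(2)[OF F_coproduct[OF T' d] c]
      show "Comp A (cmp (onar F (Add FX.FC s t)) d) (cmp (\<eta> T) c) =
          Comp A (cmp (Add FY.FC (onar F s) (onar F t)) d) (cmp (\<eta> T) c)"
        using F_cmp_unit[OF st(1) c] st(2)[OF cC] Fst(2)[OF d] F_cmp_unit[OF s c] F_cmp_unit[OF t c]
          Comp_Add(1)[OF FX.FC_HomD(5)[OF s cC] FX.FC_HomD(5)[OF t cC] \<eta>c' \<eta>c']
          Comp_Add(2)[OF \<eta>c \<eta>c FY.FC_HomD(5)[OF F_ar[OF s] d] FY.FC_HomD(5)[OF F_ar[OF t] d]] by simp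
    qed
  qed
qed

text \<open>At each object of \<open>D\<close> the image sequence is the coproduct, over the fibre,
  of the given sequence evaluated at its objects; exactness of coproducts applies.\<close>

lemma F_exact:
  assumes "short_exact FX.FC f g"
  shows "short_exact FY.FC (onar F f) (onar F g)"
proof -
  note S = FX.FC.short_exactD[OF assms]
  have T: "is_functor C A (Dom FX.FC f)" "is_functor C A (Cod FX.FC f)" "is_functor C A (Cod FX.FC g)"
    using FX.FC_HomD[OF S(1)] FX.FC_HomD[OF S(2)] by simp_all
  show ?thesis
  proof (rule FY.FC_short_exactI[OF F_ar[OF S(1)] F_ar[OF S(2)]])
    fix d assume d: "d \<in> Obj D"
    show "short_exact A (cmp (onar F f) d) (cmp (onar F g) d)"
      by (rule short_exact_coproduct[OF code _ _ _ F_coproduct[OF T(1) d] F_coproduct[OF T(2) d]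
            F_coproduct[OF T(3) d] FY.FC_HomD(5)[OF F_ar[OF S(1)] d] F_cmp_unit[OF S(1)]
            FY.FC_HomD(5)[OF F_ar[OF S(2)] d] F_cmp_unit[OF S(2)]])
        (use FX.FC_short_exactD[OF assms] FX.FC_HomD(5)[OF S(1)] FX.FC_HomD(5)[OF S(2)] in simp_all)
  qed
qed

end

section \<open>Satellites of an exact functor\<close>

lemma delta_functorD:
  assumes "delta_functor C D L"
  shows "is_functor C D (comp_at L q)"
    "short_exact C f g \<Longrightarrow> conn L q f g \<in> Hom D (onob (comp_at L (Suc q)) (Cod C g)) (onob (comp_at L q) (Dom C f))"
    "short_exact C f g \<Longrightarrow> exact_at D (conn L q f g) (onar (comp_at L q) f)"
  using assms by (auto simp: delta_functor_def additive_functor_def)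

text \<open>In degree \<open>0\<close> the square with the connecting morphisms commutes because \<open>L\<^sub>0 f\<close> is monic and
  the composite of \<open>S\<^sub>0 f\<close> with the connecting morphism vanishes; in higher degrees both sides of
  the square end in a zero object.\<close>

lemma delta_morphism_into_exact:
  assumes C: "preabelian C" and D: "preabelian D"
    and S: "\<And>q. is_functor C D (comp_at S q)"
    and S_conn: "\<And>q f g. short_exact C f g \<Longrightarrow>
      conn S q f g \<in> Hom D (onob (comp_at S (Suc q)) (Cod C g)) (onob (comp_at S q) (Dom C f))"
    and S_zero: "\<And>f g. short_exact C f g \<Longrightarrow> Comp D (onar (comp_at S 0) f) (conn S 0 f g) =
      Zero D (onob (comp_at S (Suc 0)) (Cod C g)) (onob (comp_at S 0) (Cod C f))"
    and L: "\<And>q. is_functor C D (comp_at L q)"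
    and L_conn: "\<And>q f g. short_exact C f g \<Longrightarrow>
      conn L q f g \<in> Hom D (onob (comp_at L (Suc q)) (Cod C g)) (onob (comp_at L q) (Dom C f))"
    and L_mono: "\<And>f g. short_exact C f g \<Longrightarrow> is_mono D (onar (comp_at L 0) f)"
    and L_zero: "\<And>q c. c \<in> Obj C \<Longrightarrow> zero_object D (onob (comp_at L (Suc q)) c)"
    and \<eta>: "is_nat C D (comp_at S 0) (comp_at L 0) \<eta>"
  shows "\<exists>!\<phi>. delta_morphism C D S L \<phi> \<and> \<phi> 0 = \<eta>"
proof -
  interpret C: preabelian C by (rule C)
  interpret D: preabelian D by (rule D)
  note \<eta>D = is_natD[OF \<eta>]
  have S_Obj: "\<And>q c. c \<in> Obj C \<Longrightarrow> onob (comp_at S q) c \<in> Obj D"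
    and L_Obj: "\<And>q c. c \<in> Obj C \<Longrightarrow> onob (comp_at L q) c \<in> Obj D"
    using functor_Obj[OF S] functor_Obj[OF L] by auto
  define \<phi> where "\<phi> q = (if q = 0 then \<eta> else (\<lambda>c\<in>Obj C. Zero D (onob (comp_at S q) c) (onob (comp_at L q) c)))"
    for q
  have nat: "is_nat C D (comp_at S q) (comp_at L q) (\<phi> q)" for q
  proof (cases q)
    case 0
    then show ?thesis using \<eta> by (simp add: \<phi>_def)
  next
    case (Suc p)
    show ?thesis
    proof (rule is_natI)
      show "\<phi> q \<in> extensional (Obj C)"
        using Suc by (simp add: \<phi>_def)
      show "\<phi> q x \<in> Hom D (onob (comp_at S q) x) (onob (comp_at L q) x)" if "x \<in> Obj C" for x
        using that Suc S_Obj L_Obj by (simp add: \<phi>_def)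
      show "Comp D (onar (comp_at L q) f) (\<phi> q x) = Comp D (\<phi> q y) (onar (comp_at S q) f)"
        if f: "f \<in> Hom C x y" for f x y
        using C.Hom_Obj[OF f] Suc D.Comp_Zero[OF functor_Hom[OF L f] S_Obj]
          D.Zero_Comp[OF functor_Hom[OF S f] L_Obj] by (simp add: \<phi>_def)
    qed
  qed
  note natD = is_natD(2)[OF nat]
  have "delta_morphism C D S L \<phi>"
    unfolding delta_morphism_def
  proof (intro conjI allI impI nat)
    fix f g q assume se: "short_exact C f g"
    note SE = C.short_exactD[OF se]
    have o: "Dom C f \<in> Obj C" "Cod C g \<in> Obj C"
      using C.Hom_Obj[OF SE(1)] C.Hom_Obj[OF SE(2)] by simp_all
    have l: "Comp D (\<phi> q (Dom C f)) (conn S q f g) \<in> Hom D (onob (comp_at S (Suc q)) (Cod C g)) (onob (comp_at L q) (Dom C f))"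
      using D.Comp_Hom[OF S_conn[OF se] natD[OF o(1)]] .
    have r: "Comp D (conn L q f g) (\<phi> (Suc q) (Cod C g)) \<in> Hom D (onob (comp_at S (Suc q)) (Cod C g)) (onob (comp_at L q) (Dom C f))"
      using D.Comp_Hom[OF natD[OF o(2)] L_conn[OF se]] .
    show "Comp D (\<phi> q (Dom C f)) (conn S q f g) = Comp D (conn L q f g) (\<phi> (Suc q) (Cod C g))"
    proof (cases q)
      case 0
      let ?Z = "Zero D (onob (comp_at S (Suc 0)) (Cod C g)) (onob (comp_at L 0) (Dom C f))"
      note Lf = functor_Hom[OF L SE(1), of 0] and Sf = functor_Hom[OF S SE(1), of 0]
      note cS = S_conn[OF se, of 0]
      have oS: "onob (comp_at S (Suc 0)) (Cod C g) \<in> Obj D" and oL: "onob (comp_at L 0) (Cod C f) \<in> Obj D"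
        using S_Obj[OF o(2)] L_Obj C.Hom_Obj[OF SE(1)] by simp_all
      have \<eta>o: "\<eta> (Dom C f) \<in> Hom D (onob (comp_at S 0) (Dom C f)) (onob (comp_at L 0) (Dom C f))"
        "\<eta> (Cod C f) \<in> Hom D (onob (comp_at S 0) (Cod C f)) (onob (comp_at L 0) (Cod C f))"
        using \<eta>D(2) C.Hom_Obj[OF SE(1)] by simp_all
      have "Comp D (onar (comp_at L 0) f) (Comp D (\<eta> (Dom C f)) (conn S 0 f g)) =
          Comp D (\<eta> (Cod C f)) (Comp D (onar (comp_at S 0) f) (conn S 0 f g))"
        using D.Comp_assoc[OF cS \<eta>o(1) Lf] \<eta>D(3)[OF SE(1)] D.Comp_assoc[OF cS Sf \<eta>o(2)] by simp
      also have "\<dots> = Comp D (onar (comp_at L 0) f) ?Z"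
        using S_zero[OF se] D.Comp_Zero[OF \<eta>o(2) oS] D.Comp_Zero[OF Lf oS] by simp
      finally have "Comp D (\<eta> (Dom C f)) (conn S 0 f g) = ?Z"
        by (rule D.mono_cancel[OF L_mono[OF se] Lf D.Comp_Hom[OF cS \<eta>o(1)] D.Zero_Hom[OF oS L_Obj[OF o(1)]]])
      moreover have "Comp D (conn L 0 f g) (\<phi> (Suc 0) (Cod C g)) = ?Z"
        using o D.Comp_Zero[OF L_conn[OF se] oS] by (simp add: \<phi>_def)
      ultimately show ?thesis
        using 0 by (simp add: \<phi>_def)
    next
      case (Suc p)
      then show ?thesis
        using D.zero_object_to[OF L_zero[OF o(1), of p]] l r by blast
    qed
  qed
  \<comment> \<open>In positive degrees every component ends in a zero object, so a morphism is
    determined by its degree 0 part.\<close>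
  moreover have "\<psi> = \<phi>" if \<psi>: "delta_morphism C D S L \<psi>" "\<psi> 0 = \<eta>" for \<psi>
  proof
    fix q
    show "\<psi> q = \<phi> q"
    proof (cases q)
      case 0
      then show ?thesis using \<psi>(2) by (simp add: \<phi>_def)
    next
      case (Suc p)
      have n: "is_nat C D (comp_at S q) (comp_at L q) (\<psi> q)"
        using \<psi>(1) by (simp add: delta_morphism_def)
      show ?thesis
      proof (rule extensionalityI[OF is_natD(1)[OF n] is_natD(1)[OF nat]])
        fix c assume c: "c \<in> Obj C"
        show "\<psi> q c = \<phi> q c"
          using D.zero_object_to[OF L_zero[OF c, of p]] is_natD(2)[OF n c] natD[OF c] Suc by blast
      qed
    qed
  qed
  moreover have "\<phi> 0 = \<eta>"
    by (simp add: \<phi>_def)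
  ultimately show ?thesis
    by blast
qed

locale exact_functor = C: preabelian C + D: preabelian D
  for C :: "('o, 'a, 'y) abcat_scheme" and D :: "('p, 'b, 'z) abcat_scheme"
    and F :: "('o, 'a, 'p, 'b) ftor" +
  assumes additive: "additive_functor C D F"
    and exact: "short_exact C f g \<Longrightarrow> short_exact D (onar F f) (onar F g)"
begin

lemma is_functor_F: "is_functor C D F"
  using additive by (simp add: additive_functor_def)

definition zero_obj :: 'p where
  "zero_obj = (SOME z. zero_object D z)"

lemma zero_obj: "zero_object D zero_obj"
  unfolding zero_obj_def by (rule someI_ex[OF D.zero_object_ex])

definition zero_functor :: "('o, 'a, 'p, 'b) ftor" where
  "zero_functor = \<lparr>onob = (\<lambda>x\<in>Obj C. zero_obj), onar = (\<lambda>f\<in>Arr C. Ident D zero_obj)\<rparr>"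

lemma zero_functor: "additive_functor C D zero_functor"
proof -
  note z = D.zero_object_Obj[OF zero_obj]
  note i = D.Ident_Hom[OF z]
  have "is_functor C D zero_functor"
    unfolding zero_functor_def
    by (rule mk_functor[OF C.cat D.cat]) (use z D.Comp_Ident[OF i] in simp_all)
  moreover have "Add D (Ident D zero_obj) (Ident D zero_obj) = Ident D zero_obj"
    by (rule D.zero_object_to[OF zero_obj D.Add_Hom[OF i i] i])
  ultimately show ?thesis
    using HomD(1) C.Add_Hom unfolding additive_functor_def by (fastforce simp: zero_functor_def)
qed

text \<open>The extension of \<open>F\<close> by zero. An exact functor already gives short exact
  sequences in degree 0, so zero connecting morphisms complete them to long exact ones.\<close>

definition sat :: "('o, 'a, 'p, 'b) dfunctor" where
  "sat = (let L = (\<lambda>q. if q = 0 then F else zero_functor) in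
     \<lparr>comp_at = L, conn = (\<lambda>q f g. Zero D (onob (L (Suc q)) (Cod C g)) (onob (L q) (Dom C f)))\<rparr>)"

lemma sat_simps:
  "comp_at sat 0 = F" "comp_at sat (Suc q) = zero_functor"
  "conn sat q f g = Zero D (onob (comp_at sat (Suc q)) (Cod C g)) (onob (comp_at sat q) (Dom C f))"
  by (simp_all add: sat_def Let_def)

lemma sat_additive: "additive_functor C D (comp_at sat q)"
  using additive zero_functor by (cases q) (simp_all add: sat_simps)

lemma sat_functor: "is_functor C D (comp_at sat q)"
  using sat_additive by (simp add: additive_functor_def)

lemma sat_zero: "c \<in> Obj C \<Longrightarrow> zero_object D (onob (comp_at sat (Suc q)) c)"
  using zero_obj by (simp add: sat_simps zero_functor_def)

lemma sat_conn:
  assumes "short_exact C f g"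
  shows "conn sat q f g \<in> Hom D (onob (comp_at sat (Suc q)) (Cod C g)) (onob (comp_at sat q) (Dom C f))"
proof -
  note S = C.short_exactD[OF assms]
  show ?thesis
    unfolding sat_simps(3)
    by (rule D.Zero_Hom) (use functor_Obj[OF sat_functor] C.Hom_Obj[OF S(1)] C.Hom_Obj[OF S(2)] in simp_all)
qed

lemma sat_delta_functor: "delta_functor C D sat"
  unfolding delta_functor_def
proof (intro conjI allI impI sat_additive)
  fix f g assume se: "short_exact C f g"
  note S = C.short_exactD[OF se]
  note o = C.Hom_Obj[OF S(1)] C.Hom_Obj[OF S(2)]
  note H = functor_Hom[OF sat_functor S(1)] functor_Hom[OF sat_functor S(2)]
  show "is_epi D (onar (comp_at sat 0) g)"
    using D.short_exactD(6)[OF exact[OF se]] by (simp add: sat_simps)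
  fix q
  show "conn sat q f g \<in> Hom D (onob (comp_at sat (Suc q)) (Cod C g)) (onob (comp_at sat q) (Dom C f))"
    by (rule sat_conn[OF se])
  show "exact_at D (onar (comp_at sat q) f) (onar (comp_at sat q) g)"
  proof (cases q)
    case 0
    then show ?thesis using D.exact_at_short_exact[OF exact[OF se]] by (simp add: sat_simps)
  next
    case (Suc p)
    show ?thesis by (rule D.exact_at_zero[OF H]) (use sat_zero[OF o(2)] Suc in simp)
  qed
  show "exact_at D (onar (comp_at sat (Suc q)) g) (conn sat q f g)"
    by (rule D.exact_at_zero[OF H(2) sat_conn[OF se] sat_zero[OF o(4)]])
  show "exact_at D (conn sat q f g) (onar (comp_at sat q) f)"
  proof (cases q)
    case 0
    \<comment> \<open>Exactness behind a zero connecting morphism amounts to monicity of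
      \<open>onar F f\<close>, which exactness of \<open>F\<close> provides.\<close>
    have "is_mono D (onar (comp_at sat 0) f)"
      using D.short_exactD(5)[OF exact[OF se]] by (simp add: sat_simps)
    then show ?thesis
      unfolding 0 sat_simps(3)
      using D.exact_at_mono[OF functor_Obj[OF sat_functor o(4)] H(1)] by blast
  next
    case (Suc p)
    show ?thesis by (rule D.exact_at_zero[OF sat_conn[OF se] H(1)]) (use sat_zero[OF o(1)] Suc in simp)
  qed
next
  fix f g f' g' u v w q
  assume a: "short_exact C f g \<and> short_exact C f' g' \<and>
    u \<in> Hom C (Dom C f) (Dom C f') \<and> v \<in> Hom C (Cod C f) (Cod C f') \<and> w \<in> Hom C (Cod C g) (Cod C g') \<and>
    Comp C v f = Comp C f' u \<and> Comp C w g = Comp C g' v"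
  then have u: "u \<in> Hom C (Dom C f) (Dom C f')" and w: "w \<in> Hom C (Cod C g) (Cod C g')"
    and se: "short_exact C f g" "short_exact C f' g'" by blast+
  show "Comp D (onar (comp_at sat q) u) (conn sat q f g) =
      Comp D (conn sat q f' g') (onar (comp_at sat (Suc q)) w)"
    by (rule D.zero_object_from[OF sat_zero[OF C.Hom_Obj(1)[OF w]]
          D.Comp_Hom[OF sat_conn[OF se(1)] functor_Hom[OF sat_functor u]]
          D.Comp_Hom[OF functor_Hom[OF sat_functor w] sat_conn[OF se(2)]]])
qed

text \<open>The target vanishes in positive degrees and is exact in degree 0, so
  \<open>delta_morphism_into_exact\<close> gives universality. The existence of satellites obtained
  here justifies the choice made in \<open>Lan_sat\<close>.\<close>

lemma sat_left_satellites: "left_satellites C D F sat"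
  unfolding left_satellites_def
proof (intro conjI allI impI sat_delta_functor sat_simps(1))
  fix S \<eta> assume a: "delta_functor C D S \<and> is_nat C D (comp_at S 0) F \<eta>"
  note S = delta_functorD[OF conjunct1[OF a]]
  show "\<exists>!\<phi>. delta_morphism C D S sat \<phi> \<and> \<phi> 0 = \<eta>"
  proof (rule delta_morphism_into_exact[OF C.preabelian_axioms D.preabelian_axioms S(1,2) _
        sat_functor sat_conn _ sat_zero])
    show "is_nat C D (comp_at S 0) (comp_at sat 0) \<eta>"
      using a by (simp add: sat_simps)
    fix f g assume se: "short_exact C f g"
    show "is_mono D (onar (comp_at sat 0) f)"
      using D.short_exactD(5)[OF exact[OF se]] by (simp add: sat_simps)
    show "Comp D (onar (comp_at S 0) f) (conn S 0 f g) =
        Zero D (onob (comp_at S (Suc 0)) (Cod C g)) (onob (comp_at S 0) (Cod C f))"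
      using S(3)[OF se, of 0] HomD[OF S(2)[OF se, of 0]] HomD[OF functor_Hom[OF S(1) C.short_exactD(1)[OF se]]]
      unfolding exact_at_def by metis
  qed
qed

text \<open>Universality on both sides gives comparisons \<open>\<phi>\<close> from L to
  \<open>sat\<close> and \<open>\<psi>\<close> back, both the identity in degree 0. Their composite
  \<open>\<chi>\<close> and the identity \<open>e\<close> are endomorphisms of L that agree in
  degree 0, hence everywhere; so in positive degrees the identity passes through a zero
  object.\<close>

lemma left_satellites_zero:
  assumes L: "left_satellites C D F L" and c: "c \<in> Obj C"
  shows "zero_object D (onob (comp_at L (Suc q)) c)"
proof -
  have dL: "delta_functor C D L" and L0: "comp_at L 0 = F"
    using L by (simp_all add: left_satellites_def)
  note LD = delta_functorD[OF dL]
  define e where "e q = (\<lambda>x\<in>Obj C. Ident D (onob (comp_at L q) x))" for q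
  have e: "is_nat C D (comp_at L q) (comp_at L q) (e q)" for q
    by (rule is_natI)
      (use functor_Obj[OF LD(1)] D.Comp_Ident[OF functor_Hom[OF LD(1)]] C.Hom_Obj in \<open>auto simp: e_def\<close>)
  have eL: "delta_morphism C D L L e"
    unfolding delta_morphism_def
  proof (intro conjI allI impI e)
    fix f g q assume se: "short_exact C f g"
    note S = C.short_exactD[OF se]
    show "Comp D (e q (Dom C f)) (conn L q f g) = Comp D (conn L q f g) (e (Suc q) (Cod C g))"
      using D.Comp_Ident[OF LD(2)[OF se]] C.Hom_Obj[OF S(1)] C.Hom_Obj[OF S(2)] by (simp add: e_def)
  qed
  have n0: "is_nat C D (comp_at L 0) F (e 0)" "is_nat C D (comp_at sat 0) F (e 0)"
    using e[of 0] L0 by (simp_all add: sat_simps)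
  obtain \<phi> where \<phi>: "delta_morphism C D L sat \<phi>" "\<phi> 0 = e 0"
    using sat_left_satellites dL n0(1) unfolding left_satellites_def by blast
  obtain \<psi> where \<psi>: "delta_morphism C D sat L \<psi>" "\<psi> 0 = e 0"
    using L sat_delta_functor n0(2) unfolding left_satellites_def by blast
  have \<phi>n: "is_nat C D (comp_at L q) (comp_at sat q) (\<phi> q)" and \<psi>n: "is_nat C D (comp_at sat q) (comp_at L q) (\<psi> q)" for q
    using \<phi> \<psi> by (simp_all add: delta_morphism_def)
  note \<phi>D = is_natD[OF \<phi>n] and \<psi>D = is_natD[OF \<psi>n]
  define \<chi> where "\<chi> q = (\<lambda>x\<in>Obj C. Comp D (\<psi> q x) (\<phi> q x))" for q
  have \<chi>: "delta_morphism C D L L \<chi>"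
    unfolding delta_morphism_def
  proof (intro conjI allI impI)
    fix q show "is_nat C D (comp_at L q) (comp_at L q) (\<chi> q)"
    proof (rule is_natI)
      show "\<chi> q \<in> extensional (Obj C)" by (simp add: \<chi>_def)
      show "\<chi> q x \<in> Hom D (onob (comp_at L q) x) (onob (comp_at L q) x)" if "x \<in> Obj C" for x
        using D.Comp_Hom[OF \<phi>D(2)[OF that] \<psi>D(2)[OF that]] that by (simp add: \<chi>_def)
      fix f x y assume f: "f \<in> Hom C x y"
      note o = C.Hom_Obj[OF f]
      show "Comp D (onar (comp_at L q) f) (\<chi> q x) = Comp D (\<chi> q y) (onar (comp_at L q) f)"
        using D.Comp_assoc[OF \<phi>D(2)[OF o(1)] \<psi>D(2)[OF o(1)] functor_Hom[OF LD(1) f]] \<psi>D(3)[OF f]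
          D.Comp_assoc[OF \<phi>D(2)[OF o(1)] functor_Hom[OF sat_functor f] \<psi>D(2)[OF o(2)]] \<phi>D(3)[OF f]
          D.Comp_assoc[OF functor_Hom[OF LD(1) f] \<phi>D(2)[OF o(2)] \<psi>D(2)[OF o(2)]] o
        by (simp add: \<chi>_def)
    qed
  next
    fix f g q assume se: "short_exact C f g"
    note S = C.short_exactD[OF se]
    have o: "Dom C f \<in> Obj C" "Cod C g \<in> Obj C"
      using C.Hom_Obj[OF S(1)] C.Hom_Obj[OF S(2)] by simp_all
    have "Comp D (\<phi> q (Dom C f)) (conn L q f g) = Comp D (conn sat q f g) (\<phi> (Suc q) (Cod C g))"
      "Comp D (\<psi> q (Dom C f)) (conn sat q f g) = Comp D (conn L q f g) (\<psi> (Suc q) (Cod C g))"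
      using \<phi>(1) \<psi>(1) se by (simp_all add: delta_morphism_def)
    note sq = this
    have "Comp D (\<chi> q (Dom C f)) (conn L q f g) = Comp D (\<psi> q (Dom C f)) (Comp D (\<phi> q (Dom C f)) (conn L q f g))"
      using o D.Comp_assoc[OF LD(2)[OF se] \<phi>D(2)[OF o(1)] \<psi>D(2)[OF o(1)]] by (simp add: \<chi>_def)
    also have "\<dots> = Comp D (Comp D (\<psi> q (Dom C f)) (conn sat q f g)) (\<phi> (Suc q) (Cod C g))"
      using sq(1) D.Comp_assoc[OF \<phi>D(2)[OF o(2)] sat_conn[OF se] \<psi>D(2)[OF o(1)]] by simp
    also have "\<dots> = Comp D (conn L q f g) (\<chi> (Suc q) (Cod C g))"
      using sq(2) o D.Comp_assoc[OF \<phi>D(2)[OF o(2)] \<psi>D(2)[OF o(2)] LD(2)[OF se]] by (simp add: \<chi>_def)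
    finally show "Comp D (\<chi> q (Dom C f)) (conn L q f g) = Comp D (conn L q f g) (\<chi> (Suc q) (Cod C g))" .
  qed
  have "\<chi> 0 = e 0"
  proof (rule extensionalityI[of _ "Obj C"])
    fix x assume x: "x \<in> Obj C"
    then have "Ident D (onob F x) \<in> Hom D (onob F x) (onob F x)"
      using functor_Obj[OF is_functor_F] by simp
    then show "\<chi> 0 x = e 0 x"
      using x D.Comp_Ident \<phi>(2) \<psi>(2) L0 by (simp add: \<chi>_def e_def)
  qed (simp_all add: \<chi>_def e_def)
  moreover have "\<exists>!\<xi>. delta_morphism C D L L \<xi> \<and> \<xi> 0 = e 0"
    using L dL n0(1) unfolding left_satellites_def by blast
  ultimately have "\<chi> = e"
    using eL \<chi> by blast
  then have "\<chi> (Suc q) c = e (Suc q) c" by simp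
  then have "Comp D (\<psi> (Suc q) c) (\<phi> (Suc q) c) = Ident D (onob (comp_at L (Suc q)) c)"
    using c by (simp add: \<chi>_def e_def)
  then show ?thesis
    using D.zero_object_if_id_factors[OF sat_zero[OF c] \<phi>D(2)[OF c] \<psi>D(2)[OF c]] by blast
qed

end

section \<open>Simplex categories\<close>

lemma Delta_Hom: "t \<in> Hom Delta m n \<longleftrightarrow> (\<exists>\<theta>. t = (m, n, \<theta>) \<and> \<theta> \<in> {..m} \<rightarrow>\<^sub>E {..n} \<and> mono_on {..m} \<theta>)"
  by (auto simp: Hom_def Delta_def)

lemma Delta_Comp_Hom:
  assumes "s \<in> Hom Delta l m" "t \<in> Hom Delta m n"
  shows "Comp Delta t s \<in> Hom Delta l n"
proof -
  obtain \<theta> \<psi> where e: "s = (l, m, \<theta>)" "\<theta> \<in> {..l} \<rightarrow>\<^sub>E {..m}" "mono_on {..l} \<theta>"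
    "t = (m, n, \<psi>)" "\<psi> \<in> {..m} \<rightarrow>\<^sub>E {..n}" "mono_on {..m} \<psi>"
    using assms by (auto simp: Delta_Hom)
  have \<theta>: "\<And>k. k \<le> l \<Longrightarrow> \<theta> k \<le> m"
    using e(2) by (auto simp: PiE_def)
  have "compose {..l} \<psi> \<theta> \<in> {..l} \<rightarrow>\<^sub>E {..n}"
    using \<theta> e(5) by (auto simp: compose_def PiE_def)
  moreover have "mono_on {..l} (compose {..l} \<psi> \<theta>)"
    using \<theta> e(3,6) by (auto simp: compose_def mono_on_def)
  ultimately show ?thesis
    by (simp add: Delta_Hom e(1,4)) (simp add: Delta_def)
qed

lemma Delta_category: "is_category Delta"
  unfolding is_category_def
proof (intro conjI ballI impI)
  fix f assume "f \<in> Arr Delta"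
  then obtain m n \<theta> where f: "f = (m, n, \<theta>)" "\<theta> \<in> {..m} \<rightarrow>\<^sub>E {..n}"
    by (auto simp: Delta_def)
  show "Dom Delta f \<in> Obj Delta" "Cod Delta f \<in> Obj Delta"
    by (simp_all add: Delta_def)
  have "compose {..m} \<theta> (\<lambda>k\<in>{..m}. k) = \<theta>" "compose {..m} (\<lambda>k\<in>{..n}. k) \<theta> = \<theta>"
    using f(2) by (auto simp: compose_def fun_eq_iff PiE_def extensional_def Pi_iff)
  then show "Comp Delta f (Ident Delta (Dom Delta f)) = f" "Comp Delta (Ident Delta (Cod Delta f)) f = f"
    by (simp_all add: Delta_def f(1))
next
  fix x show "Ident Delta x \<in> Hom Delta x x"
    by (simp add: Delta_Hom) (simp add: Delta_def mono_on_def)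
next
  fix f g assume "f \<in> Arr Delta" "g \<in> Arr Delta" "Cod Delta f = Dom Delta g"
  then show "Comp Delta g f \<in> Hom Delta (Dom Delta f) (Cod Delta g)"
    by (intro Delta_Comp_Hom[of _ _ "Cod Delta f"]) (simp_all add: Hom_def)
next
  fix f g h
  assume "f \<in> Arr Delta" "g \<in> Arr Delta" "h \<in> Arr Delta" "Cod Delta f = Dom Delta g \<and> Cod Delta g = Dom Delta h"
  then show "Comp Delta h (Comp Delta g f) = Comp Delta (Comp Delta h g) f"
    by (auto simp: Delta_def compose_def fun_eq_iff PiE_def Pi_iff)
qed

interpretation Delta: cat Delta
  by standard (rule Delta_category)

lemma Delta_Obj [simp]: "m \<in> Obj Delta"
  by (simp add: Delta_def)

lemma coface_Hom: "coface n i \<in> Hom Delta n (Suc n)"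
  by (auto simp: Delta_Hom coface_def mono_on_def)

text \<open>The cosimplicial identity for a smaller index j and a larger index k + 1; writing the
  larger one as a successor avoids subtraction and is the form in which the double sum pairs its
  terms.\<close>

lemma coface_coface:
  "j \<le> k \<Longrightarrow> Comp Delta (coface (Suc n) (Suc k)) (coface n j) = Comp Delta (coface (Suc n) j) (coface n k)"
  by (auto simp: Delta_def coface_def compose_def fun_eq_iff)

lemma sset_act:
  assumes "simplicial_set X" "\<theta> \<in> Hom Delta m n" "x \<in> simp X n"
  shows "act X \<theta> x \<in> simp X m"
  using assms by (auto simp: simplicial_set_def Hom_def)

lemma sset_act_Ident: "simplicial_set X \<Longrightarrow> x \<in> simp X m \<Longrightarrow> act X (Ident Delta m) x = x"
  by (simp add: simplicial_set_def)

lemma sset_act_Comp: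
  assumes "simplicial_set X" "\<theta> \<in> Hom Delta l m" "\<psi> \<in> Hom Delta m n" "x \<in> simp X n"
  shows "act X (Comp Delta \<psi> \<theta>) x = act X \<theta> (act X \<psi> x)"
  using assms by (simp add: simplicial_set_def Hom_def)

lemma smap_simp: "simplicial_map X Y f \<Longrightarrow> x \<in> simp X m \<Longrightarrow> f m x \<in> simp Y m"
  by (simp add: simplicial_map_def)

lemma smap_act:
  assumes "simplicial_map X Y f" "\<theta> \<in> Hom Delta m n" "x \<in> simp X n"
  shows "f m (act X \<theta> x) = act Y \<theta> (f n x)"
  using assms by (auto simp: simplicial_map_def Hom_def)

lemma simplex_Obj [simp]: "(m, x) \<in> Obj (simplex_cat X) \<longleftrightarrow> x \<in> simp X m"
  by (simp add: simplex_cat_def)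

text \<open>An arrow of \<open>\<Delta>/X\<close> is determined by its target and its underlying arrow of \<open>\<Delta>\<close>.\<close>

definition sx_arr :: "'u sset \<Rightarrow> nat \<Rightarrow> delta_arr \<Rightarrow> nat \<Rightarrow> 'u \<Rightarrow> 'u sx_arr" where
  "sx_arr X m \<theta> n x = ((m, act X \<theta> x), \<theta>, (n, x))"

lemma simplex_simps [simp]:
  "Dom (simplex_cat X) (s, \<theta>, s') = s" "Cod (simplex_cat X) (s, \<theta>, s') = s'"
  "((m, x), \<theta>, (n, y)) \<in> Arr (simplex_cat X) \<longleftrightarrow>
    x \<in> simp X m \<and> y \<in> simp X n \<and> \<theta> \<in> Hom Delta m n \<and> x = act X \<theta> y"
  by (simp_all add: simplex_cat_def)

lemma sx_arr_Hom:
  assumes "simplicial_set X" "\<theta> \<in> Hom Delta m n" "x \<in> simp X n"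
  shows "sx_arr X m \<theta> n x \<in> Hom (simplex_cat X) (m, act X \<theta> x) (n, x)"
  using assms sset_act[OF assms] by (intro HomI) (simp_all add: sx_arr_def)

lemma simplex_HomE:
  assumes t: "t \<in> Hom (simplex_cat X) s s'"
  obtains m n \<theta> y where "\<theta> \<in> Hom Delta m n" "y \<in> simp X n" "s = (m, act X \<theta> y)" "s' = (n, y)"
    "t = sx_arr X m \<theta> n y"
proof -
  obtain m x \<theta> n y where e: "t = ((m, x), \<theta>, (n, y))"
    using prod_cases3 surj_pair by metis
  show ?thesis
    by (rule that[of \<theta> m n y]) (use HomD[OF t] in \<open>simp_all add: e sx_arr_def\<close>)
qed

lemma sx_arr_Comp:
  assumes X: "simplicial_set X" and \<theta>: "\<theta> \<in> Hom Delta l m" and \<psi>: "\<psi> \<in> Hom Delta m n" and x: "x \<in> simp X n"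
  shows "Comp (simplex_cat X) (sx_arr X m \<psi> n x) (sx_arr X l \<theta> m (act X \<psi> x)) = sx_arr X l (Comp Delta \<psi> \<theta>) n x"
  using sset_act_Comp[OF assms] by (simp add: simplex_cat_def sx_arr_def)

lemma simplex_category:
  assumes X: "simplicial_set X"
  shows "is_category (simplex_cat X)"
  unfolding is_category_def
proof (intro conjI ballI impI)
  fix t assume t: "t \<in> Arr (simplex_cat X)"
  then have "t \<in> Hom (simplex_cat X) (Dom (simplex_cat X) t) (Cod (simplex_cat X) t)"
    by (simp add: Hom_def)
  then obtain m n \<theta> y where e: "\<theta> \<in> Hom Delta m n" "y \<in> simp X n"
    "Dom (simplex_cat X) t = (m, act X \<theta> y)" "Cod (simplex_cat X) t = (n, y)" "t = sx_arr X m \<theta> n y"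
    by (rule simplex_HomE)
  show "Dom (simplex_cat X) t \<in> Obj (simplex_cat X)" "Cod (simplex_cat X) t \<in> Obj (simplex_cat X)"
    using e sset_act[OF X] by simp_all
  show "Comp (simplex_cat X) t (Ident (simplex_cat X) (Dom (simplex_cat X) t)) = t"
    "Comp (simplex_cat X) (Ident (simplex_cat X) (Cod (simplex_cat X) t)) t = t"
    using Delta.Comp_Ident[OF e(1)] unfolding e(3,4) unfolding e(5) by (simp_all add: simplex_cat_def sx_arr_def)
next
  fix s assume s: "s \<in> Obj (simplex_cat X)"
  obtain m x where e: "s = (m, x)" by (cases s)
  have "sx_arr X m (Ident Delta m) m x \<in> Hom (simplex_cat X) (m, act X (Ident Delta m) x) (m, x)"
    by (rule sx_arr_Hom[OF X]) (use s e in auto)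
  then show "Ident (simplex_cat X) s \<in> Hom (simplex_cat X) s s"
    using s e sset_act_Ident[OF X] by (simp add: sx_arr_def) (simp add: simplex_cat_def)
next
  fix f g assume f: "f \<in> Arr (simplex_cat X)" and g: "g \<in> Arr (simplex_cat X)"
    and fg: "Cod (simplex_cat X) f = Dom (simplex_cat X) g"
  obtain l m \<theta> y where e: "\<theta> \<in> Hom Delta l m" "y \<in> simp X m"
    "Dom (simplex_cat X) f = (l, act X \<theta> y)" "Cod (simplex_cat X) f = (m, y)" "f = sx_arr X l \<theta> m y"
    by (rule simplex_HomE[OF HomI[OF f refl refl]])
  obtain m' n \<psi> z where e': "\<psi> \<in> Hom Delta m' n" "z \<in> simp X n"
    "Dom (simplex_cat X) g = (m', act X \<psi> z)" "Cod (simplex_cat X) g = (n, z)" "g = sx_arr X m' \<psi> n z"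
    by (rule simplex_HomE[OF HomI[OF g refl refl]])
  have my: "m' = m" "y = act X \<psi> z"
    using fg e(4) e'(3) by simp_all
  note \<psi> = e'(1)[unfolded my]
  show "Comp (simplex_cat X) g f \<in> Hom (simplex_cat X) (Dom (simplex_cat X) f) (Cod (simplex_cat X) g)"
    using sx_arr_Comp[OF X e(1) \<psi> e'(2)] sx_arr_Hom[OF X Delta.Comp_Hom[OF e(1) \<psi>] e'(2)]
      sset_act_Comp[OF X e(1) \<psi> e'(2)]
    unfolding e(3) e'(4) unfolding e(5) e'(5) my by simp
next
  fix f g h
  assume "f \<in> Arr (simplex_cat X)" "g \<in> Arr (simplex_cat X)" "h \<in> Arr (simplex_cat X)"
    "Cod (simplex_cat X) f = Dom (simplex_cat X) g \<and> Cod (simplex_cat X) g = Dom (simplex_cat X) h"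
  then show "Comp (simplex_cat X) h (Comp (simplex_cat X) g f) = Comp (simplex_cat X) (Comp (simplex_cat X) h g) f"
    using Delta.Comp_assoc by (auto simp: simplex_cat_def)
qed

abbreviation sxop :: "'u sset \<Rightarrow> ('u sx, 'u sx_arr) category" where
  "sxop X \<equiv> opcat (simplex_cat X)"

lemma sxop_category: "simplicial_set X \<Longrightarrow> is_category (sxop X)"
  using cat.opcat_cat cat.intro simplex_category by blast

lemma simplex_functor_simps:
  "x \<in> simp X m \<Longrightarrow> onob (simplex_functor X f) (m, x) = (m, f m x)"
  by (simp add: simplex_functor_def)

lemma simplex_functor_arr:
  assumes X: "simplicial_set X" and f: "simplicial_map X Y f" and \<theta>: "\<theta> \<in> Hom Delta m n" and x: "x \<in> simp X n"
  shows "onar (simplex_functor X f) (sx_arr X m \<theta> n x) = sx_arr Y m \<theta> n (f n x)"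
  using HomD(1)[OF sx_arr_Hom[OF X \<theta> x]] smap_act[OF f \<theta> x] by (simp add: simplex_functor_def sx_arr_def)

lemma simplex_functor:
  assumes X: "simplicial_set X" and Y: "simplicial_set Y" and f: "simplicial_map X Y f"
  shows "is_functor (sxop X) (sxop Y) (simplex_functor X f)"
proof (rule functorI[OF sxop_category[OF X] sxop_category[OF Y]])
  show "onob (simplex_functor X f) \<in> extensional (Obj (sxop X))"
    "onar (simplex_functor X f) \<in> extensional (Arr (sxop X))"
    by (simp_all add: simplex_functor_def)
  show "onob (simplex_functor X f) s \<in> Obj (sxop Y)" if "s \<in> Obj (sxop X)" for s
    using that smap_simp[OF f] by (cases s) (simp add: simplex_functor_simps)
  show "onar (simplex_functor X f) (Ident (sxop X) s) = Ident (sxop Y) (onob (simplex_functor X f) s)"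
    if sO: "s \<in> Obj (sxop X)" for s
  proof -
    obtain m x where s: "s = (m, x)" "x \<in> simp X m"
      using sO by (cases s) auto
    have "Ident (simplex_cat X) s = sx_arr X m (Ident Delta m) m x"
      "Ident (simplex_cat Y) (m, f m x) = sx_arr Y m (Ident Delta m) m (f m x)"
      using s sset_act_Ident[OF X] sset_act_Ident[OF Y] smap_simp[OF f s(2)] by (simp_all add: simplex_cat_def sx_arr_def)
    then show ?thesis
      using s simplex_functor_arr[OF X f Delta.Ident_Hom s(2)] by (simp add: simplex_functor_simps)
  qed
next
  fix t s s' assume "t \<in> Hom (sxop X) s s'"
  then have "t \<in> Hom (simplex_cat X) s' s" by simp
  then obtain m n \<theta> y where e: "\<theta> \<in> Hom Delta m n" "y \<in> simp X n" "s' = (m, act X \<theta> y)" "s = (n, y)"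
    "t = sx_arr X m \<theta> n y"
    by (rule simplex_HomE)
  show "onar (simplex_functor X f) t \<in> Hom (sxop Y) (onob (simplex_functor X f) s) (onob (simplex_functor X f) s')"
    using sx_arr_Hom[OF Y e(1) smap_simp[OF f e(2)]] smap_act[OF f e(1,2)] sset_act[OF X e(1,2)] e(2)
    by (simp add: e(3-5) simplex_functor_simps simplex_functor_arr[OF X f e(1,2)])
next
  fix g h r s t assume "g \<in> Hom (sxop X) r s" "h \<in> Hom (sxop X) s t"
  then have g: "g \<in> Hom (simplex_cat X) s r" and h: "h \<in> Hom (simplex_cat X) t s" by simp_all
  obtain m n \<theta> y where e: "\<theta> \<in> Hom Delta m n" "y \<in> simp X n" "s = (m, act X \<theta> y)" "r = (n, y)"
    "g = sx_arr X m \<theta> n y"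
    using g by (rule simplex_HomE)
  obtain l m' \<psi> z where e': "\<psi> \<in> Hom Delta l m'" "z \<in> simp X m'" "t = (l, act X \<psi> z)" "s = (m', z)"
    "h = sx_arr X l \<psi> m' z"
    using h by (rule simplex_HomE)
  have my: "m' = m" "z = act X \<theta> y"
    using e(3) e'(4) by simp_all
  note \<psi> = e'(1)[unfolded my] and z = e'(2)[unfolded my]
  show "onar (simplex_functor X f) (Comp (sxop X) h g) =
      Comp (sxop Y) (onar (simplex_functor X f) h) (onar (simplex_functor X f) g)"
    using sx_arr_Comp[OF X \<psi> e(1,2)] sx_arr_Comp[OF Y \<psi> e(1) smap_simp[OF f e(2)]] smap_act[OF f e(1,2)]
    by (simp add: e(5) e'(5) my simplex_functor_arr[OF X f e(1,2)] simplex_functor_arr[OF X f \<psi> z]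
        simplex_functor_arr[OF X f Delta.Comp_Hom[OF \<psi> e(1)] e(2)])
qed

locale simplicial_over = cocomp A U for A :: "('o, 'a) abcat" and U :: "'u itself" +
  fixes X Y :: "'u sset" and f :: "'u smap"
  assumes X: "simplicial_set X" and Y: "simplicial_set Y" and f: "simplicial_map X Y f"

text \<open>Once reversed, an arrow starts at the simplex on which its operator acts. A lift
  starting at (n, x) must therefore carry the same operator \<theta> and end at the restriction of x
  along \<theta>, which gives existence and uniqueness. On a fibre the dimension is constant, so
  \<open>snd\<close> is injective there.\<close>

sublocale simplicial_over \<subseteq> opf: discrete_opfibration A U "sxop X" "sxop Y" "simplex_functor X f" snd
proof
  show "is_category (sxop X)" "is_category (sxop Y)"
    by (rule sxop_category[OF X]) (rule sxop_category[OF Y])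
  show "is_functor (sxop X) (sxop Y) (simplex_functor X f)"
    by (rule simplex_functor[OF X Y f])
  show "inj_on snd {c \<in> Obj (sxop X). onob (simplex_functor X f) c = d}" for d
    by (auto simp: inj_on_def simplex_functor_simps)
  fix c g d assume c: "c \<in> Obj (sxop X)" and "g \<in> Hom (sxop Y) (onob (simplex_functor X f) c) d"
  then have g: "g \<in> Hom (simplex_cat Y) d (onob (simplex_functor X f) c)" by simp
  obtain n x where nx: "c = (n, x)" "x \<in> simp X n"
    using c by (cases c) auto
  obtain m n' \<theta> y where e: "\<theta> \<in> Hom Delta m n'" "d = (m, act Y \<theta> y)"
    "onob (simplex_functor X f) c = (n', y)" "g = sx_arr Y m \<theta> n' y"
    using g by (rule simplex_HomE)
  have y: "n' = n" "y = f n x"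
    using e(3) nx by (auto simp: simplex_functor_simps)
  note \<theta> = e(1)[unfolded y]
  show "\<exists>!h. h \<in> Arr (sxop X) \<and> Dom (sxop X) h = c \<and> onar (simplex_functor X f) h = g"
  proof (rule ex1I)
    show "sx_arr X m \<theta> n x \<in> Arr (sxop X) \<and> Dom (sxop X) (sx_arr X m \<theta> n x) = c \<and>
        onar (simplex_functor X f) (sx_arr X m \<theta> n x) = g"
      using HomD[OF sx_arr_Hom[OF X \<theta> nx(2)]] simplex_functor_arr[OF X f \<theta> nx(2)] nx e(4) y by simp
    fix h assume h: "h \<in> Arr (sxop X) \<and> Dom (sxop X) h = c \<and> onar (simplex_functor X f) h = g"
    then have "h \<in> Hom (simplex_cat X) (Dom (simplex_cat X) h) c"
      by (simp add: Hom_def)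
    then obtain l k \<psi> z where e': "\<psi> \<in> Hom Delta l k" "z \<in> simp X k" "c = (k, z)" "h = sx_arr X l \<psi> k z"
      by (rule simplex_HomE)
    then show "h = sx_arr X m \<theta> n x"
      using h e(4) y nx simplex_functor_arr[OF X f e'(1,2)] by (simp add: sx_arr_def)
  qed
qed

context simplicial_over
begin

lemma nsys_X: "nsys_cat A X = opf.FX.FC" and nsys_Y: "nsys_cat A Y = opf.FY.FC"
  and pull_f: "pull A X Y f = opf.P"
  by (simp_all add: nsys_cat_def pull_def)

lemma Lan_adjoint: "left_adjoint_unit opf.FX.FC opf.FY.FC opf.P (Lan A X Y f) (Lan_unit A X Y f)"
proof -
  have "case Lan_sel A X Y f of (F, \<eta>) \<Rightarrow> left_adjoint_unit opf.FX.FC opf.FY.FC opf.P F \<eta>"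
    unfolding Lan_sel_def nsys_X nsys_Y pull_f by (rule someI_ex) (use opf.left_adjoint_ex in auto)
  then show ?thesis
    by (simp add: Lan_def Lan_unit_def split_beta)
qed

end

sublocale simplicial_over \<subseteq> adj: opfibration_adjoint A U "sxop X" "sxop Y" "simplex_functor X f" snd
    "Lan A X Y f" "Lan_unit A X Y f"
  by standard (rule Lan_adjoint)

sublocale simplicial_over \<subseteq> sat: exact_functor opf.FX.FC opf.FY.FC "Lan A X Y f"
  by standard (use adj.F_additive adj.F_exact in auto)

context simplicial_over
begin

lemma Lan_sat: "left_satellites opf.FX.FC opf.FY.FC (Lan A X Y f) (Lan_sat A X Y f)"
  unfolding Lan_sat_def nsys_X nsys_Y by (rule someI) (rule sat.sat_left_satellites)

lemma Lan_sat_delta: "delta_functor opf.FX.FC opf.FY.FC (Lan_sat A X Y f)"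
  and Lan_sat_0: "comp_at (Lan_sat A X Y f) 0 = Lan A X Y f"
  using Lan_sat by (simp_all add: left_satellites_def)

lemma Lan_sat_zero:
  assumes "is_functor (sxop X) A T"
  shows "zero_object opf.FY.FC (onob (comp_at (Lan_sat A X Y f) (Suc q)) T)"
  by (rule sat.left_satellites_zero[OF Lan_sat]) (use assms in simp)

lemma pull_onob:
  assumes T: "is_functor (sxop Y) A T" and x: "x \<in> simp X n"
  shows "onob (onob opf.P T) (n, x) = onob T (n, f n x)"
  using opf.P_ob(3)[OF T, of "(n, x)"] x by (simp add: simplex_functor_simps)

lemma pull_onar:
  assumes T: "is_functor (sxop Y) A T" and \<theta>: "\<theta> \<in> Hom Delta m n" and x: "x \<in> simp X n"
  shows "onar (onob opf.P T) (sx_arr X m \<theta> n x) = onar T (sx_arr Y m \<theta> n (f n x))"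
  using opf.P_ob(4)[OF T, of "sx_arr X m \<theta> n x"] sx_arr_Hom[OF X \<theta> x] simplex_functor_arr[OF X f \<theta> x] by simp

lemma pull_cmp:
  assumes t: "t \<in> Hom opf.FY.FC T T'" and x: "x \<in> simp X n"
  shows "cmp (onar opf.P t) (n, x) = cmp t (n, f n x)"
  using opf.P_ar(2)[OF t, of "(n, x)"] x by (simp add: simplex_functor_simps)

lemma pull_zero:
  assumes z: "zero_object opf.FY.FC F"
  shows "zero_object opf.FX.FC (onob opf.P F)"
proof -
  have F: "is_functor (sxop Y) A F"
    using opf.FY.FC.zero_object_Obj[OF z] by simp
  show ?thesis
    by (rule opf.FX.FC_zero_object[OF opf.P_ob(2)[OF F]])
      (use opf.P_ob(3)[OF F] opf.FY.FC_zero_objectD[OF z functor_Obj[OF opf.K]] in simp)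
qed

end

section \<open>Gabriel-Zisman chain complexes\<close>

context preadd
begin

lemma hom_sum_Hom:
  assumes "x \<in> Obj A" "y \<in> Obj A" "\<And>i. i < n \<Longrightarrow> h i \<in> Hom A x y"
  shows "hom_sum A x y h n \<in> Hom A x y"
  using assms(3) by (induction n) (use assms(1,2) in \<open>simp_all add: Add_Hom\<close>)

lemma hom_sum_cong:
  "(\<And>i. i < n \<Longrightarrow> h i = k i) \<Longrightarrow> hom_sum A x y h n = hom_sum A x y k n"
  by (induction n) simp_all

lemma Comp_hom_sum:
  assumes "x \<in> Obj A" "g \<in> Hom A y z" "\<And>i. i < n \<Longrightarrow> h i \<in> Hom A x y"
  shows "Comp A g (hom_sum A x y h n) = hom_sum A x z (\<lambda>i. Comp A g (h i)) n"
  using assms(3)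
proof (induction n)
  case 0
  show ?case using Comp_Zero assms by simp
next
  case (Suc n)
  have "hom_sum A x y h n \<in> Hom A x y"
    by (rule hom_sum_Hom) (use assms Suc Hom_Obj in auto)
  then show ?case
    using Suc Comp_Add(1)[OF _ _ assms(2,2)] by simp
qed

lemma hom_sum_Comp:
  assumes "z \<in> Obj A" "g \<in> Hom A x y" "\<And>i. i < n \<Longrightarrow> h i \<in> Hom A y z"
  shows "Comp A (hom_sum A y z h n) g = hom_sum A x z (\<lambda>i. Comp A (h i) g) n"
  using assms(3)
proof (induction n)
  case 0
  show ?case using Zero_Comp assms by simp
next
  case (Suc n)
  have "hom_sum A y z h n \<in> Hom A y z"
    by (rule hom_sum_Hom) (use assms Suc Hom_Obj in auto)
  then show ?case
    using Suc Comp_Add(2)[OF assms(2,2)] by simp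
qed

lemma Add_interchange:
  assumes a: "a \<in> Hom A x y" and b: "b \<in> Hom A x y" and c: "c \<in> Hom A x y" and d: "d \<in> Hom A x y"
  shows "Add A (Add A a b) (Add A c d) = Add A (Add A a c) (Add A b d)"
proof -
  have "Add A b (Add A c d) = Add A c (Add A b d)"
    using Add_assoc[OF b c d] Add_assoc[OF c b d] Add_commute[OF b c] by simp
  then show ?thesis
    using Add_assoc[OF a b Add_Hom[OF c d]] Add_assoc[OF a c Add_Hom[OF b d]] by simp
qed

lemma hom_sum_Add:
  assumes "x \<in> Obj A" "y \<in> Obj A" "\<And>i. i < n \<Longrightarrow> h i \<in> Hom A x y" "\<And>i. i < n \<Longrightarrow> k i \<in> Hom A x y"
  shows "hom_sum A x y (\<lambda>i. Add A (h i) (k i)) n = Add A (hom_sum A x y h n) (hom_sum A x y k n)"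
  using assms(3,4)
proof (induction n)
  case 0
  show ?case using Add_Zero[OF Zero_Hom] assms by simp
next
  case (Suc n)
  have s: "hom_sum A x y h n \<in> Hom A x y" "hom_sum A x y k n \<in> Hom A x y"
    using hom_sum_Hom assms(1,2) Suc by simp_all
  have hk: "h n \<in> Hom A x y" "k n \<in> Hom A x y"
    using Suc by simp_all
  have "Add A (Add A (hom_sum A x y h n) (hom_sum A x y k n)) (Add A (h n) (k n)) =
      Add A (Add A (hom_sum A x y h n) (h n)) (Add A (hom_sum A x y k n) (k n))"
    by (rule Add_interchange[OF s hk])
  then show ?case
    using Suc by simp
qed

lemma hom_sum_Zero:
  assumes "x \<in> Obj A" "y \<in> Obj A"
  shows "hom_sum A x y (\<lambda>i. Zero A x y) n = Zero A x y"
  by (induction n) (use assms Add_Zero[OF Zero_Hom] in simp_all)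

text \<open>The index pairs form a rectangle with n + 1 rows and n columns, in which entry (j, k)
  with j \<le> k cancels entry (k + 1, j). Raising n by one adds the column with index n and the row
  with index n + 1; entry i of the column cancels entry i of the row.\<close>

lemma simplicial_double_sum:
  assumes xy: "x \<in> Obj A" "y \<in> Obj A" and s: "\<And>i j. s i j \<in> Hom A x y"
    and z: "\<And>j k. j \<le> k \<Longrightarrow> Add A (s j k) (s (Suc k) j) = Zero A x y"
  shows "hom_sum A x y (\<lambda>i. hom_sum A x y (s i) n) (Suc n) = Zero A x y"
proof (induction n)
  case 0
  show ?case using xy Add_Zero[OF Zero_Hom] by simp
next
  case (Suc n)
  let ?S = "hom_sum A x y"
  have h: "\<And>i m. ?S (s i) m \<in> Hom A x y" "\<And>m. ?S (\<lambda>i. s i n) m \<in> Hom A x y"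
    using hom_sum_Hom xy s by simp_all
  have "?S (\<lambda>i. ?S (s i) (Suc n)) (Suc (Suc n)) =
      Add A (Add A (?S (\<lambda>i. ?S (s i) n) (Suc n)) (?S (\<lambda>i. s i n) (Suc n))) (?S (s (Suc n)) (Suc n))"
    using hom_sum_Add[OF xy, of "Suc n" "\<lambda>i. ?S (s i) n" "\<lambda>i. s i n"] h s by simp
  also have "\<dots> = Add A (?S (\<lambda>i. s i n) (Suc n)) (?S (s (Suc n)) (Suc n))"
    using Suc Add_commute[OF Zero_Hom[OF xy] h(2)] Add_Zero[OF h(2)] by (simp only:)
  also have "\<dots> = ?S (\<lambda>i. Add A (s i n) (s (Suc n) i)) (Suc n)"
    using hom_sum_Add[OF xy, of "Suc n" "\<lambda>i. s i n" "s (Suc n)"] s by simp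
  also have "\<dots> = ?S (\<lambda>i. Zero A x y) (Suc n)"
    by (rule hom_sum_cong) (use z in simp)
  finally show ?case
    using hom_sum_Zero[OF xy] by (simp only:)
qed

definition alt :: "nat \<Rightarrow> 'a \<Rightarrow> 'a" where
  "alt i g = (if even i then g else Neg A g)"

lemma alt_Hom: "g \<in> Hom A x y \<Longrightarrow> alt i g \<in> Hom A x y"
  by (simp add: alt_def Neg)

lemma Comp_alt:
  assumes "g \<in> Hom A x y" "h \<in> Hom A y z"
  shows "Comp A h (alt i g) = alt i (Comp A h g)" "Comp A (alt i h) g = alt i (Comp A h g)"
  using Comp_Neg[OF assms] by (simp_all add: alt_def)

text \<open>The sign exponents are j + k and j + k + 1, of opposite parity. These are the signs of
  the two terms matched by \<open>coface_coface\<close>.\<close>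

lemma alt_cancel:
  assumes w: "w \<in> Hom A x y"
  shows "Add A (alt k (alt j w)) (alt j (alt (Suc k) w)) = Zero A x y"
  using Neg[OF w] Neg_Neg[OF w] Add_commute[OF w Neg(1)[OF w]] by (simp add: alt_def)

end

section \<open>Gabriel-Zisman chains and their functoriality\<close>

context cocomp
begin

definition nsys :: "'u sset \<Rightarrow> ('u, 'o, 'a) nsys \<Rightarrow> bool" where
  "nsys X T \<longleftrightarrow> simplicial_set X \<and> is_functor (sxop X) A T"

lemma nsysD:
  assumes "nsys X T"
  shows "simplicial_set X" "is_functor (sxop X) A T" "x \<in> simp X n \<Longrightarrow> onob T (n, x) \<in> Obj A"
  using assms functor_Obj[of "sxop X" A T "(n, x)"] by (auto simp: nsys_def)

lemma nsys_arr:
  assumes T: "nsys X T" and \<theta>: "\<theta> \<in> Hom Delta m n" and x: "x \<in> simp X n"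
  shows "onar T (sx_arr X m \<theta> n x) \<in> Hom A (onob T (n, x)) (onob T (m, act X \<theta> x))"
  by (rule functor_Hom[OF nsysD(2)[OF T]]) (use sx_arr_Hom[OF nsysD(1)[OF T] \<theta> x] in simp)

lemma nsys_arr_Comp:
  assumes T: "nsys X T" and \<theta>: "\<theta> \<in> Hom Delta l m" and \<psi>: "\<psi> \<in> Hom Delta m n" and x: "x \<in> simp X n"
  shows "onar T (sx_arr X l (Comp Delta \<psi> \<theta>) n x) =
    Comp A (onar T (sx_arr X l \<theta> m (act X \<psi> x))) (onar T (sx_arr X m \<psi> n x))"
proof -
  note X = nsysD(1)[OF T]
  have a: "sx_arr X l \<theta> m (act X \<psi> x) \<in> Hom (sxop X) (m, act X \<psi> x) (l, act X \<theta> (act X \<psi> x))"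
    "sx_arr X m \<psi> n x \<in> Hom (sxop X) (n, x) (m, act X \<psi> x)"
    using sx_arr_Hom[OF X \<theta> sset_act[OF X \<psi> x]] sx_arr_Hom[OF X \<psi> x] by simp_all
  show ?thesis
    using functor_Comp[OF nsysD(2)[OF T] a(2,1)] sx_arr_Comp[OF X \<theta> \<psi> x] by simp
qed

lemma GZ_coproduct:
  assumes T: "nsys X T"
  shows "is_coproduct A (simp X n) (\<lambda>\<sigma>. onob T (n, \<sigma>)) (GZ_chain A X T n) (GZ_inj A X T n)"
    and "\<exists>c \<iota>. is_coproduct A (simp X n) (\<lambda>\<sigma>. onob T (n, \<sigma>)) c \<iota>"
proof -
  show ex: "\<exists>c \<iota>. is_coproduct A (simp X n) (\<lambda>\<sigma>. onob T (n, \<sigma>)) c \<iota>"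
    by (rule small_coproduct_ex) (rule nsysD(3)[OF T])
  show "is_coproduct A (simp X n) (\<lambda>\<sigma>. onob T (n, \<sigma>)) (GZ_chain A X T n) (GZ_inj A X T n)"
    unfolding GZ_chain_def GZ_inj_def by (rule coprod[OF ex])
qed

lemmas GZ_chain_Obj = coproductD(1)[OF GZ_coproduct(1)]
lemmas GZ_inj_Hom = coproductD(2)[OF GZ_coproduct(1)]
lemmas GZ_ext = coproduct_ext[OF GZ_coproduct(1)]

text \<open>\<open>GZ_face\<close> with an arbitrary operator \<theta> in place of a coface, because
  two successive faces yield the term of a composite.\<close>

definition GZ_term :: "'u sset \<Rightarrow> ('u, 'o, 'a) nsys \<Rightarrow> nat \<Rightarrow> delta_arr \<Rightarrow> nat \<Rightarrow> 'u \<Rightarrow> 'a" where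
  "GZ_term X T m \<theta> n x = Comp A (GZ_inj A X T m (act X \<theta> x)) (onar T (sx_arr X m \<theta> n x))"

lemma GZ_term_Hom:
  assumes T: "nsys X T" and \<theta>: "\<theta> \<in> Hom Delta m n" and x: "x \<in> simp X n"
  shows "GZ_term X T m \<theta> n x \<in> Hom A (onob T (n, x)) (GZ_chain A X T m)"
  unfolding GZ_term_def
  using Comp_Hom[OF nsys_arr[OF T \<theta> x] GZ_inj_Hom[OF T sset_act[OF nsysD(1)[OF T] \<theta> x]]] .

lemma GZ_diff_eq:
  "GZ_diff A X T n = cotuple A (simp X (Suc n)) (\<lambda>\<sigma>. onob T (Suc n, \<sigma>)) (GZ_chain A X T n)
     (\<lambda>\<sigma>. hom_sum A (onob T (Suc n, \<sigma>)) (GZ_chain A X T n)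
       (\<lambda>i. alt i (GZ_term X T n (coface n i) (Suc n) \<sigma>)) (n + 2))"
  unfolding GZ_diff_def alt_def GZ_term_def sx_arr_def GZ_face_def Let_def by (rule refl)

lemma GZ_diff:
  assumes T: "nsys X T"
  shows "GZ_diff A X T n \<in> Hom A (GZ_chain A X T (Suc n)) (GZ_chain A X T n)"
    and "\<sigma> \<in> simp X (Suc n) \<Longrightarrow> Comp A (GZ_diff A X T n) (GZ_inj A X T (Suc n) \<sigma>) =
      hom_sum A (onob T (Suc n, \<sigma>)) (GZ_chain A X T n)
        (\<lambda>i. alt i (GZ_term X T n (coface n i) (Suc n) \<sigma>)) (n + 2)"
proof -
  have h: "hom_sum A (onob T (Suc n, \<sigma>)) (GZ_chain A X T n)
        (\<lambda>i. alt i (GZ_term X T n (coface n i) (Suc n) \<sigma>)) (n + 2) \<in> Hom A (onob T (Suc n, \<sigma>)) (GZ_chain A X T n)"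
    if "\<sigma> \<in> simp X (Suc n)" for \<sigma>
    by (rule hom_sum_Hom[OF nsysD(3)[OF T that] GZ_chain_Obj[OF T]])
      (rule alt_Hom[OF GZ_term_Hom[OF T coface_Hom that]])
  note ct = cotuple[OF GZ_coproduct(2)[OF T] GZ_chain_Obj[OF T] h]
  show "GZ_diff A X T n \<in> Hom A (GZ_chain A X T (Suc n)) (GZ_chain A X T n)"
    unfolding GZ_diff_eq using ct(1) by (simp add: GZ_chain_def)
  show "Comp A (GZ_diff A X T n) (GZ_inj A X T (Suc n) \<sigma>) =
      hom_sum A (onob T (Suc n, \<sigma>)) (GZ_chain A X T n)
        (\<lambda>i. alt i (GZ_term X T n (coface n i) (Suc n) \<sigma>)) (n + 2)" if "\<sigma> \<in> simp X (Suc n)"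
    unfolding GZ_diff_eq GZ_inj_def[of A X T "Suc n"] by (rule ct(2)[OF _ that])
qed

text \<open>Functoriality of \<open>T\<close> merges the action of \<psi> with that of each face
  into the action of one composite operator. For a coface \<psi> this computes one row of the double
  sum for the square of the differential.\<close>

lemma GZ_diff_term:
  assumes T: "nsys X T" and \<psi>: "\<psi> \<in> Hom Delta (Suc n) m" and \<sigma>: "\<sigma> \<in> simp X m"
  shows "Comp A (GZ_diff A X T n) (alt i (GZ_term X T (Suc n) \<psi> m \<sigma>)) =
    hom_sum A (onob T (m, \<sigma>)) (GZ_chain A X T n)
      (\<lambda>j. alt j (alt i (GZ_term X T n (Comp Delta \<psi> (coface n j)) m \<sigma>))) (n + 2)"
proof -
  note X = nsysD(1)[OF T]
  let ?\<tau> = "act X \<psi> \<sigma>"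
  let ?d = "GZ_diff A X T n" and ?T = "onar T (sx_arr X (Suc n) \<psi> m \<sigma>)"
  note \<tau> = sset_act[OF X \<psi> \<sigma>]
  note Th = nsys_arr[OF T \<psi> \<sigma>]
  note t = GZ_term_Hom[OF T coface_Hom \<tau>]
  have "Comp A ?d (alt i (GZ_term X T (Suc n) \<psi> m \<sigma>)) = Comp A (Comp A ?d (GZ_inj A X T (Suc n) ?\<tau>)) (alt i ?T)"
    using Comp_alt(1)[OF Th GZ_inj_Hom[OF T \<tau>]]
      Comp_assoc[OF alt_Hom[OF Th] GZ_inj_Hom[OF T \<tau>] GZ_diff(1)[OF T]] by (simp add: GZ_term_def)
  also have "\<dots> = hom_sum A (onob T (m, \<sigma>)) (GZ_chain A X T n)
      (\<lambda>j. Comp A (alt j (GZ_term X T n (coface n j) (Suc n) ?\<tau>)) (alt i ?T)) (n + 2)"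
    unfolding GZ_diff(2)[OF T \<tau>]
    by (rule hom_sum_Comp[OF GZ_chain_Obj[OF T] alt_Hom[OF Th] alt_Hom[OF t]])
  also have "\<dots> = hom_sum A (onob T (m, \<sigma>)) (GZ_chain A X T n)
      (\<lambda>j. alt j (alt i (GZ_term X T n (Comp Delta \<psi> (coface n j)) m \<sigma>))) (n + 2)"
  proof (rule hom_sum_cong)
    fix j
    note f = nsys_arr[OF T coface_Hom[of n j] \<tau>] and inj = GZ_inj_Hom[OF T sset_act[OF X coface_Hom[of n j] \<tau>]]
    have "Comp A (GZ_term X T n (coface n j) (Suc n) ?\<tau>) ?T = GZ_term X T n (Comp Delta \<psi> (coface n j)) m \<sigma>"
      using nsys_arr_Comp[OF T coface_Hom \<psi> \<sigma>] sset_act_Comp[OF X coface_Hom \<psi> \<sigma>] Comp_assoc[OF Th f inj]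
      by (simp add: GZ_term_def)
    then show "Comp A (alt j (GZ_term X T n (coface n j) (Suc n) ?\<tau>)) (alt i ?T) =
        alt j (alt i (GZ_term X T n (Comp Delta \<psi> (coface n j)) m \<sigma>))"
      using Comp_alt(2)[OF alt_Hom[OF Th] t] Comp_alt(1)[OF Th t] by simp
  qed
  finally show ?thesis .
qed

text \<open>On each summand the square of the differential is a double sum over pairs of faces,
  whose terms cancel in pairs by the cosimplicial identity.\<close>

lemma GZ_chain_complex:
  assumes T: "nsys X T"
  shows "chain_complex (GZ_chain A X T) (GZ_diff A X T)"
  unfolding chain_complex_def
proof (intro allI conjI GZ_diff(1)[OF T])
  fix n
  let ?d = "GZ_diff A X T"
  note C = GZ_chain_Obj[OF T]
  show "Comp A (?d n) (?d (Suc n)) = Zero A (GZ_chain A X T (Suc (Suc n))) (GZ_chain A X T n)"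
  proof (rule GZ_ext[OF T Comp_Hom[OF GZ_diff(1)[OF T] GZ_diff(1)[OF T]] Zero_Hom[OF C C]])
    fix \<sigma> assume \<sigma>: "\<sigma> \<in> simp X (Suc (Suc n))"
    let ?i = "GZ_inj A X T (Suc (Suc n)) \<sigma>" and ?x = "onob T (Suc (Suc n), \<sigma>)" and ?y = "GZ_chain A X T n"
    define s where "s i j = alt j (alt i (GZ_term X T n (Comp Delta (coface (Suc n) i) (coface n j)) (Suc (Suc n)) \<sigma>))"
      for i j
    have w: "GZ_term X T n (Comp Delta (coface (Suc n) i) (coface n j)) (Suc (Suc n)) \<sigma> \<in> Hom A ?x ?y" for i j
      by (rule GZ_term_Hom[OF T Delta_Comp_Hom[OF coface_Hom coface_Hom] \<sigma>])
    have s: "s i j \<in> Hom A ?x ?y" for i j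
      unfolding s_def by (rule alt_Hom[OF alt_Hom[OF w]])
    have "Comp A (Comp A (?d n) (?d (Suc n))) ?i = Comp A (?d n) (Comp A (?d (Suc n)) ?i)"
      using Comp_assoc[OF GZ_inj_Hom[OF T \<sigma>] GZ_diff(1)[OF T] GZ_diff(1)[OF T]] by simp
    also have "\<dots> = hom_sum A ?x ?y
        (\<lambda>i. Comp A (?d n) (alt i (GZ_term X T (Suc n) (coface (Suc n) i) (Suc (Suc n)) \<sigma>))) (Suc n + 2)"
      unfolding GZ_diff(2)[OF T \<sigma>]
      by (rule Comp_hom_sum[OF nsysD(3)[OF T \<sigma>] GZ_diff(1)[OF T]]) (rule alt_Hom[OF GZ_term_Hom[OF T coface_Hom \<sigma>]])
    also have "\<dots> = hom_sum A ?x ?y (\<lambda>i. hom_sum A ?x ?y (s i) (n + 2)) (Suc n + 2)"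
      by (rule hom_sum_cong) (unfold s_def, rule GZ_diff_term[OF T coface_Hom \<sigma>])
    \<comment> \<open>A simplex of dimension n + 2 has n + 3 faces, each with n + 2 faces of its
      own. Writing the outer bound as a successor of the inner one gives the shape required by
      \<open>simplicial_double_sum\<close>.\<close>
    also have "\<dots> = hom_sum A ?x ?y (\<lambda>i. hom_sum A ?x ?y (s i) (n + 2)) (Suc (n + 2))"
      by (simp only: add_Suc)
    also have "\<dots> = Zero A ?x ?y"
      by (rule simplicial_double_sum[OF nsysD(3)[OF T \<sigma>] C s])
        (use alt_cancel[OF w] coface_coface in \<open>simp add: s_def\<close>)
    also have "\<dots> = Comp A (Zero A (GZ_chain A X T (Suc (Suc n))) ?y) ?i"
      using Zero_Comp[OF GZ_inj_Hom[OF T \<sigma>] C] by simp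
    finally show "Comp A (Comp A (?d n) (?d (Suc n))) ?i = Comp A (Zero A (GZ_chain A X T (Suc (Suc n))) ?y) ?i" .
  qed
qed

text \<open>A morphism of pairs consisting of a simplicial set and a coefficient system on it;
  homology is functorial in such pairs.\<close>

definition nsys_map ::
  "'u sset \<Rightarrow> ('u, 'o, 'a) nsys \<Rightarrow> 'u sset \<Rightarrow> ('u, 'o, 'a) nsys \<Rightarrow> 'u smap \<Rightarrow> ('u, 'o, 'a) nsys_arr \<Rightarrow> bool" where
  "nsys_map X T X' T' a t \<longleftrightarrow> nsys X T \<and> nsys X' T' \<and> simplicial_map X X' a \<and>
     t \<in> Hom (nsys_cat A X) T (onob (pull A X X' a) T')"

lemma nsys_mapD:
  assumes "nsys_map X T X' T' a t"
  shows "nsys X T" "nsys X' T'" "simplicial_map X X' a"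
    "x \<in> simp X n \<Longrightarrow> cmp t (n, x) \<in> Hom A (onob T (n, x)) (onob T' (n, a n x))"
    "\<theta> \<in> Hom Delta m n \<Longrightarrow> x \<in> simp X n \<Longrightarrow>
      Comp A (onar T' (sx_arr X' m \<theta> n (a n x))) (cmp t (n, x)) =
      Comp A (cmp t (m, act X \<theta> x)) (onar T (sx_arr X m \<theta> n x))"
proof -
  show T: "nsys X T" and T': "nsys X' T'" and a: "simplicial_map X X' a"
    using assms by (simp_all add: nsys_map_def)
  interpret a: simplicial_over A U X X' a
    by standard (use nsysD[OF T] nsysD[OF T'] a in auto)
  have t: "t \<in> Hom a.opf.FX.FC T (onob a.opf.P T')"
    using assms by (simp add: nsys_map_def a.nsys_X a.pull_f)
  show "cmp t (n, x) \<in> Hom A (onob T (n, x)) (onob T' (n, a n x))" if "x \<in> simp X n"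
    using a.opf.FX.FC_HomD(5)[OF t, of "(n, x)"] that a.pull_onob[OF nsysD(2)[OF T']] by simp
  show "Comp A (onar T' (sx_arr X' m \<theta> n (a n x))) (cmp t (n, x)) =
      Comp A (cmp t (m, act X \<theta> x)) (onar T (sx_arr X m \<theta> n x))"
    if \<theta>: "\<theta> \<in> Hom Delta m n" and x: "x \<in> simp X n"
    using a.opf.FX.FC_HomD(6)[OF t, of "sx_arr X m \<theta> n x"] sx_arr_Hom[OF a.X \<theta> x]
      a.pull_onar[OF nsysD(2)[OF T'] \<theta> x] by simp
qed

lemma GZ_chain_map:
  assumes t: "nsys_map X T X' T' a t"
  shows "GZ_chain_map A X X' a T T' t n \<in> Hom A (GZ_chain A X T n) (GZ_chain A X' T' n)"
    and "\<sigma> \<in> simp X n \<Longrightarrow> Comp A (GZ_chain_map A X X' a T T' t n) (GZ_inj A X T n \<sigma>) =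
      Comp A (GZ_inj A X' T' n (a n \<sigma>)) (cmp t (n, \<sigma>))"
proof -
  note D = nsys_mapD[OF t]
  have h: "Comp A (GZ_inj A X' T' n (a n \<sigma>)) (cmp t (n, \<sigma>)) \<in> Hom A (onob T (n, \<sigma>)) (GZ_chain A X' T' n)"
    if "\<sigma> \<in> simp X n" for \<sigma>
    by (rule Comp_Hom[OF D(4)[OF that] GZ_inj_Hom[OF D(2) smap_simp[OF D(3) that]]])
  note ct = cotuple[OF GZ_coproduct(2)[OF D(1)] GZ_chain_Obj[OF D(2)] h]
  show "GZ_chain_map A X X' a T T' t n \<in> Hom A (GZ_chain A X T n) (GZ_chain A X' T' n)"
    unfolding GZ_chain_map_def GZ_chain_def[of A X T n] by (rule ct(1))
  show "Comp A (GZ_chain_map A X X' a T T' t n) (GZ_inj A X T n \<sigma>) =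
      Comp A (GZ_inj A X' T' n (a n \<sigma>)) (cmp t (n, \<sigma>))" if "\<sigma> \<in> simp X n"
    unfolding GZ_chain_map_def GZ_inj_def[of A X T n] by (rule ct(2)[OF _ that])
qed

text \<open>The identity holds face by face: \<open>a\<close> commutes with the face operators and
  \<open>t\<close> is natural along them, so each signed term on one side matches the term with the
  same index on the other.\<close>

lemma GZ_chain_map_chain_map:
  assumes t: "nsys_map X T X' T' a t"
  shows "chain_map (GZ_chain A X T) (GZ_diff A X T) (GZ_chain A X' T') (GZ_diff A X' T')
    (GZ_chain_map A X X' a T T' t)"
  unfolding chain_map_def
proof (intro conjI allI GZ_chain_map(1)[OF t])
  note D = nsys_mapD[OF t]
  note X = nsysD(1)[OF D(1)]
  note M = GZ_chain_map[OF t] and d = GZ_diff[OF D(1)] and d' = GZ_diff[OF D(2)]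
  show "chain_complex (GZ_chain A X T) (GZ_diff A X T)" "chain_complex (GZ_chain A X' T') (GZ_diff A X' T')"
    using GZ_chain_complex D by simp_all
  fix n
  let ?\<phi> = "GZ_chain_map A X X' a T T' t"
  show "Comp A (GZ_diff A X' T' n) (?\<phi> (Suc n)) = Comp A (?\<phi> n) (GZ_diff A X T n)"
  proof (rule GZ_ext[OF D(1) Comp_Hom[OF M(1) d'(1)] Comp_Hom[OF d(1) M(1)]])
    fix \<sigma> assume \<sigma>: "\<sigma> \<in> simp X (Suc n)"
    note a\<sigma> = smap_simp[OF D(3) \<sigma>]
    let ?i = "GZ_inj A X T (Suc n) \<sigma>" and ?i' = "GZ_inj A X' T' (Suc n) (a (Suc n) \<sigma>)"
    let ?x = "onob T (Suc n, \<sigma>)" and ?y = "GZ_chain A X' T' n"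
    note i = GZ_inj_Hom[OF D(1) \<sigma>] and i' = GZ_inj_Hom[OF D(2) a\<sigma>] and ts = D(4)[OF \<sigma>]
    have "Comp A (Comp A (GZ_diff A X' T' n) (?\<phi> (Suc n))) ?i =
        Comp A (Comp A (GZ_diff A X' T' n) ?i') (cmp t (Suc n, \<sigma>))"
      using Comp_assoc[OF i M(1) d'(1)] M(2)[OF \<sigma>] Comp_assoc[OF ts i' d'(1)] by simp
    also have "\<dots> = hom_sum A ?x ?y
        (\<lambda>i. Comp A (alt i (GZ_term X' T' n (coface n i) (Suc n) (a (Suc n) \<sigma>))) (cmp t (Suc n, \<sigma>))) (n + 2)"
      unfolding d'(2)[OF a\<sigma>]
      by (rule hom_sum_Comp[OF GZ_chain_Obj[OF D(2)] ts]) (rule alt_Hom[OF GZ_term_Hom[OF D(2) coface_Hom a\<sigma>]])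
    also have "\<dots> = hom_sum A ?x ?y (\<lambda>i. Comp A (?\<phi> n) (alt i (GZ_term X T n (coface n i) (Suc n) \<sigma>))) (n + 2)"
    proof (rule hom_sum_cong)
      fix k
      let ?c = "coface n k"
      note c = coface_Hom[of n k]
      note \<tau> = sset_act[OF X c \<sigma>]
      have e: "a n (act X ?c \<sigma>) = act X' ?c (a (Suc n) \<sigma>)"
        by (rule smap_act[OF D(3) c \<sigma>])
      have inj': "GZ_inj A X' T' n (act X' ?c (a (Suc n) \<sigma>)) \<in> Hom A (onob T' (n, act X' ?c (a (Suc n) \<sigma>))) ?y"
        using GZ_inj_Hom[OF D(2) smap_simp[OF D(3) \<tau>]] e by simp
      have t\<tau>: "cmp t (n, act X ?c \<sigma>) \<in> Hom A (onob T (n, act X ?c \<sigma>)) (onob T' (n, act X' ?c (a (Suc n) \<sigma>)))"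
        using D(4)[OF \<tau>] e by simp
      have "Comp A (GZ_term X' T' n ?c (Suc n) (a (Suc n) \<sigma>)) (cmp t (Suc n, \<sigma>)) =
          Comp A (GZ_inj A X' T' n (act X' ?c (a (Suc n) \<sigma>)))
            (Comp A (cmp t (n, act X ?c \<sigma>)) (onar T (sx_arr X n ?c (Suc n) \<sigma>)))"
        using Comp_assoc[OF ts nsys_arr[OF D(2) c a\<sigma>] inj'] D(5)[OF c \<sigma>] by (simp add: GZ_term_def)
      also have "\<dots> = Comp A (?\<phi> n) (GZ_term X T n ?c (Suc n) \<sigma>)"
        using Comp_assoc[OF nsys_arr[OF D(1) c \<sigma>] t\<tau> inj'] M(2)[OF \<tau>] e
          Comp_assoc[OF nsys_arr[OF D(1) c \<sigma>] GZ_inj_Hom[OF D(1) \<tau>] M(1)] by (simp add: GZ_term_def)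
      finally show "Comp A (alt k (GZ_term X' T' n ?c (Suc n) (a (Suc n) \<sigma>))) (cmp t (Suc n, \<sigma>)) =
          Comp A (?\<phi> n) (alt k (GZ_term X T n ?c (Suc n) \<sigma>))"
        using Comp_alt(2)[OF ts GZ_term_Hom[OF D(2) c a\<sigma>]] Comp_alt(1)[OF GZ_term_Hom[OF D(1) c \<sigma>] M(1)] by simp
    qed
    also have "\<dots> = Comp A (?\<phi> n) (Comp A (GZ_diff A X T n) ?i)"
      unfolding d(2)[OF \<sigma>]
      by (rule Comp_hom_sum[OF nsysD(3)[OF D(1) \<sigma>] M(1), symmetric])
        (rule alt_Hom[OF GZ_term_Hom[OF D(1) coface_Hom \<sigma>]])
    also have "\<dots> = Comp A (Comp A (?\<phi> n) (GZ_diff A X T n)) ?i"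
      by (rule Comp_assoc[OF i d(1) M(1)])
    finally show "Comp A (Comp A (GZ_diff A X' T' n) (?\<phi> (Suc n))) ?i = Comp A (Comp A (?\<phi> n) (GZ_diff A X T n)) ?i" .
  qed
qed

lemma GZ_homology_Obj: "nsys X T \<Longrightarrow> GZ_homology A X T n \<in> Obj A"
  unfolding GZ_homology_def by (rule chain_homology_Obj[OF GZ_chain_complex])

lemma GZ_homology_map_Hom:
  "nsys_map X T X' T' a t \<Longrightarrow>
    GZ_homology_map A X X' a T T' t n \<in> Hom A (GZ_homology A X T n) (GZ_homology A X' T' n)"
  unfolding GZ_homology_map_def GZ_homology_def by (rule chain_homology_map_Hom[OF GZ_chain_map_chain_map])

text \<open>Both composite chain maps are determined on summands, where the hypotheses make them
  equal. Stating these hypotheses componentwise avoids forming composites of arrows between systems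
  over different simplicial sets.\<close>

lemma GZ_homology_map_square:
  assumes at: "nsys_map X T X1 T1 a t" and bs: "nsys_map X1 T1 X' T' b s"
    and cu: "nsys_map X T X2 T2 c u" and dv: "nsys_map X2 T2 X' T' d v"
    and sq: "\<And>n x. x \<in> simp X n \<Longrightarrow> b n (a n x) = d n (c n x)"
    and cmp: "\<And>n x. x \<in> simp X n \<Longrightarrow>
      Comp A (cmp s (n, a n x)) (cmp t (n, x)) = Comp A (cmp v (n, c n x)) (cmp u (n, x))"
  shows "Comp A (GZ_homology_map A X1 X' b T1 T' s n) (GZ_homology_map A X X1 a T T1 t n) =
    Comp A (GZ_homology_map A X2 X' d T2 T' v n) (GZ_homology_map A X X2 c T T2 u n)"
proof -
  let ?\<chi> = "\<lambda>n. Comp A (GZ_chain_map A X1 X' b T1 T' s n) (GZ_chain_map A X X1 a T T1 t n)"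
  have inj: "Comp A (Comp A (GZ_chain_map A X1 X' b T1 T' s n) (GZ_chain_map A X X1 a T T1 t n)) (GZ_inj A X T n x) =
      Comp A (GZ_inj A X' T' n (b n (a n x))) (Comp A (cmp s (n, a n x)) (cmp t (n, x)))"
    if at: "nsys_map X T X1 T1 a t" and bs: "nsys_map X1 T1 X' T' b s" and x: "x \<in> simp X n" for X1 T1 a b s t n x
  proof -
    note D = nsys_mapD[OF at] and E = nsys_mapD[OF bs]
    note ax = smap_simp[OF D(3) x]
    show ?thesis
      using Comp_assoc[OF GZ_inj_Hom[OF D(1) x] GZ_chain_map(1)[OF at] GZ_chain_map(1)[OF bs]] GZ_chain_map(2)[OF at x]
        Comp_assoc[OF D(4)[OF x] GZ_inj_Hom[OF D(2) ax] GZ_chain_map(1)[OF bs]] GZ_chain_map(2)[OF bs ax]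
        Comp_assoc[OF D(4)[OF x] E(4)[OF ax] GZ_inj_Hom[OF E(2) smap_simp[OF E(3) ax]]] by simp
  qed
  have eq: "?\<chi> n = Comp A (GZ_chain_map A X2 X' d T2 T' v n) (GZ_chain_map A X X2 c T T2 u n)" for n
    by (rule GZ_ext[OF nsys_mapD(1)[OF at] Comp_Hom[OF GZ_chain_map(1)[OF at] GZ_chain_map(1)[OF bs]]
          Comp_Hom[OF GZ_chain_map(1)[OF cu] GZ_chain_map(1)[OF dv]]])
      (use inj[OF at bs] inj[OF cu dv] sq cmp in simp)
  show ?thesis
    unfolding GZ_homology_map_def
    using chain_homology_map_Comp[OF GZ_chain_map_chain_map[OF at] GZ_chain_map_chain_map[OF bs], of ?\<chi>]
      chain_homology_map_Comp[OF GZ_chain_map_chain_map[OF cu] GZ_chain_map_chain_map[OF dv], of ?\<chi>] eq by simp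
qed

lemma GZ_homology_zero:
  assumes T: "nsys X T" and z: "\<And>n x. x \<in> simp X n \<Longrightarrow> zero_object A (onob T (n, x))"
  shows "zero_object A (GZ_homology A X T n)"
  unfolding GZ_homology_def
proof (rule chain_homology_zero[OF GZ_chain_complex[OF T]])
  note C = GZ_chain_Obj[OF T, of n]
  have "Ident A (GZ_chain A X T n) = Zero A (GZ_chain A X T n) (GZ_chain A X T n)"
  proof (rule GZ_ext[OF T Ident_Hom[OF C] Zero_Hom[OF C C]])
    fix \<sigma> assume \<sigma>: "\<sigma> \<in> simp X n"
    note i = GZ_inj_Hom[OF T \<sigma>]
    show "Comp A (Ident A (GZ_chain A X T n)) (GZ_inj A X T n \<sigma>) =
        Comp A (Zero A (GZ_chain A X T n) (GZ_chain A X T n)) (GZ_inj A X T n \<sigma>)"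
      by (rule zero_object_from[OF z[OF \<sigma>] Comp_Hom[OF i Ident_Hom[OF C]] Comp_Hom[OF i Zero_Hom[OF C C]]])
  qed
  then show "zero_object A (GZ_chain A X T n)"
    using C zero_object_iff by simp
qed

end

section \<open>Chains with coefficients in the Kan extension\<close>

context simplicial_over
begin

lemma unit_nsys_map:
  assumes T: "nsys X T"
  shows "nsys_map X T Y (onob (Lan A X Y f) T) f (Lan_unit A X Y f T)"
  using T adj.F_ob[OF nsysD(2)[OF T]] X Y f by (simp add: nsys_map_def nsys_def nsys_X pull_f)

lemma unit_homology_iso:
  assumes T: "nsys X T"
  shows "is_iso A (GZ_homology_map A X Y f T (onob (Lan A X Y f) T) (Lan_unit A X Y f T) n)"
  unfolding GZ_homology_map_def
proof (rule chain_homology_map_iso[OF GZ_chain_map_chain_map[OF unit_nsys_map[OF T]]])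
  fix n
  let ?L = "onob (Lan A X Y f) T" and ?\<eta> = "Lan_unit A X Y f T"
  note L = nsys_mapD(2)[OF unit_nsys_map[OF T]]
  \<comment> \<open>The fibre over (n, y) consists of pairs with first entry n;
    \<open>Pair n\<close> reindexes it by the simplices themselves, which are the indices of the
    chain object.\<close>
  have "is_coproduct A {x \<in> simp X n. f n x = y} (\<lambda>x. onob T (n, x)) (onob ?L (n, y)) (\<lambda>x. cmp ?\<eta> (n, x))"
    if y: "y \<in> simp Y n" for y
    by (rule coproduct_reindex[OF adj.F_coproduct[OF nsysD(2)[OF T], of "(n, y)"], of "Pair n"])
      (use y in \<open>auto simp: bij_betw_def inj_on_def simplex_functor_simps image_iff\<close>)
  then have "is_coproduct A (simp X n) (\<lambda>x. onob T (n, x)) (GZ_chain A Y ?L n)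
      (\<lambda>x. Comp A (GZ_inj A Y ?L n (f n x)) (cmp ?\<eta> (n, x)))"
    by (rule coproduct_flatten[OF GZ_coproduct(1)[OF L], of n "simp X n" "f n" _ "\<lambda>y x. cmp ?\<eta> (n, x)"])
      (use smap_simp[OF f] in auto)
  \<comment> \<open>By its defining equation the chain map carries the selected injections to the
    regrouped ones, so it is the comparison of two coproducts of one family.\<close>
  then show "is_iso A (GZ_chain_map A X Y f T ?L ?\<eta> n)"
    by (rule coproduct_comparison_iso[OF GZ_coproduct(1)[OF T] _ GZ_chain_map[OF unit_nsys_map[OF T]]])
qed

end

section \<open>Base change\<close>

locale gz_square = cocomp A U + S: simplicial_over A U X Y f + S': simplicial_over A U X' Y' f' +
    a: simplicial_over A U X X' a + b: simplicial_over A U Y Y' b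
  for A :: "('o, 'a) abcat" and U :: "'u itself" and X Y f X' Y' f' a b +
  assumes sq: "x \<in> simp X m \<Longrightarrow> b m (f m x) = f' m (a m x)"
begin

abbreviation "FX \<equiv> fun_cat (sxop X) A"
abbreviation "FY \<equiv> fun_cat (sxop Y) A"
abbreviation "FX' \<equiv> fun_cat (sxop X') A"
abbreviation "FY' \<equiv> fun_cat (sxop Y') A"
abbreviation "L \<equiv> Lan A X Y f"
abbreviation "L' \<equiv> Lan A X' Y' f'"
abbreviation "fs \<equiv> precomposition (sxop X) (sxop Y) A (simplex_functor X f)"
abbreviation "fs' \<equiv> precomposition (sxop X') (sxop Y') A (simplex_functor X' f')"
abbreviation "as \<equiv> precomposition (sxop X) (sxop X') A (simplex_functor X a)"
abbreviation "bs \<equiv> precomposition (sxop Y) (sxop Y') A (simplex_functor Y b)"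

text \<open>Both functors evaluate \<open>G\<close> at the same simplex of Y', and functors are
  extensional, so they are equal and not merely isomorphic. Mates can therefore be formed without a
  coherence isomorphism.\<close>

lemma pull_square_onob:
  assumes G: "is_functor (sxop Y') A G"
  shows "onob fs (onob bs G) = onob as (onob fs' G)"
proof -
  have bG: "is_functor (sxop Y) A (onob bs G)" and fG: "is_functor (sxop X') A (onob fs' G)"
    using b.opf.P_ob(2)[OF G] S'.opf.P_ob(2)[OF G] .
  show ?thesis
  proof (rule functor_eqI[OF S.opf.P_ob(2)[OF bG] a.opf.P_ob(2)[OF fG]])
    fix s assume "s \<in> Obj (sxop X)"
    then obtain n x where s: "s = (n, x)" "x \<in> simp X n"
      by (cases s) auto
    show "onob (onob fs (onob bs G)) s = onob (onob as (onob fs' G)) s"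
      using S.pull_onob[OF bG s(2)] b.pull_onob[OF G smap_simp[OF S.f s(2)]] a.pull_onob[OF fG s(2)]
        S'.pull_onob[OF G smap_simp[OF a.f s(2)]] sq[OF s(2)] by (simp add: s(1))
  next
    fix t assume "t \<in> Arr (sxop X)"
    then have "t \<in> Hom (simplex_cat X) (Dom (simplex_cat X) t) (Cod (simplex_cat X) t)"
      by (simp add: Hom_def)
    then obtain m n \<theta> x where t: "\<theta> \<in> Hom Delta m n" "x \<in> simp X n" "t = sx_arr X m \<theta> n x"
      by (rule simplex_HomE)
    show "onar (onob fs (onob bs G)) t = onar (onob as (onob fs' G)) t"
      using S.pull_onar[OF bG t(1,2)] b.pull_onar[OF G t(1) smap_simp[OF S.f t(2)]] a.pull_onar[OF fG t(1,2)]
        S'.pull_onar[OF G t(1) smap_simp[OF a.f t(2)]] sq[OF t(2)] by (simp add: t(3))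
  qed
qed

lemma pull_square_onar:
  assumes t: "t \<in> Hom FY' G H"
  shows "onar fs (onar bs t) = onar as (onar fs' t)"
proof -
  have G: "is_functor (sxop Y') A G" and H: "is_functor (sxop Y') A H"
    using S'.opf.FY.FC_HomD[OF t] by simp_all
  note bt = b.opf.P_ar(1)[OF t] and ft = S'.opf.P_ar(1)[OF t]
  show ?thesis
  proof (rule S.opf.FX.FC_ext[OF S.opf.P_ar(1)[OF bt]])
    show "onar as (onar fs' t) \<in> Hom FX (onob fs (onob bs G)) (onob fs (onob bs H))"
      using a.opf.P_ar(1)[OF ft] pull_square_onob[OF G] pull_square_onob[OF H] by simp
    fix s assume "s \<in> Obj (sxop X)"
    then obtain n x where s: "s = (n, x)" "x \<in> simp X n"
      by (cases s) auto
    show "cmp (onar fs (onar bs t)) s = cmp (onar as (onar fs' t)) s"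
      using S.pull_cmp[OF bt s(2)] b.pull_cmp[OF t smap_simp[OF S.f s(2)]] a.pull_cmp[OF ft s(2)]
        S'.pull_cmp[OF t smap_simp[OF a.f s(2)]] sq[OF s(2)] by (simp add: s(1))
  qed
qed

text \<open>The formula of \<open>base_change\<close> with \<open>nsys_cat\<close> and
  \<open>pull\<close> unfolded, so that the two coincide by rewriting.\<close>

definition mate :: "('u, 'o, 'a) nsys \<Rightarrow> ('u, 'o, 'a) nsys_arr" where
  "mate = (\<lambda>T'\<in>Obj FX'.
     (THE k. k \<in> Hom FY (onob L (onob as T')) (onob bs (onob L' T')) \<and>
        Comp FX (onar fs k) (Lan_unit A X Y f (onob as T')) = onar as (Lan_unit A X' Y' f' T')))"

lemma mate:
  assumes T': "is_functor (sxop X') A T'"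
  shows "mate T' \<in> Hom FY (onob L (onob as T')) (onob bs (onob L' T'))"
    "Comp FX (onar fs (mate T')) (Lan_unit A X Y f (onob as T')) = onar as (Lan_unit A X' Y' f' T')"
proof -
  note L'T = S'.adj.F_ob[OF T']
  \<comment> \<open>\<open>pull_square_onob\<close> rewrites the codomain as a pullback along f, the
    form in which the universal property of \<open>L\<close> applies.\<close>
  have "onar as (Lan_unit A X' Y' f' T') \<in> Hom FX (onob as T') (onob fs (onob bs (onob L' T')))"
    using a.opf.P_ar(1)[OF L'T(2)] pull_square_onob[OF L'T(1)] by simp
  from theI'[OF S.adj.unit_universal[OF a.opf.P_ob(2)[OF T'] b.opf.P_ob(2)[OF L'T(1)] this]]
  show "mate T' \<in> Hom FY (onob L (onob as T')) (onob bs (onob L' T'))"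
    "Comp FX (onar fs (mate T')) (Lan_unit A X Y f (onob as T')) = onar as (Lan_unit A X' Y' f' T')"
    using T' by (simp_all add: mate_def)
qed

text \<open>Both sides have the same transpose under the adjunction of \<open>L\<close>. The chain
  of equations computes it from the equation defining the mate and the naturality of the two
  units.\<close>

lemma mate_natural:
  assumes t: "t \<in> Hom FX' T1 T2"
  shows "Comp FY (onar bs (onar L' t)) (mate T1) = Comp FY (mate T2) (onar L (onar as t))"
proof -
  let ?\<eta> = "Lan_unit A X Y f" and ?\<eta>' = "Lan_unit A X' Y' f'"
  have T: "is_functor (sxop X') A T1" "is_functor (sxop X') A T2"
    using S'.opf.FX.FC_HomD[OF t] by simp_all
  note m1 = mate[OF T(1)] and m2 = mate[OF T(2)]
  note L't = S'.adj.F_ar[OF t] and at = a.opf.P_ar(1)[OF t]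
  note bLt = b.opf.P_ar(1)[OF L't] and Lat = S.adj.F_ar[OF at]
  note aT = a.opf.P_ob(2)[OF T(1)] a.opf.P_ob(2)[OF T(2)]
  note e1 = S.adj.F_ob(2)[OF aT(1)] and e2 = S.adj.F_ob(2)[OF aT(2)]
  note e1' = S'.adj.F_ob(2)[OF T(1)] and e2' = S'.adj.F_ob(2)[OF T(2)]
  note Cf = functor_Comp[OF S.opf.P_functor] and Ca = functor_Comp[OF a.opf.P_functor]
  note l = S.opf.FY.FC_Comp(1)[OF m1(1) bLt] and r = S.opf.FY.FC_Comp(1)[OF Lat m2(1)]
  have "Comp FX (onar fs (Comp FY (onar bs (onar L' t)) (mate T1))) (?\<eta> (onob as T1)) =
      Comp FX (onar fs (onar bs (onar L' t))) (onar as (?\<eta>' T1))"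
    using Cf[OF m1(1) bLt] S.opf.FX.FC.Comp_assoc[OF e1 S.opf.P_ar(1)[OF m1(1)] S.opf.P_ar(1)[OF bLt]] m1(2) by simp
  also have "\<dots> = onar as (Comp FX' (onar fs' (onar L' t)) (?\<eta>' T1))"
    using pull_square_onar[OF L't] Ca[OF e1' S'.opf.P_ar(1)[OF L't]] by simp
  also have "\<dots> = Comp FX (onar as (?\<eta>' T2)) (onar as t)"
    using S'.adj.unit_natural[OF t] Ca[OF t e2'] by simp
  also have "\<dots> = Comp FX (onar fs (mate T2)) (Comp FX (?\<eta> (onob as T2)) (onar as t))"
    using S.opf.FX.FC.Comp_assoc[OF at e2 S.opf.P_ar(1)[OF m2(1)]] m2(2) by simp
  also have "\<dots> = Comp FX (onar fs (Comp FY (mate T2) (onar L (onar as t)))) (?\<eta> (onob as T1))"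
    using S.adj.unit_natural[OF at] S.opf.FX.FC.Comp_assoc[OF e1 S.opf.P_ar(1)[OF Lat] S.opf.P_ar(1)[OF m2(1)]]
      Cf[OF Lat m2(1)] by simp
  finally have e: "Comp FX (onar fs (Comp FY (onar bs (onar L' t)) (mate T1))) (?\<eta> (onob as T1)) =
      Comp FX (onar fs (Comp FY (mate T2) (onar L (onar as t)))) (?\<eta> (onob as T1))" .
  have "\<exists>!k. k \<in> Hom FY (onob L (onob as T1)) (onob bs (onob L' T2)) \<and>
      Comp FX (onar fs k) (?\<eta> (onob as T1)) =
      Comp FX (onar fs (Comp FY (mate T2) (onar L (onar as t)))) (?\<eta> (onob as T1))"
    by (rule S.adj.unit_universal[OF aT(1) b.opf.P_ob(2)[OF S'.adj.F_ob(1)[OF T(2)]]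
          S.opf.FX.FC_Comp(1)[OF e1 S.opf.P_ar(1)[OF r]]])
  then show ?thesis
    using l r e by blast
qed

text \<open>Shows that the description by \<open>THE\<close> is proper, through
  \<open>delta_morphism_into_exact\<close>. Pullback along b preserves exactness and zero objects,
  so the target is exact in degree 0 and zero above. For the source, pullback along a preserves
  short exact sequences, which gives its connecting morphisms and the vanishing of their composites
  in degree 0.\<close>

lemma mate_sat:
  assumes "\<phi> = (THE \<phi>. delta_morphism FX' FY (dfun_precomp FX' (Lan_sat A X Y f) as)
    (dfun_postcomp FX' bs (Lan_sat A X' Y' f')) \<phi> \<and> \<phi> 0 = mate)"
  shows "\<phi> 0 = mate"
    and "is_functor (sxop X') A T' \<Longrightarrow> \<phi> q T' \<in> Hom FY (onob (comp_at (Lan_sat A X Y f) q) (onob as T'))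
      (onob bs (onob (comp_at (Lan_sat A X' Y' f') q) T'))"
proof -
  let ?S = "dfun_precomp FX' (Lan_sat A X Y f) as" and ?L = "dfun_postcomp FX' bs (Lan_sat A X' Y' f')"
  note D = delta_functorD[OF S.Lan_sat_delta] and D' = delta_functorD[OF S'.Lan_sat_delta]
  have Sob: "onob (comp_at ?S q) c = onob (comp_at (Lan_sat A X Y f) q) (onob as c)"
    and Lob: "onob (comp_at ?L q) c = onob bs (onob (comp_at (Lan_sat A X' Y' f') q) c)"
    if "is_functor (sxop X') A c" for q c
    using that by (simp_all add: dfun_precomp_def dfun_postcomp_def)
  have Sar: "onar (comp_at ?S q) h = onar (comp_at (Lan_sat A X Y f) q) (onar as h)"
    and Lar: "onar (comp_at ?L q) h = onar bs (onar (comp_at (Lan_sat A X' Y' f') q) h)"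
    if "h \<in> Arr FX'" for q h
    using that by (simp_all add: dfun_precomp_def dfun_postcomp_def)
  have Sf: "is_functor FX' FY (comp_at ?S q)" and Lf: "is_functor FX' FY (comp_at ?L q)" for q
    using comp_functor[OF S'.opf.FX.FC_category S.opf.FY.FC_category a.opf.P_functor D(1)]
      comp_functor[OF S'.opf.FX.FC_category S.opf.FY.FC_category D'(1) b.opf.P_functor]
    by (simp_all add: dfun_precomp_def dfun_postcomp_def)
  have "\<exists>!\<phi>. delta_morphism FX' FY ?S ?L \<phi> \<and> \<phi> 0 = mate"
  proof (rule delta_morphism_into_exact[OF S'.opf.FX.FC.preabelian_axioms S.opf.FY.FC.preabelian_axioms Sf _ _ Lf])
    fix g h q assume se: "short_exact FX' g h"
    note s = S'.opf.FX.FC.short_exactD[OF se]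
    have o: "is_functor (sxop X') A (Dom FX' g)" "is_functor (sxop X') A (Cod FX' g)" "is_functor (sxop X') A (Cod FX' h)"
      using S'.opf.FX.FC_HomD[OF s(1)] S'.opf.FX.FC_HomD[OF s(2)] by simp_all
    note ag = a.opf.P_ar(1)[OF s(1)] and ah = a.opf.P_ar(1)[OF s(2)]
    note ase = a.opf.P_short_exact[OF se]
    have c: "conn ?S q g h = conn (Lan_sat A X Y f) q (onar as g) (onar as h)" for q
      by (simp add: dfun_precomp_def)
    show cS: "conn ?S q g h \<in> Hom FY (onob (comp_at ?S (Suc q)) (Cod FX' h)) (onob (comp_at ?S q) (Dom FX' g))" for q
      using D(2)[OF ase, of q] HomD[OF ag] HomD[OF ah] Sob[OF o(1)] Sob[OF o(3)] by (simp add: c)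
    show "Comp FY (onar (comp_at ?S 0) g) (conn ?S 0 g h) =
        Zero FY (onob (comp_at ?S (Suc 0)) (Cod FX' h)) (onob (comp_at ?S 0) (Cod FX' g))"
    proof -
      have "exact_at FY (conn ?S 0 g h) (onar (comp_at ?S 0) g)"
        using D(3)[OF ase, of 0] Sar[OF HomD(1)[OF s(1)]] by (simp add: c)
      then have "Comp FY (onar (comp_at ?S 0) g) (conn ?S 0 g h) =
          Zero FY (Dom FY (conn ?S 0 g h)) (Cod FY (onar (comp_at ?S 0) g))"
        by (simp add: exact_at_def)
      then show ?thesis
        using HomD(2)[OF cS[of 0]] HomD(3)[OF functor_Hom[OF Sf s(1), of 0]] by simp
    qed
    have "conn ?L q g h = onar bs (conn (Lan_sat A X' Y' f') q g h)"
      by (simp add: dfun_postcomp_def)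
    then show "conn ?L q g h \<in> Hom FY (onob (comp_at ?L (Suc q)) (Cod FX' h)) (onob (comp_at ?L q) (Dom FX' g))"
      using b.opf.P_ar(1)[OF D'(2)[OF se, of q]] Lob[OF o(1)] Lob[OF o(3)] by simp
    show "is_mono FY (onar (comp_at ?L 0) g)"
      using S.opf.FY.FC.short_exactD(5)[OF b.opf.P_short_exact[OF S'.adj.F_exact[OF se]]]
        Lar[OF HomD(1)[OF s(1)]] S'.Lan_sat_0 by simp
  next
    fix q c assume "c \<in> Obj FX'"
    then have "is_functor (sxop X') A c" by simp
    then show "zero_object FY (onob (comp_at ?L (Suc q)) c)"
      using b.pull_zero[OF S'.Lan_sat_zero] Lob by simp
  next
    show "is_nat FX' FY (comp_at ?S 0) (comp_at ?L 0) mate"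
    proof (rule is_natI)
      show "mate \<in> extensional (Obj FX')"
        by (simp add: mate_def)
      show "mate T' \<in> Hom FY (onob (comp_at ?S 0) T') (onob (comp_at ?L 0) T')" if "T' \<in> Obj FX'" for T'
        using that mate(1) Sob Lob S.Lan_sat_0 S'.Lan_sat_0 by simp
      show "Comp FY (onar (comp_at ?L 0) t) (mate T1) = Comp FY (mate T2) (onar (comp_at ?S 0) t)"
        if t: "t \<in> Hom FX' T1 T2" for t T1 T2
        using mate_natural[OF t] Sar[OF HomD(1)[OF t]] Lar[OF HomD(1)[OF t]] S.Lan_sat_0 S'.Lan_sat_0 by simp
    qed
  qed
  from theI'[OF this] have \<phi>: "delta_morphism FX' FY ?S ?L \<phi>" "\<phi> 0 = mate"
    unfolding assms by blast+
  show "\<phi> 0 = mate" by (rule \<phi>(2))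
  show "\<phi> q T' \<in> Hom FY (onob (comp_at (Lan_sat A X Y f) q) (onob as T'))
      (onob bs (onob (comp_at (Lan_sat A X' Y' f') q) T'))" if T': "is_functor (sxop X') A T'"
    using is_natD(2)[of FX' FY "comp_at ?S q" "comp_at ?L q" "\<phi> q" T'] \<phi>(1) T' Sob[OF T'] Lob[OF T']
    by (simp add: delta_morphism_def)
qed

text \<open>In degree 0 the induced map sends the summand of x to the summand of its image
  \<open>a n x\<close> through the component of \<open>t\<close>. This is the componentwise
  hypothesis for the naturality square of the edge maps.\<close>

lemma mate_unit:
  assumes T: "is_functor (sxop X) A T" and T': "is_functor (sxop X') A T'"
    and t: "t \<in> Hom FX T (onob as T')"
  defines "s \<equiv> Comp FY (mate T') (onar L t)"
  shows "s \<in> Hom FY (onob L T) (onob bs (onob L' T'))"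
    and "x \<in> simp X n \<Longrightarrow> Comp A (cmp s (n, f n x)) (cmp (Lan_unit A X Y f T) (n, x)) =
      Comp A (cmp (Lan_unit A X' Y' f' T') (n, a n x)) (cmp t (n, x))"
proof -
  note m = mate[OF T'] and Lt = S.adj.F_ar[OF t]
  show s: "s \<in> Hom FY (onob L T) (onob bs (onob L' T'))"
    unfolding s_def by (rule S.opf.FY.FC_Comp(1)[OF Lt m(1)])
  let ?\<eta> = "Lan_unit A X Y f" and ?\<eta>' = "Lan_unit A X' Y' f'"
  note e = S.adj.F_ob(2)[OF T] and e' = S'.adj.F_ob(2)[OF T'] and ea = S.adj.F_ob(2)[OF a.opf.P_ob(2)[OF T']]
  have ae': "onar as (?\<eta>' T') \<in> Hom FX (onob as T') (onob fs (onob bs (onob L' T')))"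
    using a.opf.P_ar(1)[OF e'] pull_square_onob[OF S'.adj.F_ob(1)[OF T']] by simp
  have eq: "Comp FX (onar fs s) (?\<eta> T) = Comp FX (onar as (?\<eta>' T')) t"
    using functor_Comp[OF S.opf.P_functor Lt m(1)] m(2) S.adj.unit_natural[OF t]
      S.opf.FX.FC.Comp_assoc[OF e S.opf.P_ar(1)[OF Lt] S.opf.P_ar(1)[OF m(1)]]
      S.opf.FX.FC.Comp_assoc[OF t ea S.opf.P_ar(1)[OF m(1)]] by (simp add: s_def)
  show "Comp A (cmp s (n, f n x)) (cmp (?\<eta> T) (n, x)) = Comp A (cmp (?\<eta>' T') (n, a n x)) (cmp t (n, x))"
    if x: "x \<in> simp X n"
    using S.opf.FX.FC_Comp(2)[OF e S.opf.P_ar(1)[OF s], of "(n, x)"] S.opf.FX.FC_Comp(2)[OF t ae', of "(n, x)"] x eq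
      S.pull_cmp[OF s x] a.pull_cmp[OF e' x] by simp
qed

end

section \<open>Collapsing spectral sequences\<close>

context cocomp
begin

definition zobj :: 'o where
  "zobj = (SOME z. zero_object A z)"

lemma zobj: "zero_object A zobj"
  unfolding zobj_def by (rule someI_ex[OF zero_object_ex])

definition row_page :: "(nat \<Rightarrow> 'o) \<Rightarrow> int \<Rightarrow> int \<Rightarrow> 'o" where
  "row_page H p q = (if q = 0 \<and> 0 \<le> p then H (nat p) else zobj)"

text \<open>For r \<ge> 2 a differential leaves its row, so with one nonzero row it can only be
  zero. Each page is then its own homology, up to \<open>homol_zero_iso\<close>.\<close>

definition row_spseq :: "(nat \<Rightarrow> 'o) \<Rightarrow> ('o, 'a) spseq" where
  "row_spseq H = (let d = (\<lambda>r p q. Zero A (row_page H p q) (row_page H (p - int r) (q + int r - 1))) in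
     \<lparr>page = (\<lambda>r. row_page H), pd = d,
      next_page = (\<lambda>r p q. homol_zero_iso (d r (p + int r) (q - int r + 1)) (d r p q))\<rparr>)"

text \<open>The only nonzero term of total degree n sits at p = n, so the filtration jumps there
  from zero to all of \<open>H n\<close>.\<close>

definition row_filtr :: "(nat \<Rightarrow> 'o) \<Rightarrow> 'a filtr" where
  "row_filtr H =
     \<lparr>fincl = (\<lambda>n p. if int n \<le> p then Ident A (H n) else Zero A zobj (H n)),
      fgr = (\<lambda>n p. if p = int n then Ident A (H n)
              else if int n < p then Zero A (H n) zobj else Zero A zobj zobj)\<rparr>"

text \<open>Off the row all spectral sequences share the same chosen object \<open>zobj\<close>, so
  its identity serves as the map there.\<close>

definition row_map :: "(nat \<Rightarrow> 'a) \<Rightarrow> nat \<Rightarrow> int \<Rightarrow> int \<Rightarrow> 'a" where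
  "row_map h r p q = (if q = 0 \<and> 0 \<le> p then h (nat p) else Ident A zobj)"

lemma zobj_Obj: "zobj \<in> Obj A"
  by (rule zero_object_Obj[OF zobj])

lemma row_page_Obj: "(\<And>n. H n \<in> Obj A) \<Longrightarrow> row_page H p q \<in> Obj A"
  using zobj_Obj by (simp add: row_page_def)

lemma row_spseq_simps:
  "page (row_spseq H) r = row_page H"
  "pd (row_spseq H) r p q = Zero A (row_page H p q) (row_page H (p - int r) (q + int r - 1))"
  "pd_in (row_spseq H) r p q = Zero A (row_page H (p + int r) (q - int r + 1)) (row_page H p q)"
  "next_page (row_spseq H) r p q =
     homol_zero_iso (Zero A (row_page H (p + int r) (q - int r + 1)) (row_page H p q))
       (Zero A (row_page H p q) (row_page H (p - int r) (q + int r - 1)))"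
  by (simp_all add: row_spseq_def Let_def)

lemma row_spectral_sequence:
  assumes H: "\<And>n. H n \<in> Obj A"
  shows "homology_spectral_sequence A (row_spseq H)" "first_quadrant A (row_spseq H)"
proof -
  note P = row_page_Obj[OF H]
  show "homology_spectral_sequence A (row_spseq H)"
    unfolding homology_spectral_sequence_def row_spseq_simps
    using P Comp_Zero[OF Zero_Hom[OF P P] P] homol_zero_iso(2,3)[OF P P P] by simp
  show "first_quadrant A (row_spseq H)"
    using zobj by (auto simp: first_quadrant_def row_spseq_simps row_page_def)
qed

lemma row_converges:
  assumes H: "\<And>n. H n \<in> Obj A"
  shows "converges A (row_spseq H) H (row_filtr H)"
  unfolding converges_def
proof (intro allI)
  fix n p
  let ?i = "fincl (row_filtr H)" and ?g = "fgr (row_filtr H) n p"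
  let ?Z = "Zero A zobj (H n)"
  have Z: "?Z \<in> Hom A zobj (H n)" "Zero A (H n) zobj \<in> Hom A (H n) zobj" "Zero A zobj zobj \<in> Hom A zobj zobj"
    using H zobj_Obj by simp_all
  have I: "Ident A (H n) \<in> Hom A (H n) (H n)" using H by simp
  have mono_Z: "is_mono A ?Z"
    by (rule monoI[OF Z(1)]) (rule zero_object_to[OF zobj])
  have mono: "is_mono A (?i n p)" for p
    using mono_Z iso_mono[OF iso_Ident[OF H]] by (simp add: row_filtr_def)
  have "\<exists>j. j \<in> Hom A (Dom A (?i n (p - 1))) (Dom A (?i n p)) \<and> Comp A (?i n p) j = ?i n (p - 1) \<and> is_cokernel A j ?g"
  proof -
    \<comment> \<open>At the jump the inclusion starts at a zero object and its cokernel is all of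
      \<open>H n\<close>. Above it the inclusion is an identity with zero cokernel; below it
      everything is zero.\<close>
    consider "p = int n" | "int n < p" | "p < int n" by linarith
    then show ?thesis
    proof cases
      case 1
      have "is_cokernel A ?Z (Ident A (H n))"
        by (rule cokernelI[OF Z(1) I])
          (use Comp_Ident[OF Z(1)] iso_epi[OF iso_Ident[OF H]] Comp_Ident(1) in auto)
      then show ?thesis
        using 1 Z(1) Comp_Ident[OF Z(1)] HomD[OF Z(1)] HomD[OF I]
        by (intro exI[of _ ?Z]) (simp add: row_filtr_def)
    next
      case 2
      have "is_cokernel A (Ident A (H n)) (Zero A (H n) zobj)"
      proof (rule cokernelI[OF I Z(2)])
        show "is_epi A (Zero A (H n) zobj)"
          by (rule epiI[OF Z(2)]) (rule zero_object_from[OF zobj])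
        show "\<exists>u\<in>Hom A zobj w. Comp A u (Zero A (H n) zobj) = h"
          if h: "h \<in> Hom A (H n) w" "Comp A h (Ident A (H n)) = Zero A (H n) w" for w h
          using h Comp_Ident(1)[OF h(1)] Zero_Hom[OF zobj_Obj Hom_Obj(2)[OF h(1)]]
            Comp_Zero[OF Zero_Hom[OF zobj_Obj Hom_Obj(2)[OF h(1)]] H] by metis
      qed (use Comp_Ident[OF Z(2)] in simp)
      then show ?thesis
        using 2 I Comp_Ident[OF I] HomD[OF I]
        by (intro exI[of _ "Ident A (H n)"]) (simp add: row_filtr_def)
    next
      case 3
      have c: "is_cokernel A (Zero A zobj zobj) (Zero A zobj zobj)"
      proof (rule cokernelI[OF Z(3) Z(3) Comp_Zero[OF Z(3) zobj_Obj]])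
        show "is_epi A (Zero A zobj zobj)"
          by (rule epiI[OF Z(3)]) (rule zero_object_from[OF zobj])
        show "\<exists>u\<in>Hom A zobj w. Comp A u (Zero A zobj zobj) = h" if h: "h \<in> Hom A zobj w" for w h
          using h zero_object_from[OF zobj Comp_Hom[OF Z(3) h] h] by blast
      qed
      then show ?thesis
        using 3 Z Comp_Zero[OF Z(1) zobj_Obj] HomD[OF Z(1)]
        by (intro exI[of _ "Zero A zobj zobj"]) (simp add: row_filtr_def)
    qed
  qed
  moreover have "p < 0 \<longrightarrow> zero_object A (Dom A (?i n p))"
    using zobj HomD[OF Z(1)] by (simp add: row_filtr_def)
  moreover have "Cod A ?g = page (row_spseq H) (limit_page n) p (int n - p)"
    using HomD[OF Z(2)] HomD[OF Z(3)] HomD[OF I] by (auto simp: row_filtr_def row_spseq_simps row_page_def)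
  moreover have "Cod A (?i n p) = H n" "int n \<le> p \<longrightarrow> is_iso A (?i n p)"
    using HomD[OF Z(1)] HomD[OF I] iso_Ident[OF H] by (simp_all add: row_filtr_def)
  ultimately show "is_mono A (?i n p) \<and> Cod A (?i n p) = H n \<and> (p < 0 \<longrightarrow> zero_object A (Dom A (?i n p))) \<and>
      (int n \<le> p \<longrightarrow> is_iso A (?i n p)) \<and>
      (\<exists>j. j \<in> Hom A (Dom A (?i n (p - 1))) (Dom A (?i n p)) \<and> Comp A (?i n p) j = ?i n (p - 1) \<and> is_cokernel A j ?g) \<and>
      Cod A ?g = page (row_spseq H) (limit_page n) p (int n - p)"
    using mono by blast
qed

lemma row_map_morphism:
  assumes h: "\<And>n. h n \<in> Hom A (H n) (H' n)"
  shows "spseq_morphism A (row_spseq H) (row_spseq H') (row_map h)"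
    "convergence_compatible A (row_filtr H) (row_filtr H') (row_map h) h"
proof -
  have H: "\<And>n. H n \<in> Obj A" "\<And>n. H' n \<in> Obj A"
    using Hom_Obj[OF h] by simp_all
  note P = row_page_Obj[OF H(1)] and P' = row_page_Obj[OF H(2)]
  have m: "row_map h r p q \<in> Hom A (row_page H p q) (row_page H' p q)" for r p q
    using h zobj_Obj by (simp add: row_map_def row_page_def)
  have suc: "row_map h (Suc r) p q = row_map h r p q" for r p q
    by (simp add: row_map_def)
  show "spseq_morphism A (row_spseq H) (row_spseq H') (row_map h)"
    unfolding spseq_morphism_def row_spseq_simps suc
    using m Zero_Comp[OF m P'] Comp_Zero[OF m P] homol_zero_iso_natural[OF P P P P' P' P' m] by simp
  show "convergence_compatible A (row_filtr H) (row_filtr H') (row_map h) h"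
    unfolding convergence_compatible_def
  proof (intro allI)
    fix n p
    have Z: "Zero A zobj (H n) \<in> Hom A zobj (H n)" "Zero A zobj (H' n) \<in> Hom A zobj (H' n)"
      using H zobj_Obj by simp_all
    have I: "Ident A (H n) \<in> Hom A (H n) (H n)" "Ident A (H' n) \<in> Hom A (H' n) (H' n)" "Ident A zobj \<in> Hom A zobj zobj"
      using H zobj_Obj by simp_all
    note d = HomD(2)[OF Z(1)] HomD(2)[OF Z(2)] HomD(2)[OF I(1)] HomD(2)[OF I(2)]
    \<comment> \<open>The restriction of the map to the filtration: \<open>h n\<close> from the jump
      on, and the identity of the zero object before it.\<close>
    let ?t = "if int n \<le> p then h n else Ident A zobj"
    consider "p = int n" | "int n < p" | "p < int n" by linarith
    then show "\<exists>t. t \<in> Hom A (Dom A (fincl (row_filtr H) n p)) (Dom A (fincl (row_filtr H') n p)) \<and>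
        Comp A (fincl (row_filtr H') n p) t = Comp A (h n) (fincl (row_filtr H) n p) \<and>
        Comp A (fgr (row_filtr H') n p) t =
        Comp A (row_map h (limit_page n) p (int n - p)) (fgr (row_filtr H) n p)"
    proof cases
      case 1
      then show ?thesis
        using h[of n] d Comp_Ident[OF h[of n]] by (intro exI[of _ ?t]) (simp add: row_filtr_def row_map_def)
    next
      case 2
      have "Zero A (H n) zobj \<in> Hom A (H n) zobj"
        using H zobj_Obj by simp
      then show ?thesis
        using 2 h[of n] d Comp_Ident[OF h[of n]] Zero_Comp[OF h[of n] zobj_Obj] Comp_Ident(2)[of "Zero A (H n) zobj"]
        by (intro exI[of _ ?t]) (simp add: row_filtr_def row_map_def)
    next
      case 3
      have "Zero A zobj zobj \<in> Hom A zobj zobj"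
        using zobj_Obj by simp
      then show ?thesis
        using 3 I(3) d Comp_Ident(1)[OF Z(2)] Comp_Zero[OF h[of n] zobj_Obj] Comp_Ident[of "Zero A zobj zobj" zobj zobj]
        by (intro exI[of _ ?t]) (simp add: row_filtr_def row_map_def)
    qed
  qed
qed

section \<open>The spectral sequence\<close>

text \<open>The map induced by f together with the unit of the Kan extension. It goes from the
  abutment to the bottom row of the second page and so has the shape of an edge
  homomorphism.\<close>

definition edge_map :: "('u, 'o, 'a) gz_obj \<Rightarrow> nat \<Rightarrow> 'a" where
  "edge_map P n = GZ_homology_map A (src P) (tgt P) (smap P) (coef P)
     (onob (Lan A (src P) (tgt P) (smap P)) (coef P)) (Lan_unit A (src P) (tgt P) (smap P) (coef P)) n"

text \<open>Above the bottom row the page is \<open>zobj\<close> and the second term is a zero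
  object, so the zero arrow between them is an isomorphism.\<close>

definition E2_iso :: "('u, 'o, 'a) gz_obj \<Rightarrow> nat \<Rightarrow> nat \<Rightarrow> 'a" where
  "E2_iso P p q = (if q = 0 then edge_map P p else Zero A zobj (E2_term A P p q))"

lemma gz_objD:
  assumes "is_gz_obj A (P :: ('u, 'o, 'a) gz_obj)"
  shows "simplicial_over A U (src P) (tgt P) (smap P)" "nsys (src P) (coef P)"
proof -
  show "nsys (src P) (coef P)"
    using assms by (simp add: is_gz_obj_def nsys_def)
  show "simplicial_over A U (src P) (tgt P) (smap P)"
    using assms cocomp_axioms by (simp add: is_gz_obj_def simplicial_over_def simplicial_over_axioms_def)
qed

lemma Lan_coef:
  assumes P: "is_gz_obj A (P :: ('u, 'o, 'a) gz_obj)"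
  shows "nsys (tgt P) (Lan_coef A P q)"
    "Lan_coef A P 0 = onob (Lan A (src P) (tgt P) (smap P)) (coef P)"
    "zero_object A (E2_term A P p (Suc q))"
    "E2_term A P p q \<in> Obj A"
proof -
  interpret S: simplicial_over A U "src P" "tgt P" "smap P"
    by (rule gz_objD(1)[OF P])
  note T = nsysD(2)[OF gz_objD(2)[OF P]]
  show n: "nsys (tgt P) (Lan_coef A P q)" for q
    using functor_Obj[OF delta_functorD(1)[OF S.Lan_sat_delta], of "coef P" q] T S.Y
    by (simp add: nsys_def Lan_coef_def)
  show "Lan_coef A P 0 = onob (Lan A (src P) (tgt P) (smap P)) (coef P)"
    by (simp add: Lan_coef_def S.Lan_sat_0)
  have z: "zero_object S.opf.FY.FC (Lan_coef A P (Suc q))"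
    unfolding Lan_coef_def by (rule S.Lan_sat_zero[OF T])
  show "zero_object A (E2_term A P p (Suc q))"
    unfolding E2_term_def by (rule GZ_homology_zero[OF n]) (use S.opf.FY.FC_zero_objectD[OF z] in simp)
  show "E2_term A P p q \<in> Obj A"
    unfolding E2_term_def by (rule GZ_homology_Obj[OF n])
qed

lemma abutment_Obj: "is_gz_obj A (P :: ('u, 'o, 'a) gz_obj) \<Longrightarrow> abutment A P n \<in> Obj A"
  unfolding abutment_def by (rule GZ_homology_Obj[OF gz_objD(2)])

lemma E2_iso:
  assumes P: "is_gz_obj A (P :: ('u, 'o, 'a) gz_obj)"
  shows "E2_iso P p q \<in> Hom A (row_page (abutment A P) (int p) (int q)) (E2_term A P p q)"
    "is_iso A (E2_iso P p q)"
proof -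
  interpret S: simplicial_over A U "src P" "tgt P" "smap P"
    by (rule gz_objD(1)[OF P])
  note T = gz_objD(2)[OF P] and LC = Lan_coef[OF P]
  have "E2_iso P p q \<in> Hom A (row_page (abutment A P) (int p) (int q)) (E2_term A P p q) \<and> is_iso A (E2_iso P p q)"
  proof (cases q)
    case 0
    then show ?thesis
      using GZ_homology_map_Hom[OF S.unit_nsys_map[OF T]] S.unit_homology_iso[OF T] LC(2)
      by (simp add: E2_iso_def edge_map_def row_page_def abutment_def E2_term_def)
  next
    case (Suc k)
    note z = LC(3)[of p k]
    have i: "Zero A zobj (E2_term A P p (Suc k)) \<in> Hom A zobj (E2_term A P p (Suc k))"
      "Zero A (E2_term A P p (Suc k)) zobj \<in> Hom A (E2_term A P p (Suc k)) zobj"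
      using zobj_Obj zero_object_Obj[OF z] by simp_all
    have "is_iso A (Zero A zobj (E2_term A P p (Suc k)))"
      by (rule isoI[OF i zero_object_to[OF zobj Comp_Hom[OF i] Ident_Hom[OF zobj_Obj]]
            zero_object_to[OF z Comp_Hom[OF i(2,1)] Ident_Hom[OF zero_object_Obj[OF z]]]])
    then show ?thesis
      using Suc i(1) by (simp add: E2_iso_def row_page_def)
  qed
  then show "E2_iso P p q \<in> Hom A (row_page (abutment A P) (int p) (int q)) (E2_term A P p q)"
    "is_iso A (E2_iso P p q)" by simp_all
qed

text \<open>Above the bottom row both composites start at a zero object. On the bottom row the
  square consists of maps on Gabriel-Zisman homology, and \<open>mate_unit\<close> verifies it on
  each summand.\<close>

lemma gz_mor_naturality:
  assumes P: "is_gz_obj A (P :: ('u, 'o, 'a) gz_obj)" and P': "is_gz_obj A P'" and M: "is_gz_mor A P P' M"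
  shows "abutment_map A P P' M n \<in> Hom A (abutment A P n) (abutment A P' n)"
    "Comp A (E2_iso P' p q) (row_map (abutment_map A P P' M) r (int p) (int q)) =
     Comp A (E2_map A P P' M p q) (E2_iso P p q)"
proof -
  let ?X = "src P" and ?Y = "tgt P" and ?f = "smap P" and ?X' = "src P'" and ?Y' = "tgt P'" and ?f' = "smap P'"
    and ?a = "on_src M" and ?b = "on_tgt M" and ?T = "coef P" and ?T' = "coef P'" and ?t = "on_coef M"
  interpret S: simplicial_over A U ?X ?Y ?f by (rule gz_objD(1)[OF P])
  interpret S': simplicial_over A U ?X' ?Y' ?f' by (rule gz_objD(1)[OF P'])
  interpret sq: gz_square A U ?X ?Y ?f ?X' ?Y' ?f' ?a ?b
    by standard (use M S.X S.Y S'.X S'.Y in \<open>auto simp: is_gz_mor_def\<close>)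
  note T = gz_objD(2)[OF P] and T' = gz_objD(2)[OF P']
  have t: "?t \<in> Hom sq.FX ?T (onob sq.as ?T')"
    using M by (simp add: is_gz_mor_def nsys_cat_def pull_def)
  have at: "nsys_map ?X ?T ?X' ?T' ?a ?t"
    using M T T' by (simp add: is_gz_mor_def nsys_map_def)
  show h: "abutment_map A P P' M n \<in> Hom A (abutment A P n) (abutment A P' n)" for n
    unfolding abutment_map_def abutment_def by (rule GZ_homology_map_Hom[OF at])
  have bc: "base_change A P P' M = sq.mate"
    by (simp add: base_change_def Let_def sq.mate_def nsys_cat_def pull_def)
  have "base_change_sat A P P' M = (THE \<phi>. delta_morphism sq.FX' sq.FY (dfun_precomp sq.FX' (Lan_sat A ?X ?Y ?f) sq.as)
      (dfun_postcomp sq.FX' sq.bs (Lan_sat A ?X' ?Y' ?f')) \<phi> \<and> \<phi> 0 = sq.mate)"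
    unfolding base_change_sat_def Let_def bc nsys_cat_def pull_def by (rule refl)
  note ms = sq.mate_sat[OF this]
  have s: "sat_map A P P' M q \<in> Hom sq.FY (Lan_coef A P q) (onob sq.bs (Lan_coef A P' q))" for q
    unfolding sat_map_def Lan_coef_def S.nsys_Y
    using S.opf.FY.FC_Comp(1)[OF functor_Hom[OF delta_functorD(1)[OF S.Lan_sat_delta] t] ms(2)[OF nsysD(2)[OF T']]]
    by simp
  have dv: "nsys_map ?Y (Lan_coef A P q) ?Y' (Lan_coef A P' q) ?b (sat_map A P P' M q)" for q
    using s Lan_coef(1)[OF P] Lan_coef(1)[OF P'] sq.b.f by (simp add: nsys_map_def nsys_cat_def pull_def)
  have E: "E2_map A P P' M p q \<in> Hom A (E2_term A P p q) (E2_term A P' p q)" for q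
    unfolding E2_map_def E2_term_def by (rule GZ_homology_map_Hom[OF dv])
  \<comment> \<open>In degree 0 the extension to the satellites is the mate itself, so the map on
    coefficients becomes the arrow treated by \<open>mate_unit\<close>.\<close>
  have s0: "sat_map A P P' M 0 = Comp sq.FY (sq.mate ?T') (onar (Lan A ?X ?Y ?f) ?t)"
    by (simp add: sat_map_def ms(1) S.Lan_sat_0 nsys_cat_def)
  have "Comp A (edge_map P' p) (abutment_map A P P' M p) = Comp A (E2_map A P P' M p 0) (edge_map P p)"
    unfolding edge_map_def abutment_map_def E2_map_def Lan_coef(2)[OF P] Lan_coef(2)[OF P']
  proof (rule GZ_homology_map_square[OF at S'.unit_nsys_map[OF T'] S.unit_nsys_map[OF T]
        dv[of 0, unfolded Lan_coef(2)[OF P] Lan_coef(2)[OF P']]])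
    fix n x assume x: "x \<in> simp ?X n"
    show "?f' n (?a n x) = ?b n (?f n x)"
      using sq.sq[OF x] by simp
    show "Comp A (cmp (Lan_unit A ?X' ?Y' ?f' ?T') (n, ?a n x)) (cmp ?t (n, x)) =
        Comp A (cmp (sat_map A P P' M 0) (n, ?f n x)) (cmp (Lan_unit A ?X ?Y ?f ?T) (n, x))"
      using sq.mate_unit(2)[OF nsysD(2)[OF T] nsysD(2)[OF T'] t x] by (simp add: s0)
  qed
  then have q0: "Comp A (E2_iso P' p 0) (row_map (abutment_map A P P' M) r (int p) (int 0)) =
      Comp A (E2_map A P P' M p 0) (E2_iso P p 0)"
    by (simp add: E2_iso_def row_map_def)
  show "Comp A (E2_iso P' p q) (row_map (abutment_map A P P' M) r (int p) (int q)) =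
      Comp A (E2_map A P P' M p q) (E2_iso P p q)"
  proof (cases q)
    case 0
    then show ?thesis using q0 by simp
  next
    case (Suc k)
    have e: "E2_iso P p q \<in> Hom A zobj (E2_term A P p q)" "E2_iso P' p q \<in> Hom A zobj (E2_term A P' p q)"
      using E2_iso(1)[OF P, of p q] E2_iso(1)[OF P', of p q] Suc by (simp_all add: row_page_def)
    show ?thesis
      using zero_object_from[OF zobj Comp_Hom[OF Ident_Hom[OF zobj_Obj] e(2)] Comp_Hom[OF e(1) E]] Suc
      by (simp add: row_map_def)
  qed
qed

end

theorem theorem2p12:
  fixes A :: "('o, 'a) abcat"
  assumes "infinite (UNIV :: 'u set)"
    and "is_abelian A"
    and "cocomplete TYPE('u) A"
    and "exact_coproducts TYPE('u) A"
  shows "\<exists>(S :: ('u, 'o, 'a) gz_obj \<Rightarrow> ('o, 'a) spseq)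
           (e :: ('u, 'o, 'a) gz_obj \<Rightarrow> nat \<Rightarrow> nat \<Rightarrow> 'a)
           (Fl :: ('u, 'o, 'a) gz_obj \<Rightarrow> 'a filtr).
    (\<forall>P. is_gz_obj A P \<longrightarrow>
       homology_spectral_sequence A (S P) \<and> first_quadrant A (S P) \<and>
       (\<forall>p q. is_iso A (e P p q) \<and> e P p q \<in> Hom A (page (S P) 2 (int p) (int q)) (E2_term A P p q)) \<and>
       converges A (S P) (abutment A P) (Fl P)) \<and>
    (\<forall>P P' M. is_gz_obj A P \<and> is_gz_obj A P' \<and> is_gz_mor A P P' M \<longrightarrow>
       (\<exists>\<Phi>. spseq_morphism A (S P) (S P') \<Phi> \<and>
          (\<forall>p q. Comp A (e P' p q) (\<Phi> 2 (int p) (int q)) = Comp A (E2_map A P P' M p q) (e P p q)) \<and>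
          convergence_compatible A (Fl P) (Fl P') \<Phi> (abutment_map A P P' M)))"
proof -
  interpret cocomp A "TYPE('u)"
    by standard (use assms in auto)
  show ?thesis
  proof (intro exI conjI allI impI)
    fix P :: "('u, 'o, 'a) gz_obj" assume P: "is_gz_obj A P"
    note o = abutment_Obj[OF P]
    \<comment> \<open>These goals fix the existential witnesses by unification:
      \<open>row_spseq\<close> and \<open>row_filtr\<close> of the abutment, and
      \<open>E2_iso\<close>. In the second block the morphism becomes \<open>row_map\<close> of the
      map on abutments.\<close>
    show "homology_spectral_sequence A (row_spseq (abutment A P))" "first_quadrant A (row_spseq (abutment A P))"
      "converges A (row_spseq (abutment A P)) (abutment A P) (row_filtr (abutment A P))"
      using row_spectral_sequence[OF o] row_converges[OF o] by simp_all
    fix p q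
    show "is_iso A (E2_iso P p q)"
      "E2_iso P p q \<in> Hom A (page (row_spseq (abutment A P)) 2 (int p) (int q)) (E2_term A P p q)"
      using E2_iso[OF P] by (simp_all add: row_spseq_simps)
  next
    fix P P' :: "('u, 'o, 'a) gz_obj" and M :: "('u, 'o, 'a) gz_mor"
    assume "is_gz_obj A P \<and> is_gz_obj A P' \<and> is_gz_mor A P P' M"
    then have PM: "is_gz_obj A P" "is_gz_obj A P'" "is_gz_mor A P P' M" by blast+
    note nat = gz_mor_naturality[OF PM]
    show "spseq_morphism A (row_spseq (abutment A P)) (row_spseq (abutment A P')) (row_map (abutment_map A P P' M))"
      "convergence_compatible A (row_filtr (abutment A P)) (row_filtr (abutment A P'))
        (row_map (abutment_map A P P' M)) (abutment_map A P P' M)"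
      using row_map_morphism[OF nat(1)] by simp_all
    show "Comp A (E2_iso P' p q) (row_map (abutment_map A P P' M) 2 (int p) (int q)) =
        Comp A (E2_map A P P' M p q) (E2_iso P p q)" for p q
      by (rule nat(2))
  qed
qed

end
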